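(* Let $\alpha>-1$ and let $X=\{(\lambda,m_\lambda)\}_{\lambda\in\Lambda}$ be a divisor in $\mathbb{D}$. (a) If $X$ is a sampling divisor for $\mathcal{A}^2_\alpha$, then $X$ satisfies the finite overlap condition and there exists $0<C_X<\alpha+1$ such that $$\bigcup_{\lambda\in\Lambda} D\left(\lambda,\sqrt{\frac{m_\lambda+C_X}{m_\lambda+\alpha+1}}\right)=\mathbb{D}.$$ (b) Conversely, suppose that $X$ satisfies the finite overlap condition, with overlap constant $S_X$. There is a constant $C>1$ depending on $S_X$ ($\alpha$ being fixed; $C$ depends on $X$ only through $S_X$) such that if for some compact set $K\subset\mathbb{D}$ we have $$\bigcup_{\lambda\in\Lambda,\ m_\lambda>C} D\left(\lambda,\sqrt{\frac{m_\lambda-C}{m_\lambda+\alpha+1}}\right)=\mathbb{D}\setminus K,$$ then $X$ is a sampling divisor for $\mathcal{A}^2_\alpha$.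
   Context: $\mathbb{D}$ is the open unit disk in $\mathbb{C}$. For $\alpha>-1$, $\mathcal{A}^2_\alpha$ is the space of holomorphic functions $f$ on $\mathbb{D}$ with $\|f\|_{\alpha,2}^2=\int_{\mathbb{D}}|f|^2\,dA_\alpha<\infty$, where $dA_\alpha(z)=(1+\alpha)(1-|z|^2)^\alpha\,dx\,dy/\pi$, with scalar product $\langle f,g\rangle=\int_{\mathbb{D}} f\overline{g}\,dA_\alpha$. Its standard orthonormal basis is $e_n(z)=\sqrt{\frac{\Gamma(n+2+\alpha)}{n!\,\Gamma(2+\alpha)}}\,z^n$, $n\ge 0$. For $\lambda\in\mathbb{D}$ put $\varphi_\lambda(z)=\frac{\lambda-z}{1-\overline{\lambda}z}$ and let $T_\lambda f(z)=[\varphi_\lambda'(z)]^{(2+\alpha)/2}f(\varphi_\lambda(z))$, an isometry of $\mathcal{A}^2_\alpha$ (a holomorphic branch of the power is fixed; changing it only multiplies $T_\lambda$ by a unimodular constant and is immaterial here). The pseudohyperbolic distance is $\rho(u,v)=|\varphi_u(v)|$ and $D(\lambda,r)=\{z\in\mathbb{D}:\rho(\lambda,z)<r\}$. A divisor is a set $X=\{(\lambda,m_\lambda)\}_{\lambda\in\Lambda}$, where $\Lambda\subset\mathbb{D}$ is a set of (distinct) points and each $m_\lambda\ge 1$ is an integer (multiplicity). $X$ is sampling for $\mathcal{A}^2_\alpha$ if there is a constant $C'>0$ such that for all $f\in\mathcal{A}^2_\alpha$: $\frac1{C'}\sum_{\lambda\in\Lambda}\sum_{0\le j<m_\lambda}|\langle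 f,T_\lambda e_j\rangle|^2\le\|f\|_{\alpha,2}^2\le C'\sum_{\lambda\in\Lambda}\sum_{0\le j<m_\lambda}|\langle f,T_\lambda e_j\rangle|^2$. $X$ satisfies the finite overlap condition (for $\mathcal{A}^2_\alpha$) if $S_X:=\sup_{z\in\mathbb{D}}\sum_{\lambda\in\Lambda}\chi_{D\left(\lambda,\sqrt{m_\lambda/(m_\lambda+\alpha+1)}\right)}(z)<\infty$, where $\chi_E$ denotes the indicator function of $E$. *)

theory Defs
  imports "HOL-Complex_Analysis.Complex_Analysis"
begin

abbreviation unit_disk :: "complex set" where
  "unit_disk \<equiv> ball 0 1"

definition dA :: "real \<Rightarrow> complex measure" where
  "dA \<alpha> = density (restrict_space lborel unit_disk)
     (\<lambda>z. ennreal ((1 + \<alpha>) * (1 - (cmod z)\<^sup>2) powr \<alpha> / pi))"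

text \<open>Elements are functions on the whole plane; only their values on the disk matter, since
  \<open>dA\<close> lives on the disk.\<close>

definition bergman :: "real \<Rightarrow> (complex \<Rightarrow> complex) set" where
  "bergman \<alpha> = {f. f holomorphic_on unit_disk \<and> integrable (dA \<alpha>) (\<lambda>z. (cmod (f z))\<^sup>2)}"

definition bergman_norm :: "real \<Rightarrow> (complex \<Rightarrow> complex) \<Rightarrow> real" where
  "bergman_norm \<alpha> f = sqrt (\<integral>z. (cmod (f z))\<^sup>2 \<partial>dA \<alpha>)"

definition bergman_inner :: "real \<Rightarrow> (complex \<Rightarrow> complex) \<Rightarrow> (complex \<Rightarrow> complex) \<Rightarrow> complex" where
  "bergman_inner \<alpha> f g = (\<integral>z. f z * cnj (g z) \<partial>dA \<alpha>)"

definition bergman_basis :: "real \<Rightarrow> nat \<Rightarrow> complex \<Rightarrow> complex" where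
  "bergman_basis \<alpha> n z =
     of_real (sqrt (Gamma (real n + 2 + \<alpha>) / (fact n * Gamma (2 + \<alpha>)))) * z ^ n"

definition disk_aut :: "complex \<Rightarrow> complex \<Rightarrow> complex" where
  "disk_aut a z = (a - z) / (1 - cnj a * z)"

text \<open>An arbitrary but fixed holomorphic branch on the disk of the logarithm of the derivative
  of \<open>disk_aut a\<close>. The principal logarithm would not do: the derivative is a negative real at 0.
  Two branches differ by an additive constant in \<open>2\<pi>\<i>\<int>\<close>, so the choice changes \<open>bergman_shift\<close> by a
  unimodular factor only.\<close>

definition log_deriv_aut :: "complex \<Rightarrow> complex \<Rightarrow> complex" where
  "log_deriv_aut a = (SOME L. L holomorphic_on unit_disk \<and>
     (\<forall>z\<in>unit_disk. exp (L z) = deriv (disk_aut a) z))"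

lemma log_deriv_aut:
  assumes "a \<in> unit_disk"
  shows "log_deriv_aut a holomorphic_on unit_disk"
    and "z \<in> unit_disk \<Longrightarrow> exp (log_deriv_aut a z) = deriv (disk_aut a) z"
proof -
  have l: "cmod a < 1" using assms by simp
  have nz: "1 - cnj a * z \<noteq> 0" if "z \<in> unit_disk" for z
  proof
    assume "1 - cnj a * z = 0"
    then have "cmod a * cmod z = 1"
      by (metis complex_mod_cnj eq_iff_diff_eq_0 norm_mult norm_one)
    moreover have "cmod a * cmod z < 1"
      using l that mult_strict_mono'[of "cmod a" 1 "cmod z" 1] by simp
    ultimately show False by simp
  qed
  have d: "(disk_aut a has_field_derivative
      (cnj a * a - 1) / (1 - cnj a * z)\<^sup>2) (at z)" if "z \<in> unit_disk" for z
    unfolding disk_aut_def using nz[OF that]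
    by (auto intro!: derivative_eq_intros simp: power2_eq_square field_simps)
  have "disk_aut a holomorphic_on unit_disk"
    unfolding holomorphic_on_open[OF open_ball] using d by blast
  then have hol: "deriv (disk_aut a) holomorphic_on unit_disk"
    by (rule holomorphic_deriv) simp
  have "deriv (disk_aut a) z \<noteq> 0" if "z \<in> unit_disk" for z
  proof -
    have "cnj a * a \<noteq> 1" using nz[OF assms] by auto
    then show ?thesis using DERIV_imp_deriv[OF d[OF that]] nz[OF that] by simp
  qed
  then obtain L where "L holomorphic_on unit_disk"
      "\<And>z. z \<in> unit_disk \<Longrightarrow> deriv (disk_aut a) z = exp (L z)"
    using contractible_imp_holomorphic_log[OF hol convex_imp_contractible[OF convex_ball]] by blast
  then have "\<exists>L. L holomorphic_on unit_disk \<and>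
      (\<forall>z\<in>unit_disk. exp (L z) = deriv (disk_aut a) z)"
    by force
  from someI_ex[OF this]
  show "log_deriv_aut a holomorphic_on unit_disk"
    and "z \<in> unit_disk \<Longrightarrow> exp (log_deriv_aut a z) = deriv (disk_aut a) z"
    unfolding log_deriv_aut_def by auto
qed

definition bergman_shift :: "real \<Rightarrow> complex \<Rightarrow> (complex \<Rightarrow> complex) \<Rightarrow> complex \<Rightarrow> complex" where
  "bergman_shift \<alpha> a f z =
     exp (of_real ((2 + \<alpha>) / 2) * log_deriv_aut a z) * f (disk_aut a z)"

definition pseudohyp_dist :: "complex \<Rightarrow> complex \<Rightarrow> real" where
  "pseudohyp_dist u v = cmod (disk_aut u v)"

definition pseudohyp_disk :: "complex \<Rightarrow> real \<Rightarrow> complex set" where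
  "pseudohyp_disk a r = {z \<in> unit_disk. pseudohyp_dist a z < r}"

text \<open>The divisor \<open>{(a, m a) | a \<in> \<Lambda>}\<close> is represented by its support \<open>\<Lambda>\<close> and a multiplicity
  function \<open>m\<close>, whose values off \<open>\<Lambda>\<close> are irrelevant.\<close>

definition divisor :: "complex set \<Rightarrow> (complex \<Rightarrow> nat) \<Rightarrow> bool" where
  "divisor \<Lambda> m \<longleftrightarrow> \<Lambda> \<subseteq> unit_disk \<and> (\<forall>a\<in>\<Lambda>. 1 \<le> m a)"

text \<open>Sums over \<open>\<Lambda>\<close> are taken in \<open>ennreal\<close>, so that a divergent sum is \<open>\<infinity>\<close> (in \<open>real\<close>,
  \<open>infsum\<close> would return 0).\<close>

definition sample_sum ::
  "real \<Rightarrow> complex set \<Rightarrow> (complex \<Rightarrow> nat) \<Rightarrow> (complex \<Rightarrow> complex) \<Rightarrow> ennreal" where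
  "sample_sum \<alpha> \<Lambda> m f = (\<Sum>\<^sub>\<infinity>a\<in>\<Lambda>. \<Sum>j<m a.
     ennreal ((cmod (bergman_inner \<alpha> f (bergman_shift \<alpha> a (bergman_basis \<alpha> j))))\<^sup>2))"

definition sampling :: "real \<Rightarrow> complex set \<Rightarrow> (complex \<Rightarrow> nat) \<Rightarrow> bool" where
  "sampling \<alpha> \<Lambda> m \<longleftrightarrow> (\<exists>C'>0::real. \<forall>f\<in>bergman \<alpha>.
     ennreal (1 / C') * sample_sum \<alpha> \<Lambda> m f \<le> ennreal ((bergman_norm \<alpha> f)\<^sup>2) \<and>
     ennreal ((bergman_norm \<alpha> f)\<^sup>2) \<le> ennreal C' * sample_sum \<alpha> \<Lambda> m f)"

definition overlap_const :: "real \<Rightarrow> complex set \<Rightarrow> (complex \<Rightarrow> nat) \<Rightarrow> ennreal" where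
  "overlap_const \<alpha> \<Lambda> m = (SUP z\<in>unit_disk. \<Sum>\<^sub>\<infinity>a\<in>\<Lambda>.
     indicator (pseudohyp_disk a (sqrt (real (m a) / (real (m a) + \<alpha> + 1)))) z)"

definition finite_overlap :: "real \<Rightarrow> complex set \<Rightarrow> (complex \<Rightarrow> nat) \<Rightarrow> bool" where
  "finite_overlap \<alpha> \<Lambda> m \<longleftrightarrow> overlap_const \<alpha> \<Lambda> m < \<infinity>"

end

theory Submission imports Defs begin

text \<open>Write \<open>b\<^sub>n\<close> for the Taylor coefficients of \<open>T\<^sub>\<lambda> f\<close> and \<open>c\<^sub>n\<close> for the squared leading coefficient
  of \<open>e\<^sub>n\<close>. Since \<open>T\<^sub>\<lambda>\<close> is self-adjoint up to a unimodular factor, \<open>|\<langle>f, T\<^sub>\<lambda> e\<^sub>j\<rangle>|\<^sup>2 = |b\<^sub>j|\<^sup>2 / c\<^sub>j\<close>, and the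
  integral of \<open>|f|\<^sup>2\<close> over \<open>D(\<lambda>, r)\<close> is \<open>\<Sum> |b\<^sub>n|\<^sup>2 W\<^sub>n(r\<^sup>2)\<close>, where \<open>W\<^sub>n\<close> is an incomplete beta integral.

  Necessity. Testing the Bessel inequality on the kernel \<open>T\<^sub>z e\<^sub>0\<close> bounds the overlap at \<open>z\<close>. If \<open>z\<close> is
  so badly covered that \<open>(m + \<alpha> + 1)(1 - \<rho>(\<lambda>, z)\<^sup>2) \<le> \<epsilon>\<close> for all \<open>\<lambda>\<close>, then multiplication by
  \<open>\<phi>\<^sub>z \<circ> \<phi>\<^sub>\<lambda>\<close> is almost isometric on the first \<open>m\<close> Taylor coefficients, so the sampling sum of
  \<open>T\<^sub>z e\<^sub>n\<close> is at least about \<open>c\<^sub>n\<close> times that of \<open>T\<^sub>z e\<^sub>0\<close>; this is impossible as \<open>c\<^sub>n\<close> tends to infinity.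

  Sufficiency. For \<open>n \<ge> m\<close>, shrinking the disk from \<open>m / (m + \<alpha> + 1)\<close> to \<open>(m - C) / (m + \<alpha> + 1)\<close>
  reduces \<open>W\<^sub>n\<close> by a factor tending to 0 with \<open>1 / C\<close>, so by finite overlap the norm is controlled by the
  sampling sum up to the mass on a smaller disk. Applying this to \<open>z\<^sup>k f\<close> with \<open>k\<close> large removes that mass.\<close>

section \<open>Change of variables on the disk\<close>

text \<open>The obstacle in both halves is uniformity in the multiplicity: \<open>m\<close> is
  unbounded, so the estimates at a point of the divisor must not depend on it. The radii are scaled
  for this: \<open>basis_coeff \<alpha> n\<close> has size n^(\<alpha> + 1), and (m / (m + \<alpha>
  + 1))^m stays above exp (-(\<alpha> + 1)). The sum of the first \<open>m\<close> weighted squared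
  Taylor coefficients is the squared norm of a class modulo z^m, and a holomorphic multiplier
  bounded by 1 cannot increase such a quotient norm. This gives the stability of the sampling sum
  under z^k and, with the reverse triangle inequality, the almost isometry in the necessity part. In
  the sufficiency part \<open>C\<close> has to be fixed before \<open>K\<close> is known, so the
  uncovered set cannot be absorbed by enlarging \<open>C\<close>. Multiplication by z^k treats it
  with explicit constants, in place of a compactness argument; only \<open>k\<close> and the
  sampling constant depend on \<open>K\<close>.\<close>

definition plane :: "real^2 \<Rightarrow> complex" where "plane v = Complex (vec_nth v 1) (vec_nth v 2)"
definition plane_inv :: "complex \<Rightarrow> real^2" where "plane_inv z = vector [Re z, Im z]"

lemma plane_inv_plane [simp]: "plane_inv (plane v) = v"
  by (simp add: plane_def plane_inv_def vec_eq_iff forall_2)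

lemma plane_plane_inv [simp]: "plane (plane_inv z) = z"
  by (simp add: plane_def plane_inv_def)

lemma bounded_linear_plane: "bounded_linear plane"
  by (rule linear_conv_bounded_linear[THEN iffD1], rule linearI)
    (auto simp: plane_def complex_eq_iff)

lemma bounded_linear_plane_inv: "bounded_linear plane_inv"
  by (rule linear_conv_bounded_linear[THEN iffD1], rule linearI)
    (auto simp: plane_inv_def vec_eq_iff forall_2)

lemma plane_measurable [measurable]: "plane \<in> borel_measurable borel"
  by (intro borel_measurable_continuous_onI linear_continuous_on bounded_linear_plane)

lemma Basis_vec2: "(Basis :: (real^2) set) = {axis 1 1, axis 2 1}"
  by (auto simp: Basis_vec_def UNIV_2)

text \<open>Boxes correspond under \<open>plane\<close> with equal side lengths, and a Borel measure
  that gives every box its volume is \<open>lborel\<close>.\<close>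

lemma distr_plane: "distr lborel borel plane = lborel"
proof (rule sym, rule lborel_eqI)
  fix l u :: complex
  assume le: "\<And>b. b \<in> Basis \<Longrightarrow> l \<bullet> b \<le> u \<bullet> b"
  have vim: "plane -` box l u = box (plane_inv l) (plane_inv u)"
    by (auto simp: plane_inv_def plane_def mem_box Basis_vec2 Basis_complex_def inner_axis)
  have ne: "axis 1 1 \<noteq> (axis 2 1 :: real^2)" by (simp add: axis_eq_axis)
  have le': "plane_inv l \<bullet> b \<le> plane_inv u \<bullet> b" if "b \<in> Basis" for b
    using that le[of 1] le[of \<i>] by (auto simp: Basis_vec2 inner_axis plane_inv_def Basis_complex_def)
  have "emeasure (distr lborel borel plane) (box l u) = emeasure lborel (box (plane_inv l) (plane_inv u))"
    by (subst emeasure_distr) (auto simp: vim)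
  also have "\<dots> = ennreal (\<Prod>b\<in>Basis. (u - l) \<bullet> b)"
    using le' ne by (subst emeasure_lborel_box) (auto simp: Basis_vec2 Basis_complex_def inner_axis plane_inv_def)
  finally show "emeasure (distr lborel borel plane) (box l u) = ennreal (\<Prod>b\<in>Basis. (u - l) \<bullet> b)" .
qed simp

lemma nn_integral_plane:
  assumes [measurable]: "f \<in> borel_measurable borel"
  shows "(\<integral>\<^sup>+z. f z \<partial>lborel) = (\<integral>\<^sup>+v. f (plane v) \<partial>lborel)"
  by (subst distr_plane[symmetric], subst nn_integral_distr) auto

lemma det_mult_complex:
  "det (matrix (\<lambda>h. plane_inv (c * plane h))) = (cmod c)\<^sup>2"
  by (simp add: det_2 matrix_def plane_inv_def plane_def axis_def cmod_def power2_eq_square)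

text \<open>The real Jacobian of a holomorphic map is the squared modulus of its derivative.
  \<open>measure_differentiable_image_eq\<close> works with determinants over \<open>real^2\<close>,
  so \<psi> is conjugated by \<open>plane\<close>. Boundedness of \<open>A\<close> and of the
  derivative on \<open>A\<close> makes the Jacobian integrable, as that formula requires.\<close>

lemma emeasure_holomorphic_image:
  fixes \<psi> :: "complex \<Rightarrow> complex"
  assumes U: "open U" and hol: "\<psi> holomorphic_on U" and inj: "inj_on \<psi> U"
    and A[measurable]: "A \<in> sets borel" and "A \<subseteq> U" and bA: "bounded A"
    and im[measurable]: "\<psi> ` A \<in> sets borel"
    and bd: "\<And>z. z \<in> A \<Longrightarrow> cmod (deriv \<psi> z) \<le> B"
  shows "emeasure lborel (\<psi> ` A) = (\<integral>\<^sup>+z. indicator A z * ennreal ((cmod (deriv \<psi> z))\<^sup>2) \<partial>lborel)"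
proof -
  define g where "g v = plane_inv (\<psi> (plane v))" for v
  define g' where "g' v h = plane_inv (deriv \<psi> (plane v) * plane h)" for v h
  define A' where "A' = plane -` A"
  define d where "d z = indicator A z * (cmod (deriv \<psi> z))\<^sup>2" for z
  have A'[measurable]: "A' \<in> sets borel" unfolding A'_def using measurable_sets[OF plane_measurable A] by simp
  have img: "g ` A' = plane -` (\<psi> ` A)"
  proof (intro set_eqI iffI)
    fix v assume "v \<in> plane -` (\<psi> ` A)"
    then obtain z where "z \<in> A" "plane v = \<psi> z" by auto
    then show "v \<in> g ` A'"
      by (intro image_eqI[of _ _ "plane_inv z"]) (auto simp: g_def A'_def simp flip: \<open>plane v = \<psi> z\<close>)
  qed (auto simp: g_def A'_def)
  have der: "(g has_derivative g' v) (at v within A')" if "v \<in> A'" for v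
  proof -
    have "plane v \<in> U" using that \<open>A \<subseteq> U\<close> by (auto simp: A'_def)
    then have "(\<psi> has_field_derivative deriv \<psi> (plane v)) (at (plane v))"
      using hol U by (metis holomorphic_derivI)
    then have "(\<psi> has_derivative (*) (deriv \<psi> (plane v))) (at (plane v))"
      by (simp add: has_field_derivative_def)
    from bounded_linear.has_derivative[OF bounded_linear_plane_inv
        has_derivative_compose[OF bounded_linear_imp_has_derivative[OF bounded_linear_plane] this]]
    show ?thesis unfolding g_def g'_def by (rule has_derivative_at_withinI)
  qed
  have injg: "inj_on g A'"
    using inj \<open>A \<subseteq> U\<close> unfolding inj_on_def g_def A'_def
    by (metis plane_inv_plane plane_plane_inv subsetD vimage_eq)
  have det: "\<bar>det (matrix (g' v))\<bar> = (cmod (deriv \<psi> (plane v)))\<^sup>2" for v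
    unfolding g'_def det_mult_complex by simp
  have derm: "(\<lambda>z. indicator A z *\<^sub>R (cmod (deriv \<psi> z))\<^sup>2) \<in> borel_measurable borel"
  proof -
    have "continuous_on A (\<lambda>z. (cmod (deriv \<psi> z))\<^sup>2)"
      using holomorphic_on_imp_continuous_on[OF holomorphic_deriv[OF hol U]] \<open>A \<subseteq> U\<close>
      by (intro continuous_intros) (auto intro: continuous_on_subset)
    then show ?thesis using borel_measurable_continuous_on_indicator[OF A] by blast
  qed
  then have dm[measurable]: "d \<in> borel_measurable borel" unfolding d_def by simp
  have finA: "emeasure lborel A < \<infinity>" using bA by (rule emeasure_bounded_finite)
  have emA': "emeasure lborel A' = emeasure lborel A"
    by (subst distr_plane[symmetric], subst emeasure_distr) (auto simp: A'_def)
  have intd: "integrable lborel (\<lambda>v. d (plane v))"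
  proof (rule Bochner_Integration.integrable_bound)
    show "integrable lborel (\<lambda>v. B\<^sup>2 * indicator A' v)"
      using finA emA' by (intro integrable_mult_right integrable_real_indicator) auto
    have "norm (d (plane v)) \<le> norm (B\<^sup>2 * indicator A' v)" for v
    proof (cases "plane v \<in> A")
      case True
      then have "(cmod (deriv \<psi> (plane v)))\<^sup>2 \<le> B\<^sup>2" using bd by (intro power_mono) auto
      then show ?thesis using True by (simp add: d_def A'_def)
    qed (simp add: d_def)
    then show "AE v in lborel. norm (d (plane v)) \<le> norm (B\<^sup>2 * indicator A' v)" by simp
  qed simp
  define I where "I = (\<integral>v. d (plane v) \<partial>lborel)"
  have "((\<lambda>v. d (plane v)) has_integral I) UNIV"
    unfolding I_def by (rule has_integral_integral_lborel[OF intd])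
  moreover have dd: "(\<lambda>v. d (plane v)) = (\<lambda>v. if v \<in> A' then \<bar>det (matrix (g' v))\<bar> else 0)"
    by (auto simp: d_def A'_def det fun_eq_iff)
  ultimately have hi: "((\<lambda>v. \<bar>det (matrix (g' v))\<bar>) has_integral I) A'"
    by (simp only: has_integral_restrict_UNIV)
  have lebA': "A' \<in> sets lebesgue" using A' by simp
  have "measure lebesgue (g ` A') = I"
    using measure_differentiable_image_eq[OF lebA' der injg] hi by (simp add: has_integral_integrable integral_unique)
  moreover have "g ` A' \<in> lmeasurable"
    using measurable_differentiable_image_eq[OF lebA' der injg] hi by (blast intro: has_integral_integrable)
  ultimately have "emeasure lebesgue (g ` A') = ennreal I"
    by (simp add: emeasure_eq_measure2)
  also have "\<dots> = (\<integral>\<^sup>+v. ennreal (d (plane v)) \<partial>lborel)"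
    unfolding I_def by (rule nn_integral_eq_integral[symmetric, OF intd]) (auto simp: d_def)
  also have "\<dots> = (\<integral>\<^sup>+z. ennreal (d z) \<partial>lborel)"
    by (rule nn_integral_plane[symmetric]) simp
  also have "\<dots> = (\<integral>\<^sup>+z. indicator A z * ennreal ((cmod (deriv \<psi> z))\<^sup>2) \<partial>lborel)"
    by (intro nn_integral_cong) (auto simp: d_def indicator_def)
  also have "emeasure lebesgue (g ` A') = emeasure lborel (\<psi> ` A)"
  proof -
    have "plane -` (\<psi> ` A) \<in> sets borel" using measurable_sets[OF plane_measurable im] by simp
    then have "emeasure lebesgue (g ` A') = emeasure lborel (plane -` (\<psi> ` A))" unfolding img by simp
    also have "\<dots> = emeasure (distr lborel borel plane) (\<psi> ` A)"
      by (subst emeasure_distr) auto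
    finally show ?thesis unfolding distr_plane .
  qed
  finally show ?thesis .
qed

section \<open>Weighted area on the disk and its conformal change of variables\<close>

abbreviation lebesgue_disk :: "complex measure" where
  "lebesgue_disk \<equiv> restrict_space lborel unit_disk"

lemma sets_lebesgue_disk: "sets lebesgue_disk = sets (restrict_space borel unit_disk)"
  by (simp add: sets_restrict_space)

lemma space_dA [simp]: "space (dA \<alpha>) = unit_disk"
  by (simp add: dA_def space_restrict_space)

lemma sets_dA [simp, measurable_cong]: "sets (dA \<alpha>) = sets lebesgue_disk"
  by (simp add: dA_def)

lemma borel_measurable_lebesgue_disk_continuous:
  assumes "continuous_on unit_disk f"
  shows "f \<in> borel_measurable lebesgue_disk"
  using borel_measurable_continuous_on_restrict[OF assms]
  by (simp add: measurable_cong_sets[OF sets_lebesgue_disk refl])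

lemma borel_measurable_dA_continuous:
  assumes "continuous_on unit_disk f"
  shows "f \<in> borel_measurable (dA \<alpha>)"
  using borel_measurable_lebesgue_disk_continuous[OF assms]
  by (simp add: measurable_cong_sets[OF sets_dA refl])

lemma borel_measurable_lebesgue_disk [measurable (raw)]:
  "f \<in> borel_measurable borel \<Longrightarrow> f \<in> borel_measurable lebesgue_disk"
  by (simp add: measurable_restrict_space1)

lemma one_minus_norm_sq_pos: "z \<in> unit_disk \<Longrightarrow> 0 < 1 - (cmod z)\<^sup>2"
  by (simp add: power_less_one_iff abs_square_less_1)

lemma nn_integral_dA:
  assumes "f \<in> borel_measurable lebesgue_disk"
  shows "(\<integral>\<^sup>+z. f z \<partial>dA \<alpha>) =
    (\<integral>\<^sup>+z. ennreal ((1 + \<alpha>) * (1 - (cmod z)\<^sup>2) powr \<alpha> / pi) * f z \<partial>lebesgue_disk)"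
  unfolding dA_def using assms by (subst nn_integral_density) auto

text \<open>\<theta> is the inverse of \<psi>. The identity for 1 - |\<psi>|^2 is the case of
  equality in the Schwarz-Pick lemma; it describes how the weight of \<open>dA\<close> transforms.
  The bounded derivative is what \<open>emeasure_holomorphic_image\<close> asks for. The instances
  are the rotations and the maps \<open>disk_aut a\<close>.\<close>

definition disk_automorphism :: "(complex \<Rightarrow> complex) \<Rightarrow> (complex \<Rightarrow> complex) \<Rightarrow> bool" where
  "disk_automorphism \<psi> \<theta> \<longleftrightarrow> \<psi> holomorphic_on unit_disk \<and>
     (\<forall>z\<in>unit_disk. \<psi> z \<in> unit_disk \<and> \<theta> z \<in> unit_disk \<and> \<theta> (\<psi> z) = z \<and> \<psi> (\<theta> z) = z \<and>
        1 - (cmod (\<psi> z))\<^sup>2 = (1 - (cmod z)\<^sup>2) * cmod (deriv \<psi> z)) \<and>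
     bounded (deriv \<psi> ` unit_disk)"

lemma disk_automorphism_measurable:
  assumes "disk_automorphism \<psi> \<theta>"
  shows "\<psi> \<in> measurable lebesgue_disk lebesgue_disk"
proof -
  have "\<psi> \<in> borel_measurable lebesgue_disk"
    using assms unfolding disk_automorphism_def
    by (intro borel_measurable_lebesgue_disk_continuous) (auto dest: holomorphic_on_imp_continuous_on)
  then show ?thesis
    using assms unfolding disk_automorphism_def
    by (intro measurable_restrict_space2) (auto simp: space_restrict_space)
qed

lemma deriv_measurable_lebesgue_disk:
  assumes "\<psi> holomorphic_on unit_disk"
  shows "(\<lambda>z. cmod (deriv \<psi> z)) \<in> borel_measurable lebesgue_disk"
  using holomorphic_on_imp_continuous_on[OF holomorphic_deriv[OF assms]]
  by (intro borel_measurable_lebesgue_disk_continuous continuous_intros) auto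

lemma lebesgue_disk_change_of_variables:
  assumes \<psi>: "disk_automorphism \<psi> \<theta>"
  shows "distr (density lebesgue_disk (\<lambda>z. ennreal ((cmod (deriv \<psi> z))\<^sup>2))) lebesgue_disk \<psi> = lebesgue_disk"
    (is "distr ?D _ _ = _")
proof (rule measure_eqI)
  have hol: "\<psi> holomorphic_on unit_disk"
    and maps: "z \<in> unit_disk \<Longrightarrow> \<psi> z \<in> unit_disk" "z \<in> unit_disk \<Longrightarrow> \<theta> z \<in> unit_disk"
    and inv: "z \<in> unit_disk \<Longrightarrow> \<theta> (\<psi> z) = z" "z \<in> unit_disk \<Longrightarrow> \<psi> (\<theta> z) = z" for z
    using \<psi> unfolding disk_automorphism_def by auto
  have [measurable]: "\<psi> \<in> measurable lebesgue_disk lebesgue_disk"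
    by (rule disk_automorphism_measurable[OF \<psi>])
  have [measurable]: "(\<lambda>z. cmod (deriv \<psi> z)) \<in> borel_measurable lebesgue_disk"
    by (rule deriv_measurable_lebesgue_disk[OF hol])
  obtain B where B: "\<And>z. z \<in> unit_disk \<Longrightarrow> cmod (deriv \<psi> z) \<le> B"
    using \<psi> unfolding disk_automorphism_def bounded_iff by blast
  fix E assume "E \<in> sets (distr ?D lebesgue_disk \<psi>)"
  then have E[measurable]: "E \<in> sets lebesgue_disk" by simp
  then have Eb: "E \<in> sets borel" and ED: "E \<subseteq> unit_disk"
    by (auto simp: sets_restrict_space_iff)
  define A where "A = \<psi> -` E \<inter> unit_disk"
  have "A \<in> sets lebesgue_disk"
    using measurable_sets[OF \<open>\<psi> \<in> measurable lebesgue_disk lebesgue_disk\<close> E]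
    by (simp add: A_def space_restrict_space)
  then have Ab: "A \<in> sets borel" and AD: "A \<subseteq> unit_disk" and [measurable]: "A \<in> sets lebesgue_disk"
    by (auto simp: sets_restrict_space_iff)
  have im: "\<psi> ` A = E"
    using maps inv ED unfolding A_def by (force simp: image_iff)
  have "emeasure (distr ?D lebesgue_disk \<psi>) E = emeasure ?D A"
    by (subst emeasure_distr) (auto simp: A_def space_restrict_space)
  also have "\<dots> = (\<integral>\<^sup>+z. ennreal ((cmod (deriv \<psi> z))\<^sup>2) * indicator A z \<partial>lebesgue_disk)"
    by (rule emeasure_density) auto
  also have "\<dots> = (\<integral>\<^sup>+z. indicator A z * ennreal ((cmod (deriv \<psi> z))\<^sup>2) \<partial>lborel)"
    using AD by (subst nn_integral_restrict_space) (auto intro!: nn_integral_cong simp: indicator_def)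
  also have "\<dots> = emeasure lborel (\<psi> ` A)"
  proof (rule emeasure_holomorphic_image[symmetric, OF open_ball hol _ Ab AD])
    show "inj_on \<psi> unit_disk" using inv by (metis inj_on_def)
    show "bounded A" using AD bounded_ball bounded_subset by blast
    show "\<psi> ` A \<in> sets borel" using im Eb by simp
    show "cmod (deriv \<psi> z) \<le> B" if "z \<in> A" for z using B AD that by auto
  qed
  also have "\<dots> = emeasure lebesgue_disk E"
    using im ED by (subst emeasure_restrict_space) auto
  finally show "emeasure (distr ?D lebesgue_disk \<psi>) E = emeasure lebesgue_disk E" .
qed simp

lemma nn_integral_lebesgue_disk_change_of_variables:
  assumes \<psi>: "disk_automorphism \<psi> \<theta>" and [measurable]: "f \<in> borel_measurable lebesgue_disk"
  shows "(\<integral>\<^sup>+z. f z \<partial>lebesgue_disk) = (\<integral>\<^sup>+z. ennreal ((cmod (deriv \<psi> z))\<^sup>2) * f (\<psi> z) \<partial>lebesgue_disk)"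
proof -
  have [measurable]: "\<psi> \<in> measurable lebesgue_disk lebesgue_disk"
    by (rule disk_automorphism_measurable[OF \<psi>])
  have [measurable]: "(\<lambda>z. cmod (deriv \<psi> z)) \<in> borel_measurable lebesgue_disk"
    using \<psi> by (intro deriv_measurable_lebesgue_disk) (auto simp: disk_automorphism_def)
  show ?thesis
    by (subst lebesgue_disk_change_of_variables[OF \<psi>, symmetric])
      (simp add: nn_integral_distr nn_integral_density)
qed

text \<open>Area contributes the square of |\<psi>'|, and by the Schwarz-Pick equality the weight
  contributes its power \<alpha>. An equality of measures serves nonnegative and complex integrands
  alike.\<close>

lemma dA_change_of_variables:
  assumes \<psi>: "disk_automorphism \<psi> \<theta>"
  shows "distr (density (dA \<alpha>) (\<lambda>z. ennreal (cmod (deriv \<psi> z) powr (2 + \<alpha>)))) (dA \<alpha>) \<psi> = dA \<alpha>"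
    (is "distr ?D _ _ = _")
proof (rule measure_eqI)
  have hol: "\<psi> holomorphic_on unit_disk"
    and maps: "z \<in> unit_disk \<Longrightarrow> \<psi> z \<in> unit_disk"
    and wt: "z \<in> unit_disk \<Longrightarrow> 1 - (cmod (\<psi> z))\<^sup>2 = (1 - (cmod z)\<^sup>2) * cmod (deriv \<psi> z)" for z
    using \<psi> unfolding disk_automorphism_def by auto
  have m0: "\<psi> \<in> measurable lebesgue_disk lebesgue_disk"
    by (rule disk_automorphism_measurable[OF \<psi>])
  note [measurable] = m0
  have [measurable]: "(\<lambda>z. cmod (deriv \<psi> z)) \<in> borel_measurable lebesgue_disk"
    by (rule deriv_measurable_lebesgue_disk[OF hol])
  fix E assume "E \<in> sets (distr ?D (dA \<alpha>) \<psi>)"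
  then have E[measurable]: "E \<in> sets lebesgue_disk" by simp
  have A: "\<psi> -` E \<inter> unit_disk \<in> sets lebesgue_disk"
    using measurable_sets[OF m0 E] by (simp add: space_restrict_space)
  define W where "W z = (1 + \<alpha>) * (1 - (cmod z)\<^sup>2) powr \<alpha> / pi" for z
  have [measurable]: "W \<in> borel_measurable borel" unfolding W_def by measurable
  have "emeasure (distr ?D (dA \<alpha>) \<psi>) E = emeasure ?D (\<psi> -` E \<inter> unit_disk)"
    by (subst emeasure_distr) (auto)
  also have "\<dots> = (\<integral>\<^sup>+z. ennreal (cmod (deriv \<psi> z) powr (2 + \<alpha>)) * indicator (\<psi> -` E \<inter> unit_disk) z \<partial>dA \<alpha>)"
    using A by (intro emeasure_density) auto
  also have "\<dots> = (\<integral>\<^sup>+z. ennreal (W z) * (ennreal (cmod (deriv \<psi> z) powr (2 + \<alpha>)) * indicator (\<psi> -` E \<inter> unit_disk) z) \<partial>lebesgue_disk)"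
    using A unfolding W_def by (intro nn_integral_dA) auto
  also have "\<dots> = (\<integral>\<^sup>+z. ennreal ((cmod (deriv \<psi> z))\<^sup>2) * (ennreal (W (\<psi> z)) * indicator E (\<psi> z)) \<partial>lebesgue_disk)"
  proof (intro nn_integral_cong)
    fix z assume "z \<in> space lebesgue_disk"
    then have z: "z \<in> unit_disk" by (simp add: space_restrict_space)
    have pos: "0 < 1 - (cmod z)\<^sup>2" "0 < 1 - (cmod (\<psi> z))\<^sup>2"
      using one_minus_norm_sq_pos[OF z] one_minus_norm_sq_pos[OF maps[OF z]] by auto
    then have d0: "0 < cmod (deriv \<psi> z)" using wt[OF z] by (simp add: zero_less_mult_iff)
    have "W z * cmod (deriv \<psi> z) powr (2 + \<alpha>) = (cmod (deriv \<psi> z))\<^sup>2 * W (\<psi> z)"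
      unfolding W_def wt[OF z] using pos d0 by (simp add: powr_mult powr_add)
    then have "ennreal (cmod (deriv \<psi> z) powr (2 + \<alpha>)) * ennreal (W z) = ennreal ((cmod (deriv \<psi> z))\<^sup>2) * ennreal (W (\<psi> z))"
      by (simp add: ennreal_mult''[symmetric] mult.commute)
    then show "ennreal (W z) * (ennreal (cmod (deriv \<psi> z) powr (2 + \<alpha>)) * indicator (\<psi> -` E \<inter> unit_disk) z) =
      ennreal ((cmod (deriv \<psi> z))\<^sup>2) * (ennreal (W (\<psi> z)) * indicator E (\<psi> z))"
      using z by (auto simp: indicator_def mult.commute)
  qed
  also have "\<dots> = (\<integral>\<^sup>+z. ennreal (W z) * indicator E z \<partial>lebesgue_disk)"
    by (rule nn_integral_lebesgue_disk_change_of_variables[OF \<psi>, symmetric])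
      (intro borel_measurable_times_ennreal borel_measurable_indicator E borel_measurable_lebesgue_disk; measurable)
  also have "\<dots> = emeasure (dA \<alpha>) E"
    unfolding dA_def W_def by (rule emeasure_density[symmetric]) auto
  finally show "emeasure (distr ?D (dA \<alpha>) \<psi>) E = emeasure (dA \<alpha>) E" .
qed simp

lemma nn_integral_dA_change_of_variables:
  assumes \<psi>: "disk_automorphism \<psi> \<theta>" and [measurable]: "f \<in> borel_measurable lebesgue_disk"
  shows "(\<integral>\<^sup>+z. f z \<partial>dA \<alpha>) = (\<integral>\<^sup>+z. ennreal (cmod (deriv \<psi> z) powr (2 + \<alpha>)) * f (\<psi> z) \<partial>dA \<alpha>)"
proof -
  have [measurable]: "\<psi> \<in> measurable lebesgue_disk lebesgue_disk"
    by (rule disk_automorphism_measurable[OF \<psi>])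
  have [measurable]: "(\<lambda>z. cmod (deriv \<psi> z)) \<in> borel_measurable lebesgue_disk"
    using \<psi> by (intro deriv_measurable_lebesgue_disk) (auto simp: disk_automorphism_def)
  show ?thesis
    by (subst dA_change_of_variables[OF \<psi>, symmetric])
      (simp add: nn_integral_distr nn_integral_density)
qed

lemma integral_dA_change_of_variables:
  fixes f :: "complex \<Rightarrow> complex"
  assumes \<psi>: "disk_automorphism \<psi> \<theta>" and [measurable]: "f \<in> borel_measurable lebesgue_disk"
  shows "(\<integral>z. f z \<partial>dA \<alpha>) = (\<integral>z. (cmod (deriv \<psi> z) powr (2 + \<alpha>)) *\<^sub>R f (\<psi> z) \<partial>dA \<alpha>)"
proof -
  have [measurable]: "\<psi> \<in> measurable lebesgue_disk lebesgue_disk"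
    by (rule disk_automorphism_measurable[OF \<psi>])
  have [measurable]: "(\<lambda>z. cmod (deriv \<psi> z)) \<in> borel_measurable lebesgue_disk"
    using \<psi> by (intro deriv_measurable_lebesgue_disk) (auto simp: disk_automorphism_def)
  show ?thesis
    by (subst dA_change_of_variables[OF \<psi>, symmetric])
      (simp add: integral_distr integral_density)
qed

section \<open>Radial moments\<close>

text \<open>For 0 \<le> x < 1 the part of the disk where |z|^2 > x has area pi (1 - x), so |z|^2 is
  uniformly distributed with total mass pi. This takes the place of polar coordinates.\<close>

lemma distr_norm_sq_lebesgue_disk:
  "distr lebesgue_disk borel (\<lambda>z. (cmod z)\<^sup>2) =
   density lborel (\<lambda>t. ennreal pi * indicator {0<..<1} t)" (is "?M = ?N")
proof (rule measure_eqI_lessThan)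
  have N: "emeasure ?N {x<..} = ennreal pi * emeasure lborel ({x<..} \<inter> {0<..<1})" for x
  proof -
    have "emeasure ?N {x<..} = (\<integral>\<^sup>+t. ennreal pi * indicator ({x<..} \<inter> {0<..<1}) t \<partial>lborel)"
      by (subst emeasure_density) (auto intro!: nn_integral_cong simp: indicator_def)
    then show ?thesis by (simp add: nn_integral_cmult_indicator)
  qed
  have M: "emeasure ?M {x<..} = emeasure lborel {z \<in> unit_disk. x < (cmod z)\<^sup>2}" for x
  proof -
    have "emeasure ?M {x<..} = emeasure lebesgue_disk {z \<in> unit_disk. x < (cmod z)\<^sup>2}"
      by (subst emeasure_distr) (auto intro!: arg_cong[where f="emeasure _"] simp: space_restrict_space)
    then show ?thesis by (subst (asm) emeasure_restrict_space) auto
  qed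
  have area: "emeasure lborel (ball (0::complex) 1) = ennreal pi"
    by (simp add: emeasure_ball unit_ball_vol_2)
  fix x :: real
  have eq: "emeasure lborel {z \<in> unit_disk. x < (cmod z)\<^sup>2} = ennreal pi * emeasure lborel ({x<..} \<inter> {0<..<1})"
  proof -
    consider "x < 0" | "0 \<le> x" "x < 1" | "1 \<le> x" by linarith
    then show ?thesis
    proof cases
      case 1
      then have "{z \<in> unit_disk. x < (cmod z)\<^sup>2} = ball 0 1" "{x<..} \<inter> {0<..<1} = {0<..<1}"
        by (auto intro: less_le_trans[OF _ zero_le_power2])
      then show ?thesis using area by simp
    next
      case 2
      then have l: "sqrt x < 1" "0 \<le> sqrt x" by (auto intro: real_less_lsqrt)
      have "{z \<in> unit_disk. x < (cmod z)\<^sup>2} = ball 0 1 - cball 0 (sqrt x)"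
      proof -
        have "x < (cmod z)\<^sup>2 \<longleftrightarrow> sqrt x < cmod z" for z
          using real_sqrt_less_iff[of x "(cmod z)\<^sup>2"] by simp
        then show ?thesis by (simp only: set_eq_iff Diff_iff mem_Collect_eq mem_ball_0 mem_cball_0 not_le) simp
      qed
      moreover have cball_sub: "cball (0::complex) (sqrt x) \<subseteq> ball 0 1"
        using l(1) unfolding subset_iff mem_cball_0 mem_ball_0 by (meson le_less_trans)
      moreover have "emeasure lborel (ball (0::complex) 1 - cball 0 (sqrt x)) = ennreal pi - ennreal (pi * x)"
        using l 2 area cball_sub
        by (subst emeasure_Diff) (auto simp: emeasure_cball unit_ball_vol_2)
      moreover have "{x<..} \<inter> {0<..<1} = {x<..<1}" using 2 by auto
      ultimately show ?thesis using 2
        by (simp add: ennreal_minus ennreal_mult'[symmetric] algebra_simps)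
    next
      case 3
      then have "\<not> x < (cmod z)\<^sup>2" if "z \<in> unit_disk" for z
        using one_minus_norm_sq_pos[OF that] by simp
      then have "{z \<in> unit_disk. x < (cmod z)\<^sup>2} = {}" "{x<..} \<inter> {0<..<1} = {}" using 3 by auto
      then show ?thesis by (simp only: emeasure_empty mult_zero_right)
    qed
  qed
  show "emeasure ?M {x<..} = emeasure ?N {x<..}" unfolding M N eq ..
  have "emeasure ?M {x<..} \<le> emeasure lborel (ball (0::complex) 1)" unfolding M
    by (intro emeasure_mono) auto
  then show "emeasure ?M {x<..} < \<infinity>" using area by (simp add: le_less_trans)
qed auto

lemma nn_integral_radial_lebesgue_disk:
  assumes [measurable]: "h \<in> borel_measurable borel"
  shows "(\<integral>\<^sup>+z. h ((cmod z)\<^sup>2) \<partial>lebesgue_disk) = ennreal pi * (\<integral>\<^sup>+t. indicator {0<..<1} t * h t \<partial>lborel)"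
proof -
  have "(\<integral>\<^sup>+z. h ((cmod z)\<^sup>2) \<partial>lebesgue_disk) = (\<integral>\<^sup>+t. h t \<partial>distr lebesgue_disk borel (\<lambda>z. (cmod z)\<^sup>2))"
    by (subst nn_integral_distr) auto
  also have "\<dots> = (\<integral>\<^sup>+t. ennreal pi * (indicator {0<..<1} t * h t) \<partial>lborel)"
    unfolding distr_norm_sq_lebesgue_disk by (subst nn_integral_density) (auto simp: mult.assoc)
  finally show ?thesis by (simp add: nn_integral_cmult)
qed

definition incomplete_beta :: "real \<Rightarrow> nat \<Rightarrow> real \<Rightarrow> ennreal" where
  "incomplete_beta \<alpha> n x = (\<integral>\<^sup>+t. indicator {0<..<x} t * ennreal (t ^ n * (1 - t) powr \<alpha>) \<partial>lborel)"

text \<open>These are the weights \<open>W\<^sub>n\<close> of the overview. Here and in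
  \<open>disk_norm_sq\<close> the parameter \<open>x\<close> is the square of the radius.\<close>

definition moment :: "real \<Rightarrow> nat \<Rightarrow> real \<Rightarrow> ennreal" where
  "moment \<alpha> n x = (\<integral>\<^sup>+z. indicator {z. (cmod z)\<^sup>2 < x} z * ennreal (cmod z ^ (2 * n)) \<partial>dA \<alpha>)"

text \<open>This is the Taylor coefficient of (1 - x)^(-(2 + \<alpha>)). The recursion and the
  partial sum identity used later are those of this series.\<close>

definition basis_coeff :: "real \<Rightarrow> nat \<Rightarrow> real" where
  "basis_coeff \<alpha> n = Gamma (real n + 2 + \<alpha>) / (fact n * Gamma (2 + \<alpha>))"

lemma moment_eq_incomplete_beta:
  assumes "\<alpha> > -1" "x \<le> 1"
  shows "moment \<alpha> n x = ennreal (1 + \<alpha>) * incomplete_beta \<alpha> n x"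
proof -
  have "moment \<alpha> n x = (\<integral>\<^sup>+z. ennreal ((1 + \<alpha>) * (1 - (cmod z)\<^sup>2) powr \<alpha> / pi) *
      (indicator {z. (cmod z)\<^sup>2 < x} z * ennreal (cmod z ^ (2 * n))) \<partial>lebesgue_disk)"
    unfolding moment_def by (rule nn_integral_dA) (auto intro!: borel_measurable_lebesgue_disk)
  also have "\<dots> = (\<integral>\<^sup>+z. (\<lambda>t. ennreal ((1 + \<alpha>) * (1 - t) powr \<alpha> / pi) *
      (indicator {..<x} t * ennreal (t ^ n))) ((cmod z)\<^sup>2) \<partial>lebesgue_disk)"
    by (intro nn_integral_cong) (auto simp: indicator_def power_mult)
  also have "\<dots> = ennreal pi * (\<integral>\<^sup>+t. indicator {0<..<1} t * (ennreal ((1 + \<alpha>) * (1 - t) powr \<alpha> / pi) *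
      (indicator {..<x} t * ennreal (t ^ n))) \<partial>lborel)"
    by (rule nn_integral_radial_lebesgue_disk) measurable
  also have "\<dots> = (\<integral>\<^sup>+t. ennreal pi * (indicator {0<..<1} t * (ennreal ((1 + \<alpha>) * (1 - t) powr \<alpha> / pi) *
      (indicator {..<x} t * ennreal (t ^ n)))) \<partial>lborel)"
    by (subst nn_integral_cmult) auto
  also have "\<dots> = (\<integral>\<^sup>+t. ennreal (1 + \<alpha>) * (indicator {0<..<x} t * ennreal (t ^ n * (1 - t) powr \<alpha>)) \<partial>lborel)"
  proof (intro nn_integral_cong)
    fix t :: real
    show "ennreal pi * (indicator {0<..<1} t * (ennreal ((1 + \<alpha>) * (1 - t) powr \<alpha> / pi) *
      (indicator {..<x} t * ennreal (t ^ n)))) = ennreal (1 + \<alpha>) * (indicator {0<..<x} t * ennreal (t ^ n * (1 - t) powr \<alpha>))"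
    proof (cases "t \<in> {0<..<x}")
      case True
      then have "t < 1" "0 < t" using assms by auto
      define X where "X = (1 + \<alpha>) * (1 - t) powr \<alpha> / pi"
      have "0 \<le> X" using assms by (simp add: X_def)
      then have "ennreal pi * (ennreal X * ennreal (t ^ n)) = ennreal (pi * (X * t ^ n))"
        using \<open>0 < t\<close> by (simp add: ennreal_mult)
      then have "ennreal pi * (ennreal ((1 + \<alpha>) * (1 - t) powr \<alpha> / pi) * ennreal (t ^ n)) =
        ennreal (pi * ((1 + \<alpha>) * (1 - t) powr \<alpha> / pi * t ^ n))" unfolding X_def .
      also have "pi * ((1 + \<alpha>) * (1 - t) powr \<alpha> / pi * t ^ n) = (1 + \<alpha>) * (t ^ n * (1 - t) powr \<alpha>)" by simp
      also have "ennreal \<dots> = ennreal (1 + \<alpha>) * ennreal (t ^ n * (1 - t) powr \<alpha>)"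
        using assms by (simp add: ennreal_mult')
      finally show ?thesis using True \<open>t < 1\<close> by simp
    qed (auto simp: indicator_def)
  qed
  also have "\<dots> = ennreal (1 + \<alpha>) * incomplete_beta \<alpha> n x"
    unfolding incomplete_beta_def by (subst nn_integral_cmult) auto
  finally show ?thesis .
qed

lemma incomplete_beta_1:
  assumes "\<alpha> > -1"
  shows "incomplete_beta \<alpha> n 1 = ennreal (Beta (real n + 1) (\<alpha> + 1))"
proof -
  have "((\<lambda>t. t powr (real n + 1 - 1) * (1 - t) powr (\<alpha> + 1 - 1)) has_integral Beta (real n + 1) (\<alpha> + 1)) {0..1}"
    using assms by (intro has_integral_Beta_real) auto
  then have "((\<lambda>t. t powr real n * (1 - t) powr \<alpha>) has_integral Beta (real n + 1) (\<alpha> + 1)) {0<..<1}"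
    by (simp add: has_integral_Icc_iff_Ioo)
  then have "((\<lambda>t. t ^ n * (1 - t) powr \<alpha>) has_integral Beta (real n + 1) (\<alpha> + 1)) {0<..<1}"
    by (rule has_integral_eq[rotated]) (simp add: powr_realpow)
  from nn_integral_has_integral_lebesgue'[OF _ this]
  have "(\<integral>\<^sup>+x. ennreal (x ^ n * (1 - x) powr \<alpha>) * indicator {0<..<1} x \<partial>lborel) = ennreal (Beta (real n + 1) (\<alpha> + 1))"
    by simp
  then show ?thesis unfolding incomplete_beta_def by (simp add: mult.commute)
qed

lemma basis_coeff_pos: "\<alpha> > -1 \<Longrightarrow> 0 < basis_coeff \<alpha> n"
  unfolding basis_coeff_def by (intro divide_pos_pos mult_pos_pos Gamma_real_pos) auto

lemma moment_1:
  assumes "\<alpha> > -1"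
  shows "moment \<alpha> n 1 = ennreal (1 / basis_coeff \<alpha> n)"
proof -
  have "(1 + \<alpha>) * Beta (real n + 1) (\<alpha> + 1) = 1 / basis_coeff \<alpha> n"
  proof -
    have "1 + \<alpha> \<notin> \<int>\<^sub>\<le>\<^sub>0" using assms by (auto dest: nonpos_Ints_nonpos)
    then show ?thesis
      using assms Gamma_plus1[of "1 + \<alpha>"] Gamma_fact[of n, where 'a=real]
      by (simp add: Beta_def basis_coeff_def add_ac)
  qed
  then show ?thesis using assms
    by (simp add: moment_eq_incomplete_beta incomplete_beta_1 ennreal_mult'[symmetric])
qed

lemma basis_coeff_0 [simp]: "\<alpha> > -1 \<Longrightarrow> basis_coeff \<alpha> 0 = 1"
proof -
  assume "\<alpha> > -1"
  then have "Gamma (2 + \<alpha>) > 0" by (intro Gamma_real_pos) simp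
  then show ?thesis by (simp add: basis_coeff_def)
qed

lemma basis_coeff_Suc:
  assumes "\<alpha> > -1"
  shows "basis_coeff \<alpha> (Suc n) = basis_coeff \<alpha> n * (real n + 2 + \<alpha>) / (real n + 1)"
proof -
  have "Gamma (real n + 2 + \<alpha> + 1) = (real n + 2 + \<alpha>) * Gamma (real n + 2 + \<alpha>)"
    using assms by (intro Gamma_plus1) (auto dest: nonpos_Ints_nonpos)
  then show ?thesis using assms by (simp add: basis_coeff_def add_ac field_simps)
qed

text \<open>The ratio of consecutive coefficients is 1 + (1 + \<alpha>) / (k + 1), which decreases
  in \<open>k\<close>; starting from the value 1 at index 0, this makes the sequence
  submultiplicative. It bounds how much of the norm is lost when a function is multiplied by
  z^k.\<close>

lemma basis_coeff_add_le:
  assumes "\<alpha> > -1"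
  shows "basis_coeff \<alpha> (n + k) \<le> basis_coeff \<alpha> n * basis_coeff \<alpha> k"
proof (induction k)
  case (Suc k)
  have "basis_coeff \<alpha> (n + Suc k) = basis_coeff \<alpha> (n + k) * ((real (n + k) + 2 + \<alpha>) / (real (n + k) + 1))"
    using assms by (simp add: basis_coeff_Suc)
  also have "\<dots> \<le> (basis_coeff \<alpha> n * basis_coeff \<alpha> k) * ((real k + 2 + \<alpha>) / (real k + 1))"
  proof (rule mult_mono[OF Suc])
    have "0 \<le> real n * (1 + \<alpha>)" using assms by simp
    then show "(real (n + k) + 2 + \<alpha>) / (real (n + k) + 1) \<le> (real k + 2 + \<alpha>) / (real k + 1)"
      by (simp add: field_simps)
  qed (use assms basis_coeff_pos[OF assms] in \<open>auto intro!: mult_nonneg_nonneg less_imp_le divide_nonneg_nonneg\<close>)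
  finally show ?case using assms by (simp add: basis_coeff_Suc)
qed (simp add: assms)

section \<open>Taylor coefficients and Parseval's identity\<close>

definition taylor_coeff :: "(complex \<Rightarrow> complex) \<Rightarrow> nat \<Rightarrow> complex" where
  "taylor_coeff h n = (deriv ^^ n) h 0 / fact n"

lemma taylor_coeff_sums:
  assumes "h holomorphic_on unit_disk" "z \<in> unit_disk"
  shows "(\<lambda>n. taylor_coeff h n * z ^ n) sums h z"
  using holomorphic_power_series[OF assms] by (simp add: taylor_coeff_def)

lemma taylor_coeff_mult:
  assumes "f holomorphic_on unit_disk" "g holomorphic_on unit_disk"
  shows "taylor_coeff (\<lambda>z. f z * g z) n = (\<Sum>i\<le>n. taylor_coeff f i * taylor_coeff g (n - i))"
proof -
  have "of_nat (n choose i) * (deriv ^^ i) f 0 * (deriv ^^ (n - i)) g 0 / fact n =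
      taylor_coeff f i * taylor_coeff g (n - i)" if "i \<le> n" for i
    using binomial_fact[OF that, where 'a=complex] by (simp add: taylor_coeff_def)
  then show ?thesis
    unfolding taylor_coeff_def[of "\<lambda>z. f z * g z"]
    by (subst higher_deriv_mult[OF assms open_ball]) (auto simp: sum_divide_distrib atLeast0AtMost intro!: sum.cong)
qed

lemma taylor_coeff_cong:
  assumes "\<And>z. z \<in> unit_disk \<Longrightarrow> f z = g z"
  shows "taylor_coeff f n = taylor_coeff g n"
proof -
  have "eventually (\<lambda>z. f z = g z) (nhds 0)"
    using assms eventually_nhds_in_open[of unit_disk 0] by (auto elim!: eventually_mono)
  then show ?thesis unfolding taylor_coeff_def by (simp add: higher_deriv_cong_ev)
qed

lemma taylor_coeff_diff:
  assumes "f holomorphic_on unit_disk" "g holomorphic_on unit_disk"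
  shows "taylor_coeff (\<lambda>z. f z - g z) n = taylor_coeff f n - taylor_coeff g n"
  unfolding taylor_coeff_def by (subst higher_deriv_diff[OF assms open_ball]) (auto simp: diff_divide_distrib)

lemma taylor_coeff_cmult:
  assumes "f holomorphic_on unit_disk"
  shows "taylor_coeff (\<lambda>z. c * f z) n = c * taylor_coeff f n"
  unfolding taylor_coeff_def by (subst higher_deriv_cmult[OF _ _ open_ball, OF assms]) auto

lemma taylor_coeff_polynomial:
  "taylor_coeff (\<lambda>z. \<Sum>i<m. a i * z ^ i) n = (if n < m then a n else 0)"
proof -
  have "(\<lambda>z. \<Sum>i<m. a i * z ^ i) has_fps_expansion (\<Sum>i<m. fps_const (a i) * fps_X ^ i)"
    by (intro fps_expansion_intros)
  from fps_nth_fps_expansion[OF this, of n]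
  have "taylor_coeff (\<lambda>z. \<Sum>i<m. a i * z ^ i) n = (\<Sum>i<m. a i * (if n = i then 1 else 0))"
    by (simp add: taylor_coeff_def fps_sum_nth fps_X_power_nth)
  then show ?thesis by (auto simp: if_distrib cong: if_cong)
qed

lemma taylor_coeff_power: "taylor_coeff (\<lambda>z. z ^ k) n = (if n = k then 1 else 0)"
proof -
  have "(\<lambda>z. z ^ k) has_fps_expansion (fps_X ^ k :: complex fps)"
    by (intro fps_expansion_intros)
  from fps_nth_fps_expansion[OF this, of n] show ?thesis
    by (simp add: taylor_coeff_def fps_X_power_nth split: if_splits)
qed

lemma taylor_coeff_power_mult:
  assumes "f holomorphic_on unit_disk"
  shows "taylor_coeff (\<lambda>z. z ^ k * f z) n = (if n < k then 0 else taylor_coeff f (n - k))"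
proof -
  have "taylor_coeff (\<lambda>z. z ^ k * f z) n = (\<Sum>i\<le>n. taylor_coeff (\<lambda>z. z ^ k) i * taylor_coeff f (n - i))"
    using assms by (intro taylor_coeff_mult holomorphic_intros)
  also have "\<dots> = (\<Sum>i\<le>n. if i = k then taylor_coeff f (n - i) else 0)"
    by (intro sum.cong) (auto simp: taylor_coeff_power)
  finally show ?thesis by (auto simp: sum.delta)
qed

section \<open>Finiteness of the measure and orthogonality of the monomials\<close>

lemma finite_measure_dA:
  assumes "\<alpha> > -1"
  shows "finite_measure (dA \<alpha>)"
proof
  have "emeasure (dA \<alpha>) (space (dA \<alpha>)) = (\<integral>\<^sup>+z. 1 \<partial>dA \<alpha>)" by simp
  also have "\<dots> = moment \<alpha> 0 1"
    unfolding moment_def by (intro nn_integral_cong) (simp add: power_less_one_iff abs_square_less_1)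
  finally show "emeasure (dA \<alpha>) (space (dA \<alpha>)) \<noteq> \<infinity>" using moment_1[OF assms, of 0] by simp
qed

lemma integrable_dA_bounded:
  fixes f :: "complex \<Rightarrow> 'a::{banach, second_countable_topology}"
  assumes "\<alpha> > -1" "f \<in> borel_measurable (dA \<alpha>)" "\<And>z. z \<in> unit_disk \<Longrightarrow> norm (f z) \<le> B"
  shows "integrable (dA \<alpha>) f"
proof (rule finite_measure.integrable_const_bound[OF finite_measure_dA[OF assms(1)]])
  show "AE z in dA \<alpha>. norm (f z) \<le> B" using assms(3) by (intro AE_I2) simp
qed (rule assms(2))

lemma borel_measurable_dA:
  "f \<in> borel_measurable borel \<Longrightarrow> f \<in> borel_measurable (dA \<alpha>)"
  by (subst measurable_cong_sets[OF sets_dA refl]) (rule borel_measurable_lebesgue_disk)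

lemma borel_measurable_cnj [measurable]: "cnj \<in> borel_measurable borel"
  by (intro borel_measurable_continuous_onI continuous_intros)

lemma disk_automorphism_rotation:
  assumes "cmod u = 1"
  shows "disk_automorphism (\<lambda>z. u * z) (\<lambda>z. cnj u * z)"
proof -
  have [simp]: "deriv (\<lambda>z. u * z) = (\<lambda>z. u)"
    by (rule ext, rule DERIV_imp_deriv) (auto intro!: derivative_eq_intros)
  have "cnj u * u = 1" using assms complex_norm_square[of u] by (simp add: mult.commute)
  then show ?thesis using assms unfolding disk_automorphism_def
    by (auto intro!: holomorphic_intros boundedI[of _ 1] simp: norm_mult mult.assoc[symmetric] mult.commute[of u "cnj u"])
qed

abbreviation disk_indicator :: "real \<Rightarrow> complex \<Rightarrow> real" where
  "disk_indicator x \<equiv> indicator {z. (cmod z)\<^sup>2 < x}"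

definition monomial_inner :: "real \<Rightarrow> real \<Rightarrow> nat \<Rightarrow> nat \<Rightarrow> complex" where
  "monomial_inner \<alpha> x n k = (\<integral>z. of_real (disk_indicator x z) * (z ^ n * cnj z ^ k) \<partial>dA \<alpha>)"

lemma monomial_inner_integrable:
  assumes "\<alpha> > -1"
  shows "integrable (dA \<alpha>) (\<lambda>z. of_real (disk_indicator x z) * (z ^ n * cnj z ^ k))"
proof (rule integrable_dA_bounded[OF assms, where B=1])
  fix z :: complex assume "z \<in> unit_disk"
  then have "cmod z ^ n * cmod z ^ k \<le> 1"
    by (simp add: power_le_one flip: power_add)
  then show "norm (of_real (disk_indicator x z) * (z ^ n * cnj z ^ k)) \<le> 1"
    by (simp add: norm_mult norm_power indicator_def)
next
  show "(\<lambda>z. complex_of_real (disk_indicator x z) * (z ^ n * cnj z ^ k)) \<in> borel_measurable (dA \<alpha>)"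
    by (rule borel_measurable_dA) measurable
qed

text \<open>A rotation by an angle \<open>t\<close> with (n - k) t = pi preserves both
  \<open>dA\<close> and the concentric disk but multiplies the integrand by -1, so the integral
  equals its own negative.\<close>

lemma monomial_inner_diff:
  assumes "n \<noteq> k"
  shows "monomial_inner \<alpha> x n k = 0"
proof -
  define t where "t = pi / (real n - real k)"
  define u where "u = cis t"
  have u: "cmod u = 1" by (simp add: u_def)
  have nk: "u ^ n * cnj u ^ k = -1"
  proof -
    have "u ^ n * cnj u ^ k = cis (real n * t + real k * - t)"
      by (simp only: u_def cis_cnj Complex.DeMoivre cis_mult)
    also have "real n * t + real k * - t = (real n - real k) * t" by (simp add: algebra_simps)
    also have "\<dots> = pi" using assms by (simp add: t_def)
    finally show ?thesis by simp
  qed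
  have [simp]: "deriv (\<lambda>z. u * z) z = u" for z
    by (rule DERIV_imp_deriv) (auto intro!: derivative_eq_intros)
  have m: "(\<lambda>z. complex_of_real (disk_indicator x z) * (z ^ n * cnj z ^ k)) \<in> borel_measurable lebesgue_disk"
    by (rule borel_measurable_lebesgue_disk) measurable
  have "monomial_inner \<alpha> x n k =
    (\<integral>z. (cmod (deriv (\<lambda>z. u * z) z) powr (2 + \<alpha>)) *\<^sub>R (of_real (disk_indicator x (u * z)) * ((u * z) ^ n * cnj (u * z) ^ k)) \<partial>dA \<alpha>)"
    unfolding monomial_inner_def
    using integral_dA_change_of_variables[OF disk_automorphism_rotation[OF u] m, of \<alpha>] .
  also have "\<dots> = (\<integral>z. (u ^ n * cnj u ^ k) * (of_real (disk_indicator x z) * (z ^ n * cnj z ^ k)) \<partial>dA \<alpha>)"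
  proof (intro Bochner_Integration.integral_cong refl)
    fix z
    have "disk_indicator x (u * z) = disk_indicator x z" by (simp add: indicator_def norm_mult u)
    moreover have "cmod (deriv (\<lambda>z. u * z) z) powr (2 + \<alpha>) = 1" by (simp add: u)
    ultimately show "(cmod (deriv (\<lambda>z. u * z) z) powr (2 + \<alpha>)) *\<^sub>R (of_real (disk_indicator x (u * z)) * ((u * z) ^ n * cnj (u * z) ^ k)) =
      (u ^ n * cnj u ^ k) * (of_real (disk_indicator x z) * (z ^ n * cnj z ^ k))"
      by (simp only: complex_cnj_mult power_mult_distrib scaleR_one mult_ac)
  qed
  also have "\<dots> = - monomial_inner \<alpha> x n k"
    unfolding nk monomial_inner_def by simp
  finally show ?thesis by simp
qed

lemma moment_finite:
  assumes "\<alpha> > -1"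
  shows "moment \<alpha> n x < \<infinity>"
proof -
  have "moment \<alpha> n x \<le> moment \<alpha> n 1"
    unfolding moment_def
    by (intro nn_integral_mono) (auto simp: indicator_def power_less_one_iff abs_square_less_1)
  then show ?thesis using moment_1[OF assms, of n] by (simp add: le_less_trans)
qed

lemma monomial_inner_same:
  assumes "\<alpha> > -1"
  shows "monomial_inner \<alpha> x n n = of_real (enn2real (moment \<alpha> n x))"
proof -
  have m: "(\<lambda>z. disk_indicator x z * cmod z ^ (2 * n)) \<in> borel_measurable (dA \<alpha>)"
    by (rule borel_measurable_dA) measurable
  have zz: "z ^ n * cnj z ^ n = of_real (cmod z ^ (2 * n))" for z
    by (simp only: power_mult of_real_power[of _ n] complex_norm_square power_mult_distrib)
  have "monomial_inner \<alpha> x n n = (\<integral>z. of_real (disk_indicator x z * cmod z ^ (2 * n)) \<partial>dA \<alpha>)"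
    unfolding monomial_inner_def
    unfolding zz of_real_mult ..
  also have "\<dots> = complex_of_real (\<integral>z. disk_indicator x z * cmod z ^ (2 * n) \<partial>dA \<alpha>)"
    by (rule integral_complex_of_real)
  also have "(\<integral>z. disk_indicator x z * cmod z ^ (2 * n) \<partial>dA \<alpha>) = enn2real (moment \<alpha> n x)"
    unfolding moment_def
    by (subst integral_eq_nn_integral)
      (auto intro!: arg_cong[where f=enn2real] nn_integral_cong m simp: indicator_def)
  finally show ?thesis .
qed

section \<open>Parseval's identity on concentric disks\<close>

definition disk_norm_sq :: "real \<Rightarrow> real \<Rightarrow> (complex \<Rightarrow> complex) \<Rightarrow> ennreal" where
  "disk_norm_sq \<alpha> x f = (\<integral>\<^sup>+z. ennreal (disk_indicator x z) * ennreal ((cmod (f z))\<^sup>2) \<partial>dA \<alpha>)"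

lemma disk_norm_sq_polynomial:
  assumes "\<alpha> > -1"
  shows "disk_norm_sq \<alpha> x (\<lambda>z. \<Sum>n<N. b n * z ^ n) = (\<Sum>n<N. ennreal ((cmod (b n))\<^sup>2) * moment \<alpha> n x)"
proof -
  let ?p = "\<lambda>z. \<Sum>n<N. b n * z ^ n"
  have eq: "complex_of_real (disk_indicator x z * (cmod (?p z))\<^sup>2) =
      (\<Sum>n<N. \<Sum>k<N. (b n * cnj (b k)) * (of_real (disk_indicator x z) * (z ^ n * cnj z ^ k)))" for z
    unfolding of_real_mult complex_norm_square cnj_sum complex_cnj_mult complex_cnj_power sum_product
    by (simp add: sum_distrib_left mult_ac)
  have int: "integrable (dA \<alpha>) (\<lambda>z. complex_of_real (disk_indicator x z * (cmod (?p z))\<^sup>2))"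
    unfolding eq by (intro Bochner_Integration.integrable_sum integrable_mult_right monomial_inner_integrable assms)
  then have intr: "integrable (dA \<alpha>) (\<lambda>z. disk_indicator x z * (cmod (?p z))\<^sup>2)"
    using integrable_Re[OF int] by (simp only: Re_complex_of_real)
  have "complex_of_real (\<integral>z. disk_indicator x z * (cmod (?p z))\<^sup>2 \<partial>dA \<alpha>) =
      (\<integral>z. complex_of_real (disk_indicator x z * (cmod (?p z))\<^sup>2) \<partial>dA \<alpha>)"
    by (rule integral_complex_of_real[symmetric])
  also have "\<dots> = (\<Sum>n<N. \<Sum>k<N. (b n * cnj (b k)) * monomial_inner \<alpha> x n k)"
    unfolding eq monomial_inner_def
    by (subst Bochner_Integration.integral_sum | intro Bochner_Integration.integrable_sum integrable_mult_right monomial_inner_integrable assms sum.cong refl integral_mult_right_zero)+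
  also have "\<dots> = (\<Sum>n<N. (b n * cnj (b n)) * monomial_inner \<alpha> x n n)"
  proof (intro sum.cong refl)
    fix n assume "n \<in> {..<N}"
    then show "(\<Sum>k<N. (b n * cnj (b k)) * monomial_inner \<alpha> x n k) = (b n * cnj (b n)) * monomial_inner \<alpha> x n n"
      by (subst sum.remove[of _ n]) (auto simp: monomial_inner_diff)
  qed
  also have "\<dots> = of_real (\<Sum>n<N. (cmod (b n))\<^sup>2 * enn2real (moment \<alpha> n x))"
    unfolding monomial_inner_same[OF assms] of_real_sum of_real_mult complex_norm_square ..
  finally have I: "(\<integral>z. disk_indicator x z * (cmod (?p z))\<^sup>2 \<partial>dA \<alpha>) = (\<Sum>n<N. (cmod (b n))\<^sup>2 * enn2real (moment \<alpha> n x))"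
    by (simp only: of_real_eq_iff)
  have "disk_norm_sq \<alpha> x ?p = (\<integral>\<^sup>+z. ennreal (disk_indicator x z * (cmod (?p z))\<^sup>2) \<partial>dA \<alpha>)"
    unfolding disk_norm_sq_def by (intro nn_integral_cong) (simp add: ennreal_mult')
  also have "\<dots> = ennreal (\<Sum>n<N. (cmod (b n))\<^sup>2 * enn2real (moment \<alpha> n x))"
    unfolding I[symmetric] by (rule nn_integral_eq_integral[OF intr]) auto
  also have "\<dots> = (\<Sum>n<N. ennreal ((cmod (b n))\<^sup>2) * moment \<alpha> n x)"
    using moment_finite[OF assms]
    by (subst sum_ennreal[symmetric]) (auto simp: ennreal_mult' intro!: sum.cong)
  finally show ?thesis .
qed

lemma disk_norm_sq_measurable:
  assumes "f holomorphic_on unit_disk"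
  shows "(\<lambda>z. ennreal (disk_indicator x z) * ennreal ((cmod (f z))\<^sup>2)) \<in> borel_measurable (dA \<alpha>)"
proof -
  have [measurable]: "f \<in> borel_measurable (dA \<alpha>)"
    by (intro borel_measurable_dA_continuous holomorphic_on_imp_continuous_on assms)
  have [measurable]: "disk_indicator x \<in> borel_measurable (dA \<alpha>)"
    by (rule borel_measurable_dA) measurable
  show ?thesis by measurable
qed

text \<open>Provides the constant that dominates all partial sums when integrals over a smaller disk
  are passed to the limit. Convergence at a point \<open>q\<close> strictly between the radius and 1
  gives absolute convergence at the radius itself.\<close>

lemma taylor_partial_sum_bound:
  assumes h: "h holomorphic_on unit_disk" and x: "0 \<le> x" "x < 1"
  obtains B where "\<And>z N. (cmod z)\<^sup>2 < x \<Longrightarrow> cmod (\<Sum>n<N. taylor_coeff h n * z ^ n) \<le> B" "0 \<le> B"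
proof -
  define r where "r = sqrt x"
  have r: "0 \<le> r" "r < 1" using x by (auto simp: r_def)
  define q where "q = (1 + r) / 2"
  have q: "r < q" "q < 1" "0 < q" using r by (auto simp: q_def)
  have "summable (\<lambda>n. taylor_coeff h n * (complex_of_real q) ^ n)"
    using taylor_coeff_sums[OF h, of "of_real q"] q by (auto simp: sums_iff)
  then have "summable (\<lambda>n. norm (taylor_coeff h n * (complex_of_real r) ^ n))"
    by (rule powser_insidea) (use r q in auto)
  then have S: "summable (\<lambda>n. cmod (taylor_coeff h n) * r ^ n)"
    using r by (simp add: norm_mult norm_power)
  show thesis
  proof (rule that)
    show "0 \<le> (\<Sum>n. cmod (taylor_coeff h n) * r ^ n)" using S r by (intro suminf_nonneg) auto
    fix z N assume "(cmod z)\<^sup>2 < x"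
    then have "cmod z \<le> r" unfolding r_def by (intro real_le_rsqrt) simp
    then have "cmod (\<Sum>n<N. taylor_coeff h n * z ^ n) \<le> (\<Sum>n<N. cmod (taylor_coeff h n) * r ^ n)"
      by (intro sum_norm_le) (auto simp: norm_mult norm_power intro!: mult_left_mono power_mono)
    also have "\<dots> \<le> (\<Sum>n. cmod (taylor_coeff h n) * r ^ n)"
      using S r by (intro sum_le_suminf) auto
    finally show "cmod (\<Sum>n<N. taylor_coeff h n * z ^ n) \<le> (\<Sum>n. cmod (taylor_coeff h n) * r ^ n)" .
  qed
qed

lemma disk_norm_sq_taylor_less:
  assumes \<alpha>: "\<alpha> > -1" and h: "h holomorphic_on unit_disk" and x: "x < 1"
  shows "disk_norm_sq \<alpha> x h = (\<Sum>n. ennreal ((cmod (taylor_coeff h n))\<^sup>2) * moment \<alpha> n x)"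
proof (cases "0 \<le> x")
  case True
  obtain B where B: "\<And>z N. (cmod z)\<^sup>2 < x \<Longrightarrow> cmod (\<Sum>n<N. taylor_coeff h n * z ^ n) \<le> B" "0 \<le> B"
    using taylor_partial_sum_bound[OF h True x] by blast
  let ?S = "\<lambda>N z. \<Sum>n<N. taylor_coeff h n * z ^ n"
  have "(\<lambda>N. disk_norm_sq \<alpha> x (?S N)) \<longlonglongrightarrow> disk_norm_sq \<alpha> x h"
    unfolding disk_norm_sq_def
  proof (rule nn_integral_dominated_convergence[where w="\<lambda>z. ennreal (B\<^sup>2)"])
    show "(\<lambda>z. ennreal (disk_indicator x z) * ennreal ((cmod (?S N z))\<^sup>2)) \<in> borel_measurable (dA \<alpha>)" for N
      by (intro disk_norm_sq_measurable holomorphic_intros)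
    show "(\<lambda>z. ennreal (disk_indicator x z) * ennreal ((cmod (h z))\<^sup>2)) \<in> borel_measurable (dA \<alpha>)"
      by (intro disk_norm_sq_measurable h)
    have "emeasure (dA \<alpha>) (space (dA \<alpha>)) < \<infinity>"
      using finite_measure.emeasure_finite[OF finite_measure_dA[OF \<alpha>], of "space (dA \<alpha>)"]
      by (simp add: less_top)
    then show "(\<integral>\<^sup>+z. ennreal (B\<^sup>2) \<partial>dA \<alpha>) < \<infinity>"
      by (simp add: ennreal_mult_less_top)
    show "AE z in dA \<alpha>. ennreal (disk_indicator x z) * ennreal ((cmod (?S N z))\<^sup>2) \<le> ennreal (B\<^sup>2)" for N
    proof (rule AE_I2)
      fix z
      show "ennreal (disk_indicator x z) * ennreal ((cmod (?S N z))\<^sup>2) \<le> ennreal (B\<^sup>2)"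
        using power_mono[OF B(1)[of z N], of 2] by (cases "(cmod z)\<^sup>2 < x") (auto intro!: ennreal_leI)
    qed
    show "AE z in dA \<alpha>. (\<lambda>N. ennreal (disk_indicator x z) * ennreal ((cmod (?S N z))\<^sup>2))
        \<longlonglongrightarrow> ennreal (disk_indicator x z) * ennreal ((cmod (h z))\<^sup>2)"
    proof (rule AE_I2)
      fix z assume "z \<in> space (dA \<alpha>)"
      then have "(\<lambda>N. ?S N z) \<longlonglongrightarrow> h z" using taylor_coeff_sums[OF h, of z] by (simp add: sums_def)
      then have "(\<lambda>N. disk_indicator x z * (cmod (?S N z))\<^sup>2) \<longlonglongrightarrow> disk_indicator x z * (cmod (h z))\<^sup>2"
        by (intro tendsto_intros)
      then have "(\<lambda>N. ennreal (disk_indicator x z * (cmod (?S N z))\<^sup>2)) \<longlonglongrightarrow> ennreal (disk_indicator x z * (cmod (h z))\<^sup>2)"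
        by (rule tendsto_ennrealI)
      then show "(\<lambda>N. ennreal (disk_indicator x z) * ennreal ((cmod (?S N z))\<^sup>2))
        \<longlonglongrightarrow> ennreal (disk_indicator x z) * ennreal ((cmod (h z))\<^sup>2)"
        by (simp add: ennreal_mult')
    qed
  qed simp
  then have "(\<lambda>n. ennreal ((cmod (taylor_coeff h n))\<^sup>2) * moment \<alpha> n x) sums disk_norm_sq \<alpha> x h"
    by (simp add: sums_def disk_norm_sq_polynomial[OF \<alpha>])
  then show ?thesis by (rule sums_unique)
next
  case False
  then have "disk_indicator x z = 0" for z
    by (auto simp: indicator_def dest: le_less_trans[OF zero_le_power2])
  then show ?thesis by (simp add: disk_norm_sq_def moment_def indicator_def)
qed

lemma SUP_disk_indicator:
  fixes c :: ennreal
  assumes "z \<in> unit_disk"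
  shows "ennreal (disk_indicator 1 z) * c = (SUP i. ennreal (disk_indicator (1 - 1 / real (Suc i)) z) * c)"
proof -
  have "0 < 1 - (cmod z)\<^sup>2" by (rule one_minus_norm_sq_pos[OF assms])
  then obtain i where i: "inverse (real (Suc i)) < 1 - (cmod z)\<^sup>2" using reals_Archimedean by blast
  then have "disk_indicator (1 - 1 / real (Suc i)) z = 1" by (simp add: inverse_eq_divide)
  then have "c \<le> (SUP i. ennreal (disk_indicator (1 - 1 / real (Suc i)) z) * c)"
    by (intro SUP_upper2[of i]) auto
  moreover have "(SUP i. ennreal (disk_indicator (1 - 1 / real (Suc i)) z) * c) \<le> c"
    by (intro SUP_least) (auto simp: indicator_def)
  ultimately show ?thesis using assms \<open>0 < 1 - (cmod z)\<^sup>2\<close> by (simp add: antisym)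
qed

lemma incseq_disk_indicator: "incseq (\<lambda>i z. ennreal (disk_indicator (1 - 1 / real (Suc i)) z) * c z)"
proof (intro incseq_SucI le_funI mult_right_mono ennreal_leI)
  fix i z
  have "1 - 1 / real (Suc i) \<le> 1 - 1 / real (Suc (Suc i))"
    by (simp add: field_simps)
  then show "disk_indicator (1 - 1 / real (Suc i)) z \<le> disk_indicator (1 - 1 / real (Suc (Suc i))) z"
    by (auto simp: indicator_def simp del: of_nat_Suc)
qed simp

lemma disk_norm_sq_SUP:
  assumes "f holomorphic_on unit_disk"
  shows "disk_norm_sq \<alpha> 1 f = (SUP i. disk_norm_sq \<alpha> (1 - 1 / real (Suc i)) f)"
proof -
  have "disk_norm_sq \<alpha> 1 f = (\<integral>\<^sup>+z. (SUP i. ennreal (disk_indicator (1 - 1 / real (Suc i)) z) * ennreal ((cmod (f z))\<^sup>2)) \<partial>dA \<alpha>)"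
    unfolding disk_norm_sq_def by (intro nn_integral_cong SUP_disk_indicator) simp
  also have "\<dots> = (SUP i. disk_norm_sq \<alpha> (1 - 1 / real (Suc i)) f)"
    unfolding disk_norm_sq_def
    by (intro nn_integral_monotone_convergence_SUP incseq_disk_indicator disk_norm_sq_measurable assms)
  finally show ?thesis .
qed

lemma moment_eq_disk_norm_sq: "moment \<alpha> n x = disk_norm_sq \<alpha> x (\<lambda>z. z ^ n)"
  unfolding moment_def disk_norm_sq_def
  by (intro nn_integral_cong) (auto simp: indicator_def norm_power power_mult mult.commute simp flip: power_mult)

lemma disk_norm_sq_mono: "x \<le> y \<Longrightarrow> disk_norm_sq \<alpha> x f \<le> disk_norm_sq \<alpha> y f"
  unfolding disk_norm_sq_def by (intro nn_integral_mono mult_right_mono ennreal_leI) (auto simp: indicator_def)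

text \<open>On the full disk the partial sums need not be dominated. Both sides are instead suprema
  over the radii squared 1 - 1/(i + 1), and monotone convergence moves the supremum through the
  series. The identity therefore also holds when both sides are infinite.\<close>

lemma disk_norm_sq_taylor:
  assumes \<alpha>: "\<alpha> > -1" and h: "h holomorphic_on unit_disk" and x: "x \<le> 1"
  shows "disk_norm_sq \<alpha> x h = (\<Sum>n. ennreal ((cmod (taylor_coeff h n))\<^sup>2) * moment \<alpha> n x)"
proof (cases "x = 1")
  case True
  let ?x = "\<lambda>i. 1 - 1 / real (Suc i)"
  have inc: "incseq (\<lambda>i. disk_norm_sq \<alpha> (?x i) f)" for f
    by (intro incseq_SucI disk_norm_sq_mono) (simp add: field_simps)
  have "disk_norm_sq \<alpha> 1 h = (SUP i. \<Sum>n. ennreal ((cmod (taylor_coeff h n))\<^sup>2) * moment \<alpha> n (?x i))"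
    by (subst disk_norm_sq_SUP[OF h], subst disk_norm_sq_taylor_less[OF \<alpha> h]) auto
  also have "\<dots> = (\<Sum>n. SUP i. ennreal ((cmod (taylor_coeff h n))\<^sup>2) * moment \<alpha> n (?x i))"
    using inc unfolding moment_eq_disk_norm_sq
    by (intro ennreal_suminf_SUP_eq[symmetric]) (auto simp: incseq_def intro!: mult_left_mono)
  also have "\<dots> = (\<Sum>n. ennreal ((cmod (taylor_coeff h n))\<^sup>2) * moment \<alpha> n 1)"
    unfolding moment_eq_disk_norm_sq
    by (simp add: disk_norm_sq_SUP[of "\<lambda>z. z ^ _"] holomorphic_intros SUP_mult_left_ennreal del: of_nat_Suc)
  finally show ?thesis using True by simp
qed (use disk_norm_sq_taylor_less[OF \<alpha> h, of x] x in auto)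

lemma disk_norm_sq_1:
  "disk_norm_sq \<alpha> 1 f = (\<integral>\<^sup>+z. ennreal ((cmod (f z))\<^sup>2) \<partial>dA \<alpha>)"
  unfolding disk_norm_sq_def by (intro nn_integral_cong) (simp add: power_less_one_iff abs_square_less_1)

section \<open>The Bergman norm and the pairing with the basis\<close>

lemma bergman_iff:
  "f \<in> bergman \<alpha> \<longleftrightarrow> f holomorphic_on unit_disk \<and> disk_norm_sq \<alpha> 1 f < \<infinity>"
proof -
  have "integrable (dA \<alpha>) (\<lambda>z. (cmod (f z))\<^sup>2) \<longleftrightarrow> disk_norm_sq \<alpha> 1 f < \<infinity>" if "f holomorphic_on unit_disk"
  proof -
    have [measurable]: "f \<in> borel_measurable (dA \<alpha>)"
      by (intro borel_measurable_dA_continuous holomorphic_on_imp_continuous_on that)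
    show ?thesis unfolding integrable_iff_bounded disk_norm_sq_1 by simp
  qed
  then show ?thesis by (auto simp: bergman_def)
qed

lemma bergman_norm_sq:
  assumes "f \<in> bergman \<alpha>"
  shows "ennreal ((bergman_norm \<alpha> f)\<^sup>2) = disk_norm_sq \<alpha> 1 f"
proof -
  have "(bergman_norm \<alpha> f)\<^sup>2 = (\<integral>z. (cmod (f z))\<^sup>2 \<partial>dA \<alpha>)"
    unfolding bergman_norm_def by (intro real_sqrt_pow2 Bochner_Integration.integral_nonneg) simp
  also have "ennreal \<dots> = disk_norm_sq \<alpha> 1 f"
    using assms unfolding disk_norm_sq_1 bergman_def
    by (intro nn_integral_eq_integral[symmetric]) auto
  finally show ?thesis .
qed

text \<open>By orthogonality the integral of a partial sum no longer changes once it contains the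
  term of degree \<open>k\<close>. Dominated convergence, available because x < 1, carries this
  value over to \<open>h\<close>.\<close>

lemma integral_disk_monomial:
  assumes \<alpha>: "\<alpha> > -1" and h: "h holomorphic_on unit_disk" and x: "0 \<le> x" "x < 1"
  shows "(\<integral>z. of_real (disk_indicator x z) * (h z * cnj z ^ k) \<partial>dA \<alpha>) = taylor_coeff h k * monomial_inner \<alpha> x k k"
proof -
  obtain B where B: "\<And>z N. (cmod z)\<^sup>2 < x \<Longrightarrow> cmod (\<Sum>n<N. taylor_coeff h n * z ^ n) \<le> B" "0 \<le> B"
    using taylor_partial_sum_bound[OF h x] by blast
  let ?S = "\<lambda>N z. \<Sum>n<N. taylor_coeff h n * z ^ n"
  let ?I = "\<lambda>g. \<integral>z. of_real (disk_indicator x z) * (g z * cnj z ^ k) \<partial>dA \<alpha>"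
  have meas: "(\<lambda>z. complex_of_real (disk_indicator x z) * (g z * cnj z ^ k)) \<in> borel_measurable (dA \<alpha>)"
    if "g holomorphic_on unit_disk" for g
  proof -
    have [measurable]: "g \<in> borel_measurable (dA \<alpha>)"
      by (intro borel_measurable_dA_continuous holomorphic_on_imp_continuous_on that)
    have [measurable]: "disk_indicator x \<in> borel_measurable (dA \<alpha>)" "cnj \<in> borel_measurable (dA \<alpha>)"
      by (rule borel_measurable_dA, measurable)+
    show ?thesis by measurable
  qed
  have lim: "(\<lambda>N. ?I (?S N)) \<longlonglongrightarrow> ?I h"
  proof (rule integral_dominated_convergence[where w="\<lambda>z. B"])
    show "(\<lambda>z. complex_of_real (disk_indicator x z) * (?S N z * cnj z ^ k)) \<in> borel_measurable (dA \<alpha>)" for N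
      by (intro meas holomorphic_intros)
    show "(\<lambda>z. complex_of_real (disk_indicator x z) * (h z * cnj z ^ k)) \<in> borel_measurable (dA \<alpha>)"
      by (rule meas[OF h])
    show "integrable (dA \<alpha>) (\<lambda>z. B)"
      using B(2) by (intro integrable_dA_bounded[OF \<alpha>, where B=B]) auto
    show "AE z in dA \<alpha>. norm (complex_of_real (disk_indicator x z) * (?S N z * cnj z ^ k)) \<le> B" for N
    proof (rule AE_I2)
      fix z assume "z \<in> space (dA \<alpha>)"
      then have "cmod z ^ k \<le> 1" by (simp add: power_le_one)
      then show "norm (complex_of_real (disk_indicator x z) * (?S N z * cnj z ^ k)) \<le> B"
        using mult_mono[OF B(1)[of z N], of "cmod z ^ k" 1] B(2)
        by (cases "(cmod z)\<^sup>2 < x") (auto simp: norm_mult norm_power)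
    qed
    show "AE z in dA \<alpha>. (\<lambda>N. complex_of_real (disk_indicator x z) * (?S N z * cnj z ^ k))
        \<longlonglongrightarrow> complex_of_real (disk_indicator x z) * (h z * cnj z ^ k)"
    proof (rule AE_I2)
      fix z assume "z \<in> space (dA \<alpha>)"
      then have "(\<lambda>N. ?S N z) \<longlonglongrightarrow> h z" using taylor_coeff_sums[OF h, of z] by (simp add: sums_def)
      then show "(\<lambda>N. complex_of_real (disk_indicator x z) * (?S N z * cnj z ^ k))
        \<longlonglongrightarrow> complex_of_real (disk_indicator x z) * (h z * cnj z ^ k)"
        by (intro tendsto_intros)
    qed
  qed
  have eq: "?I (?S N) = taylor_coeff h k * monomial_inner \<alpha> x k k" if "N > k" for N
  proof -
    have "?I (?S N) = (\<integral>z. (\<Sum>n<N. taylor_coeff h n * (of_real (disk_indicator x z) * (z ^ n * cnj z ^ k))) \<partial>dA \<alpha>)"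
      by (intro Bochner_Integration.integral_cong refl) (simp add: sum_distrib_left sum_distrib_right mult_ac)
    also have "\<dots> = (\<Sum>n<N. taylor_coeff h n * monomial_inner \<alpha> x n k)"
      unfolding monomial_inner_def
      by (subst Bochner_Integration.integral_sum)
        (intro integrable_mult_right monomial_inner_integrable \<alpha> sum.cong refl integral_mult_right_zero)+
    also have "\<dots> = taylor_coeff h k * monomial_inner \<alpha> x k k"
      using that by (subst sum.remove[of _ k]) (auto simp: monomial_inner_diff)
    finally show ?thesis .
  qed
  have "(\<lambda>N. ?I (?S N)) \<longlonglongrightarrow> taylor_coeff h k * monomial_inner \<alpha> x k k"
    using eq by (intro tendsto_eventually eventually_mono[OF eventually_gt_at_top[of k]]) auto
  from LIMSEQ_unique[OF lim this] show ?thesis .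
qed

text \<open>Since the measure is finite, 1 + |h|^2 is an integrable majorant of |h|, hence of |h|
  |z|^k.\<close>

lemma integral_disk_exhaustion:
  assumes \<alpha>: "\<alpha> > -1" and h: "h \<in> bergman \<alpha>"
  shows "(\<lambda>i. \<integral>z. of_real (disk_indicator (1 - 1 / real (Suc i)) z) * (h z * cnj z ^ k) \<partial>dA \<alpha>)
    \<longlonglongrightarrow> (\<integral>z. h z * cnj z ^ k \<partial>dA \<alpha>)"
proof (rule integral_dominated_convergence[where w="\<lambda>z. 1 + (cmod (h z))\<^sup>2"])
  have hol: "h holomorphic_on unit_disk" using h by (simp add: bergman_def)
  have [measurable]: "h \<in> borel_measurable (dA \<alpha>)"
    by (intro borel_measurable_dA_continuous holomorphic_on_imp_continuous_on hol)
  have [measurable]: "cnj \<in> borel_measurable (dA \<alpha>)" "disk_indicator x \<in> borel_measurable (dA \<alpha>)" for x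
    by (rule borel_measurable_dA, measurable)+
  show "(\<lambda>z. h z * cnj z ^ k) \<in> borel_measurable (dA \<alpha>)" by measurable
  show "(\<lambda>z. complex_of_real (disk_indicator (1 - 1 / real (Suc i)) z) * (h z * cnj z ^ k)) \<in> borel_measurable (dA \<alpha>)" for i
    by measurable
  show "integrable (dA \<alpha>) (\<lambda>z. 1 + (cmod (h z))\<^sup>2)"
  proof (rule Bochner_Integration.integrable_add)
    show "integrable (dA \<alpha>) (\<lambda>z. 1::real)" by (rule integrable_dA_bounded[OF \<alpha>, where B=1]) auto
  qed (use h in \<open>simp add: bergman_def\<close>)
  show "AE z in dA \<alpha>. norm (complex_of_real (disk_indicator (1 - 1 / real (Suc i)) z) * (h z * cnj z ^ k)) \<le> 1 + (cmod (h z))\<^sup>2" for i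
  proof (rule AE_I2)
    fix z assume "z \<in> space (dA \<alpha>)"
    then have "cmod z ^ k \<le> 1" by (simp add: power_le_one)
    then have "cmod (h z) * cmod z ^ k \<le> cmod (h z)" by (simp add: mult_left_le)
    also have "\<dots> \<le> 1 + (cmod (h z))\<^sup>2"
      using sum_squares_bound[of 1 "cmod (h z)"] by simp (smt (verit) norm_ge_zero)
    finally show "norm (complex_of_real (disk_indicator (1 - 1 / real (Suc i)) z) * (h z * cnj z ^ k)) \<le> 1 + (cmod (h z))\<^sup>2"
      by (auto simp: norm_mult norm_power indicator_def add_nonneg_nonneg)
  qed
  show "AE z in dA \<alpha>. (\<lambda>i. complex_of_real (disk_indicator (1 - 1 / real (Suc i)) z) * (h z * cnj z ^ k)) \<longlonglongrightarrow> h z * cnj z ^ k"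
  proof (rule AE_I2)
    fix z assume "z \<in> space (dA \<alpha>)"
    then have "0 < 1 - (cmod z)\<^sup>2" by (intro one_minus_norm_sq_pos) simp
    moreover have "(\<lambda>i. inverse (real (Suc i))) \<longlonglongrightarrow> 0" by (rule LIMSEQ_inverse_real_of_nat)
    ultimately have "eventually (\<lambda>i. inverse (real (Suc i)) < 1 - (cmod z)\<^sup>2) sequentially"
      by (rule order_tendstoD(2)[rotated])
    then have "eventually (\<lambda>i. complex_of_real (disk_indicator (1 - 1 / real (Suc i)) z) * (h z * cnj z ^ k) = h z * cnj z ^ k) sequentially"
      by (rule eventually_mono) (simp add: indicator_def inverse_eq_divide)
    then show "(\<lambda>i. complex_of_real (disk_indicator (1 - 1 / real (Suc i)) z) * (h z * cnj z ^ k)) \<longlonglongrightarrow> h z * cnj z ^ k"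
      by (rule tendsto_eventually)
  qed
qed

lemma monomial_in_bergman: "\<alpha> > -1 \<Longrightarrow> (\<lambda>z. z ^ n) \<in> bergman \<alpha>"
  using moment_finite[of \<alpha> n 1] by (auto simp: bergman_iff moment_eq_disk_norm_sq intro!: holomorphic_intros)

lemma bergman_inner_basis:
  assumes \<alpha>: "\<alpha> > -1" and h: "h \<in> bergman \<alpha>"
  shows "bergman_inner \<alpha> h (bergman_basis \<alpha> k) = taylor_coeff h k / of_real (sqrt (basis_coeff \<alpha> k))"
proof -
  let ?x = "\<lambda>i. 1 - 1 / real (Suc i)"
  have hol: "h holomorphic_on unit_disk" using h by (simp add: bergman_def)
  have x: "0 \<le> ?x i" "?x i < 1" for i by (auto simp: field_simps)
  \<comment> \<open>The same exhaustion is applied to the monomial itself. Since the integrals for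
    \<open>h\<close> are a fixed multiple of those for z^k at every radius, comparing the two limits
    gives the pairing on the full disk.\<close>
  have "(\<lambda>i. monomial_inner \<alpha> (?x i) k k) \<longlonglongrightarrow> (\<integral>z. z ^ k * cnj z ^ k \<partial>dA \<alpha>)"
    using integral_disk_exhaustion[OF \<alpha> monomial_in_bergman[OF \<alpha>, of k], of k]
    unfolding monomial_inner_def .
  then have "(\<lambda>i. taylor_coeff h k * monomial_inner \<alpha> (?x i) k k) \<longlonglongrightarrow> taylor_coeff h k * (\<integral>z. z ^ k * cnj z ^ k \<partial>dA \<alpha>)"
    by (rule tendsto_mult_left)
  moreover have "(\<lambda>i. taylor_coeff h k * monomial_inner \<alpha> (?x i) k k) \<longlonglongrightarrow> (\<integral>z. h z * cnj z ^ k \<partial>dA \<alpha>)"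
    using integral_disk_exhaustion[OF \<alpha> h, of k] unfolding integral_disk_monomial[OF \<alpha> hol x] .
  ultimately have I: "(\<integral>z. h z * cnj z ^ k \<partial>dA \<alpha>) = taylor_coeff h k * (\<integral>z. z ^ k * cnj z ^ k \<partial>dA \<alpha>)"
    using LIMSEQ_unique by blast
  have "(\<integral>z. z ^ k * cnj z ^ k \<partial>dA \<alpha>) = monomial_inner \<alpha> 1 k k"
    unfolding monomial_inner_def
    by (intro Bochner_Integration.integral_cong refl) (simp add: power_less_one_iff abs_square_less_1)
  also have "\<dots> = of_real (1 / basis_coeff \<alpha> k)"
    using basis_coeff_pos[OF \<alpha>, of k] by (simp add: monomial_inner_same[OF \<alpha>] moment_1[OF \<alpha>])
  finally have II: "(\<integral>z. z ^ k * cnj z ^ k \<partial>dA \<alpha>) = of_real (1 / basis_coeff \<alpha> k)" .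
  define s where "s = sqrt (basis_coeff \<alpha> k)"
  have s: "s > 0" "basis_coeff \<alpha> k = s * s" using basis_coeff_pos[OF \<alpha>, of k] by (auto simp: s_def)
  have "bergman_inner \<alpha> h (bergman_basis \<alpha> k) = (\<integral>z. of_real s * (h z * cnj z ^ k) \<partial>dA \<alpha>)"
    unfolding bergman_inner_def bergman_basis_def basis_coeff_def[symmetric] s_def
    by (intro Bochner_Integration.integral_cong refl) simp
  also have "\<dots> = of_real s * (taylor_coeff h k * of_real (1 / basis_coeff \<alpha> k))"
    unfolding II[symmetric] I[symmetric] by (rule integral_mult_right_zero)
  also have "\<dots> = taylor_coeff h k / of_real s" using s by simp
  finally show ?thesis by (simp add: s_def)
qed

section \<open>The shift operators\<close>

lemma one_minus_cnj_mult_nonzero: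
  assumes "a \<in> unit_disk" "z \<in> unit_disk"
  shows "1 - cnj a * z \<noteq> 0" and "1 - cmod a \<le> cmod (1 - cnj a * z)"
proof -
  have "cmod (cnj a * z) \<le> cmod a" using assms by (simp add: norm_mult mult_left_le)
  then show le: "1 - cmod a \<le> cmod (1 - cnj a * z)"
    using norm_triangle_ineq2[of 1 "cnj a * z"] by simp
  then show "1 - cnj a * z \<noteq> 0" using assms(1) by auto
qed

lemma disk_aut_has_field_derivative:
  assumes "a \<in> unit_disk" "z \<in> unit_disk"
  shows "(disk_aut a has_field_derivative (cnj a * a - 1) / (1 - cnj a * z)\<^sup>2) (at z)"
  unfolding disk_aut_def using one_minus_cnj_mult_nonzero(1)[OF assms]
  by (auto intro!: derivative_eq_intros simp: power2_eq_square field_simps)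

lemma deriv_disk_aut:
  assumes "a \<in> unit_disk" "z \<in> unit_disk"
  shows "deriv (disk_aut a) z = (cnj a * a - 1) / (1 - cnj a * z)\<^sup>2"
  by (rule DERIV_imp_deriv[OF disk_aut_has_field_derivative[OF assms]])

lemma holomorphic_disk_aut [holomorphic_intros]:
  "a \<in> unit_disk \<Longrightarrow> disk_aut a holomorphic_on unit_disk"
  unfolding holomorphic_on_open[OF open_ball] using disk_aut_has_field_derivative by blast

lemma one_minus_norm_sq_disk_aut:
  assumes "a \<in> unit_disk" "z \<in> unit_disk"
  shows "1 - (cmod (disk_aut a z))\<^sup>2 = (1 - (cmod a)\<^sup>2) * (1 - (cmod z)\<^sup>2) / (cmod (1 - cnj a * z))\<^sup>2"
proof -
  have "complex_of_real ((cmod (1 - cnj a * z))\<^sup>2 - (cmod (a - z))\<^sup>2) =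
      complex_of_real ((1 - (cmod a)\<^sup>2) * (1 - (cmod z)\<^sup>2))"
    unfolding of_real_diff of_real_mult complex_norm_square of_real_1
    by (simp add: algebra_simps)
  then have "(cmod (1 - cnj a * z))\<^sup>2 - (cmod (a - z))\<^sup>2 = (1 - (cmod a)\<^sup>2) * (1 - (cmod z)\<^sup>2)"
    by (simp only: of_real_eq_iff)
  then show ?thesis
    using one_minus_cnj_mult_nonzero(1)[OF assms]
    by (simp add: disk_aut_def norm_divide power_divide field_simps)
qed

lemma norm_deriv_disk_aut:
  assumes "a \<in> unit_disk" "z \<in> unit_disk"
  shows "cmod (deriv (disk_aut a) z) = (1 - (cmod a)\<^sup>2) / (cmod (1 - cnj a * z))\<^sup>2"
proof -
  have "cnj a * a - 1 = - complex_of_real (1 - (cmod a)\<^sup>2)"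
    unfolding of_real_diff complex_norm_square by (simp add: mult.commute)
  then have "cmod (cnj a * a - 1) = \<bar>1 - (cmod a)\<^sup>2\<bar>" by (simp only: norm_minus_cancel norm_of_real)
  then show ?thesis
    using one_minus_norm_sq_pos[OF assms(1)] by (simp add: deriv_disk_aut[OF assms] norm_divide norm_power)
qed

lemma disk_aut_in_disk:
  assumes "a \<in> unit_disk" "z \<in> unit_disk"
  shows "disk_aut a z \<in> unit_disk"
proof -
  have "0 < (1 - (cmod a)\<^sup>2) * (1 - (cmod z)\<^sup>2) / (cmod (1 - cnj a * z))\<^sup>2"
    using one_minus_norm_sq_pos[OF assms(1)] one_minus_norm_sq_pos[OF assms(2)] one_minus_cnj_mult_nonzero(1)[OF assms]
    by (intro divide_pos_pos mult_pos_pos) auto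
  then have "(cmod (disk_aut a z))\<^sup>2 < 1" using one_minus_norm_sq_disk_aut[OF assms] by simp
  then show ?thesis by (simp add: power_less_one_iff abs_square_less_1)
qed

lemma disk_aut_disk_aut:
  assumes "a \<in> unit_disk" "z \<in> unit_disk"
  shows "disk_aut a (disk_aut a z) = z"
proof -
  note nz = one_minus_cnj_mult_nonzero(1)[OF assms]
  have a: "1 - cnj a * a \<noteq> 0" by (rule one_minus_cnj_mult_nonzero(1)[OF assms(1,1)])
  have "a - (a - z) / (1 - cnj a * z) = z * (1 - cnj a * a) / (1 - cnj a * z)"
    using nz by (simp add: field_simps)
  moreover have "1 - cnj a * ((a - z) / (1 - cnj a * z)) = (1 - cnj a * a) / (1 - cnj a * z)"
    using nz by (simp add: field_simps)
  ultimately show ?thesis using nz a unfolding disk_aut_def by simp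
qed

lemma disk_automorphism_disk_aut:
  assumes a: "a \<in> unit_disk"
  shows "disk_automorphism (disk_aut a) (disk_aut a)"
proof -
  have "bounded (deriv (disk_aut a) ` unit_disk)"
  proof (rule boundedI)
    fix w assume "w \<in> deriv (disk_aut a) ` unit_disk"
    then obtain z where z: "z \<in> unit_disk" "w = deriv (disk_aut a) z" by auto
    have "(1 - cmod a)\<^sup>2 \<le> (cmod (1 - cnj a * z))\<^sup>2"
      using one_minus_cnj_mult_nonzero(2)[OF a z(1)] a by (intro power_mono) auto
    then show "norm w \<le> 1 / (1 - cmod a)\<^sup>2"
      unfolding z(2) norm_deriv_disk_aut[OF a z(1)] using a by (intro frac_le) auto
  qed
  then show ?thesis
    unfolding disk_automorphism_def
    using a by (auto simp: holomorphic_disk_aut disk_aut_disk_aut one_minus_norm_sq_disk_aut norm_deriv_disk_aut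
        intro: disk_aut_in_disk[unfolded mem_ball_0])
qed

definition shift_weight :: "real \<Rightarrow> complex \<Rightarrow> complex \<Rightarrow> complex" where
  "shift_weight \<alpha> a z = exp (of_real ((2 + \<alpha>) / 2) * log_deriv_aut a z)"

lemma bergman_shift_eq: "bergman_shift \<alpha> a f z = shift_weight \<alpha> a z * f (disk_aut a z)"
  by (simp add: bergman_shift_def shift_weight_def)

lemma holomorphic_shift_weight:
  "a \<in> unit_disk \<Longrightarrow> shift_weight \<alpha> a holomorphic_on unit_disk"
  unfolding shift_weight_def by (intro holomorphic_intros log_deriv_aut(1))

lemma norm_shift_weight:
  assumes "a \<in> unit_disk" "z \<in> unit_disk"
  shows "(cmod (shift_weight \<alpha> a z))\<^sup>2 = cmod (deriv (disk_aut a) z) powr (2 + \<alpha>)"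
proof -
  have "cmod (deriv (disk_aut a) z) = exp (Re (log_deriv_aut a z))"
    using log_deriv_aut(2)[OF assms] by (metis norm_exp_eq_Re)
  then show ?thesis
    by (simp add: shift_weight_def power2_eq_square powr_def flip: exp_add)
qed

lemma holomorphic_compose_disk_aut:
  assumes "a \<in> unit_disk" "f holomorphic_on unit_disk"
  shows "(\<lambda>z. f (disk_aut a z)) holomorphic_on unit_disk"
proof -
  have "disk_aut a ` unit_disk \<subseteq> unit_disk" using disk_aut_in_disk[OF assms(1)] by blast
  from holomorphic_on_compose_gen[OF holomorphic_disk_aut[OF assms(1)] assms(2) this]
  show ?thesis by (simp add: o_def)
qed

lemma holomorphic_bergman_shift:
  assumes "a \<in> unit_disk" "f holomorphic_on unit_disk"
  shows "bergman_shift \<alpha> a f holomorphic_on unit_disk"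
  unfolding bergman_shift_eq[abs_def]
  by (intro holomorphic_on_mult holomorphic_shift_weight holomorphic_compose_disk_aut assms)

text \<open>The two branches of the logarithm of the derivative add up to a logarithm of 1, which is
  constant on the disk.\<close>

lemma shift_weight_involution:
  assumes a: "a \<in> unit_disk"
  obtains u where "cmod u = 1" "\<And>z. z \<in> unit_disk \<Longrightarrow> shift_weight \<alpha> a (disk_aut a z) * shift_weight \<alpha> a z = u"
proof -
  define g where "g z = log_deriv_aut a (disk_aut a z) + log_deriv_aut a z" for z
  have hol: "g holomorphic_on unit_disk"
    unfolding g_def using a
    by (intro holomorphic_on_add holomorphic_compose_disk_aut log_deriv_aut(1))
  have e1: "exp (g z) = 1" if z: "z \<in> unit_disk" for z
  proof -
    note z' = disk_aut_in_disk[OF a z]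
    have "(disk_aut a \<circ> disk_aut a has_field_derivative deriv (disk_aut a) (disk_aut a z) * deriv (disk_aut a) z) (at z)"
      unfolding deriv_disk_aut[OF a z] deriv_disk_aut[OF a z']
      by (rule DERIV_chain[OF disk_aut_has_field_derivative[OF a z'] disk_aut_has_field_derivative[OF a z]])
    moreover have "(disk_aut a \<circ> disk_aut a has_field_derivative 1) (at z)"
      by (rule has_field_derivative_transform_within_open[OF DERIV_ident open_ball z])
        (simp add: disk_aut_disk_aut[OF a])
    ultimately have "deriv (disk_aut a) (disk_aut a z) * deriv (disk_aut a) z = 1"
      by (rule DERIV_unique)
    then show ?thesis unfolding g_def exp_add log_deriv_aut(2)[OF a z] log_deriv_aut(2)[OF a z'] .
  qed
  have "\<exists>c. \<forall>z\<in>unit_disk. g z = c"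
  proof (rule has_field_derivative_zero_constant[OF convex_ball])
    fix z assume z: "z \<in> unit_disk"
    have d: "(g has_field_derivative deriv g z) (at z)" using holomorphic_derivI[OF hol open_ball z] .
    then have "((\<lambda>z. exp (g z)) has_field_derivative exp (g z) * deriv g z) (at z)"
      by (auto intro!: derivative_eq_intros)
    moreover have "((\<lambda>z. exp (g z)) has_field_derivative 0) (at z)"
      by (rule has_field_derivative_transform_within_open[OF DERIV_const open_ball z]) (simp add: e1)
    ultimately have "exp (g z) * deriv g z = 0" by (rule DERIV_unique)
    then show "(g has_field_derivative 0) (at z within unit_disk)"
      using d by (simp add: has_field_derivative_at_within)
  qed
  then obtain c where c: "\<And>z. z \<in> unit_disk \<Longrightarrow> g z = c" by blast
  have "exp c = 1" using c[of 0] e1[of 0] by simp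
  then have "Re c = 0" by (metis norm_exp_eq_Re norm_one exp_eq_one_iff)
  show thesis
  proof (rule that[of "exp (of_real ((2 + \<alpha>) / 2) * c)"])
    show "cmod (exp (of_real ((2 + \<alpha>) / 2) * c)) = 1" using \<open>Re c = 0\<close> by (simp add: norm_exp_eq_Re)
    fix z assume "z \<in> unit_disk"
    then show "shift_weight \<alpha> a (disk_aut a z) * shift_weight \<alpha> a z = exp (of_real ((2 + \<alpha>) / 2) * c)"
      using c[of z] by (simp only: shift_weight_def g_def exp_add[symmetric] distrib_left[symmetric])
  qed
qed

section \<open>Local mass and the adjoint of the shift\<close>

definition set_norm_sq :: "real \<Rightarrow> complex set \<Rightarrow> (complex \<Rightarrow> complex) \<Rightarrow> ennreal" where
  "set_norm_sq \<alpha> A f = (\<integral>\<^sup>+z. indicator A z * ennreal ((cmod (f z))\<^sup>2) \<partial>dA \<alpha>)"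

lemma holomorphic_measurable_lebesgue_disk:
  "f holomorphic_on unit_disk \<Longrightarrow> f \<in> borel_measurable lebesgue_disk"
  by (intro borel_measurable_lebesgue_disk_continuous holomorphic_on_imp_continuous_on)

lemma pseudohyp_disk_open:
  assumes "a \<in> unit_disk"
  shows "open (pseudohyp_disk a r)"
proof -
  have "continuous_on unit_disk (\<lambda>z. cmod (disk_aut a z))"
    by (intro continuous_intros holomorphic_on_imp_continuous_on holomorphic_disk_aut assms)
  then have "open (unit_disk \<inter> (\<lambda>z. cmod (disk_aut a z)) -` {..<r})"
    by (rule continuous_open_preimage) auto
  moreover have "pseudohyp_disk a r = unit_disk \<inter> (\<lambda>z. cmod (disk_aut a z)) -` {..<r}"
    by (auto simp: pseudohyp_disk_def pseudohyp_dist_def)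
  ultimately show ?thesis by simp
qed

text \<open>\<open>disk_aut a\<close> maps the Euclidean disk |z|^2 < x onto the pseudohyperbolic
  disk around \<open>a\<close>, and the squared modulus of the shift weight is the corresponding
  Jacobian factor. Mass of \<open>f\<close> near \<open>a\<close> thus becomes mass around 0, where
  Parseval's identity applies.\<close>

lemma disk_norm_sq_bergman_shift:
  assumes a: "a \<in> unit_disk" and f: "f holomorphic_on unit_disk" and x: "0 \<le> x"
  shows "disk_norm_sq \<alpha> x (bergman_shift \<alpha> a f) = set_norm_sq \<alpha> (pseudohyp_disk a (sqrt x)) f"
proof -
  let ?g = "\<lambda>z. indicator (pseudohyp_disk a (sqrt x)) z * ennreal ((cmod (f z))\<^sup>2)"
  have [measurable]: "f \<in> borel_measurable lebesgue_disk" by (rule holomorphic_measurable_lebesgue_disk[OF f])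
  have "pseudohyp_disk a (sqrt x) \<in> sets lebesgue_disk"
    using pseudohyp_disk_open[OF a, of "sqrt x"]
    by (auto simp: sets_restrict_space_iff pseudohyp_disk_def)
  then have g: "?g \<in> borel_measurable lebesgue_disk" by measurable
  have "set_norm_sq \<alpha> (pseudohyp_disk a (sqrt x)) f =
      (\<integral>\<^sup>+z. ennreal (cmod (deriv (disk_aut a) z) powr (2 + \<alpha>)) * ?g (disk_aut a z) \<partial>dA \<alpha>)"
    unfolding set_norm_sq_def
    by (rule nn_integral_dA_change_of_variables[OF disk_automorphism_disk_aut[OF a] g])
  also have "\<dots> = disk_norm_sq \<alpha> x (bergman_shift \<alpha> a f)"
    unfolding disk_norm_sq_def
  proof (intro nn_integral_cong)
    fix z assume "z \<in> space (dA \<alpha>)"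
    then have z: "z \<in> unit_disk" by simp
    have "cmod z < sqrt x \<longleftrightarrow> (cmod z)\<^sup>2 < x"
      using real_sqrt_less_iff[of "(cmod z)\<^sup>2" x] by simp
    then have "indicator (pseudohyp_disk a (sqrt x)) (disk_aut a z) = ennreal (disk_indicator x z)"
      using disk_aut_in_disk[OF a z]
      by (simp add: indicator_def pseudohyp_disk_def pseudohyp_dist_def disk_aut_disk_aut[OF a z] del: real_sqrt_less_iff)
    moreover have "ennreal ((cmod (bergman_shift \<alpha> a f z))\<^sup>2) =
        ennreal (cmod (deriv (disk_aut a) z) powr (2 + \<alpha>)) * ennreal ((cmod (f (disk_aut a z)))\<^sup>2)"
      by (simp add: bergman_shift_eq norm_mult power_mult_distrib norm_shift_weight[OF a z] ennreal_mult)
    ultimately show "ennreal (cmod (deriv (disk_aut a) z) powr (2 + \<alpha>)) * ?g (disk_aut a z) =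
        ennreal (disk_indicator x z) * ennreal ((cmod (bergman_shift \<alpha> a f z))\<^sup>2)"
      by (simp only: mult_ac)
  qed
  finally show ?thesis ..
qed

lemma pseudohyp_disk_1:
  assumes "a \<in> unit_disk"
  shows "pseudohyp_disk a 1 = unit_disk"
proof -
  have "pseudohyp_dist a z < 1" if "z \<in> unit_disk" for z
    using disk_aut_in_disk[OF assms that] by (simp add: pseudohyp_dist_def)
  then show ?thesis unfolding pseudohyp_disk_def by blast
qed

lemma set_norm_sq_unit_disk: "set_norm_sq \<alpha> unit_disk f = disk_norm_sq \<alpha> 1 f"
  unfolding set_norm_sq_def disk_norm_sq_1 by (intro nn_integral_cong) (simp only: space_dA indicator_simps mult_1)

lemma disk_norm_sq_1_bergman_shift:
  assumes "a \<in> unit_disk" "f holomorphic_on unit_disk"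
  shows "disk_norm_sq \<alpha> 1 (bergman_shift \<alpha> a f) = disk_norm_sq \<alpha> 1 f"
  using disk_norm_sq_bergman_shift[OF assms zero_le_one, of \<alpha>]
  by (simp only: real_sqrt_one pseudohyp_disk_1[OF assms(1)] set_norm_sq_unit_disk)

lemma bergman_shift_in_bergman:
  "a \<in> unit_disk \<Longrightarrow> f \<in> bergman \<alpha> \<Longrightarrow> bergman_shift \<alpha> a f \<in> bergman \<alpha>"
  by (simp add: bergman_iff holomorphic_bergman_shift disk_norm_sq_1_bergman_shift)

text \<open>The change of variables moves \<open>disk_aut a\<close> from \<open>h\<close> to
  \<open>f\<close>, and its Jacobian factor is the shift weight times its conjugate. One of these
  factors joins \<open>f\<close>; the other cancels against the weight of \<open>h\<close> up to the
  constant \<open>u\<close>, which is why only moduli are compared.\<close>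

lemma norm_bergman_inner_shift:
  assumes a: "a \<in> unit_disk" and f: "f holomorphic_on unit_disk" and h: "h holomorphic_on unit_disk"
  shows "cmod (bergman_inner \<alpha> f (bergman_shift \<alpha> a h)) = cmod (bergman_inner \<alpha> (bergman_shift \<alpha> a f) h)"
proof -
  obtain u where u: "cmod u = 1"
    "\<And>z. z \<in> unit_disk \<Longrightarrow> shift_weight \<alpha> a (disk_aut a z) * shift_weight \<alpha> a z = u"
    using shift_weight_involution[OF a] by blast
  have m: "(\<lambda>z. f z * cnj (bergman_shift \<alpha> a h z)) \<in> borel_measurable lebesgue_disk"
    by (intro borel_measurable_lebesgue_disk_continuous continuous_intros holomorphic_on_imp_continuous_on
        f holomorphic_bergman_shift[OF a h])
  have "bergman_inner \<alpha> f (bergman_shift \<alpha> a h) =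
    (\<integral>z. (cmod (deriv (disk_aut a) z) powr (2 + \<alpha>)) *\<^sub>R
      (f (disk_aut a z) * cnj (bergman_shift \<alpha> a h (disk_aut a z))) \<partial>dA \<alpha>)"
    unfolding bergman_inner_def
    by (rule integral_dA_change_of_variables[OF disk_automorphism_disk_aut[OF a] m])
  also have "\<dots> = (\<integral>z. cnj u * (bergman_shift \<alpha> a f z * cnj (h z)) \<partial>dA \<alpha>)"
  proof (intro Bochner_Integration.integral_cong refl)
    fix z assume "z \<in> space (dA \<alpha>)"
    then have z: "z \<in> unit_disk" by simp
    have "of_real (cmod (deriv (disk_aut a) z) powr (2 + \<alpha>)) = shift_weight \<alpha> a z * cnj (shift_weight \<alpha> a z)"
      unfolding norm_shift_weight[OF a z, symmetric] by (rule complex_norm_square)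
    then show "(cmod (deriv (disk_aut a) z) powr (2 + \<alpha>)) *\<^sub>R
      (f (disk_aut a z) * cnj (bergman_shift \<alpha> a h (disk_aut a z))) = cnj u * (bergman_shift \<alpha> a f z * cnj (h z))"
      unfolding u(2)[OF z, symmetric]
      by (simp add: scaleR_conv_of_real bergman_shift_eq disk_aut_disk_aut[OF a z] mult_ac)
  qed
  also have "\<dots> = cnj u * bergman_inner \<alpha> (bergman_shift \<alpha> a f) h"
    unfolding bergman_inner_def by (rule integral_mult_right_zero)
  finally show ?thesis using u(1) by (simp add: norm_mult)
qed

lemma holomorphic_bergman_basis: "bergman_basis \<alpha> j holomorphic_on S"
  unfolding bergman_basis_def by (intro holomorphic_intros)

text \<open>For the shift of \<open>f\<close> to \<open>a\<close> and \<open>m = m a\<close> this is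
  the contribution of \<open>a\<close> to the sampling sum. For \<open>h\<close> in the Bergman
  space it is also the squared distance from \<open>h\<close> to the functions vanishing at 0 to
  order \<open>m\<close>, which explains its behaviour under multipliers.\<close>

definition trunc_norm_sq :: "real \<Rightarrow> nat \<Rightarrow> (complex \<Rightarrow> complex) \<Rightarrow> real" where
  "trunc_norm_sq \<alpha> m h = (\<Sum>j<m. (cmod (taylor_coeff h j))\<^sup>2 / basis_coeff \<alpha> j)"

lemma norm_sq_bergman_inner_shift_basis:
  assumes \<alpha>: "\<alpha> > -1" and a: "a \<in> unit_disk" and f: "f \<in> bergman \<alpha>"
  shows "(cmod (bergman_inner \<alpha> f (bergman_shift \<alpha> a (bergman_basis \<alpha> j))))\<^sup>2 =
    (cmod (taylor_coeff (bergman_shift \<alpha> a f) j))\<^sup>2 / basis_coeff \<alpha> j"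
proof -
  have "cmod (bergman_inner \<alpha> f (bergman_shift \<alpha> a (bergman_basis \<alpha> j))) =
      cmod (taylor_coeff (bergman_shift \<alpha> a f) j / of_real (sqrt (basis_coeff \<alpha> j)))"
    using f by (simp add: norm_bergman_inner_shift[OF a _ holomorphic_bergman_basis] bergman_def
        bergman_inner_basis[OF \<alpha> bergman_shift_in_bergman[OF a f]])
  then show ?thesis
    using basis_coeff_pos[OF \<alpha>, of j] by (simp add: norm_divide power_divide)
qed

lemma sample_sum_eq:
  assumes \<alpha>: "\<alpha> > -1" and L: "\<Lambda> \<subseteq> unit_disk" and f: "f \<in> bergman \<alpha>"
  shows "sample_sum \<alpha> \<Lambda> m f = (\<Sum>\<^sub>\<infinity>a\<in>\<Lambda>. ennreal (trunc_norm_sq \<alpha> (m a) (bergman_shift \<alpha> a f)))"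
  unfolding sample_sum_def
proof (intro infsum_cong)
  fix a assume "a \<in> \<Lambda>"
  then have a: "a \<in> unit_disk" using L by blast
  show "(\<Sum>j<m a. ennreal ((cmod (bergman_inner \<alpha> f (bergman_shift \<alpha> a (bergman_basis \<alpha> j))))\<^sup>2)) =
      ennreal (trunc_norm_sq \<alpha> (m a) (bergman_shift \<alpha> a f))"
    unfolding norm_sq_bergman_inner_shift_basis[OF \<alpha> a f] trunc_norm_sq_def
    by (subst sum_ennreal) (simp_all add: less_imp_le[OF basis_coeff_pos[OF \<alpha>]])
qed

section \<open>Truncation and multipliers\<close>

text \<open>Sums over the divisor are always handled through their finite subsums, so that no
  question of convergence arises and finite subcovers can be compared with the full sum.\<close>

lemma infsum_ennreal_SUP:
  fixes f :: "'a \<Rightarrow> ennreal"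
  shows "infsum f A = (SUP F\<in>{F. finite F \<and> F \<subseteq> A}. sum f F)"
  by (rule nonneg_infsum_complete) simp

lemma finite_sum_le_infsum_ennreal:
  fixes f :: "'a \<Rightarrow> ennreal"
  shows "finite F \<Longrightarrow> F \<subseteq> A \<Longrightarrow> sum f F \<le> infsum f A"
  unfolding infsum_ennreal_SUP by (intro SUP_upper) auto

lemma ennreal_infsum_le_cmult:
  fixes f g :: "'a \<Rightarrow> ennreal"
  assumes "\<And>x. x \<in> A \<Longrightarrow> f x \<le> c * g x"
  shows "infsum f A \<le> c * infsum g A"
proof -
  have "sum f F \<le> c * infsum g A" if "finite F" "F \<subseteq> A" for F
  proof -
    have "sum f F \<le> c * sum g F" unfolding sum_distrib_left using assms that by (intro sum_mono) auto
    also have "sum g F \<le> infsum g A" by (rule finite_sum_le_infsum_ennreal[OF that])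
    finally show ?thesis by (simp add: mult_left_mono)
  qed
  then show ?thesis
    unfolding infsum_ennreal_SUP[of f] by (intro SUP_least) auto
qed

lemma disk_norm_sq_1_taylor:
  assumes \<alpha>: "\<alpha> > -1" and h: "h holomorphic_on unit_disk"
  shows "disk_norm_sq \<alpha> 1 h = (\<Sum>n. ennreal ((cmod (taylor_coeff h n))\<^sup>2 / basis_coeff \<alpha> n))"
proof -
  have "disk_norm_sq \<alpha> 1 h = (\<Sum>n. ennreal ((cmod (taylor_coeff h n))\<^sup>2) * moment \<alpha> n 1)"
    using disk_norm_sq_taylor[OF \<alpha> h order_refl] .
  also have "\<dots> = (\<Sum>n. ennreal ((cmod (taylor_coeff h n))\<^sup>2 / basis_coeff \<alpha> n))"
    by (intro suminf_cong) (simp add: moment_1[OF \<alpha>] flip: ennreal_mult')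
  finally show ?thesis .
qed

lemma trunc_norm_sq_nonneg: "\<alpha> > -1 \<Longrightarrow> 0 \<le> trunc_norm_sq \<alpha> m h"
  unfolding trunc_norm_sq_def by (intro sum_nonneg divide_nonneg_pos basis_coeff_pos) auto

lemma ennreal_trunc_norm_sq:
  assumes "\<alpha> > -1"
  shows "ennreal (trunc_norm_sq \<alpha> m h) = (\<Sum>j<m. ennreal ((cmod (taylor_coeff h j))\<^sup>2 / basis_coeff \<alpha> j))"
  unfolding trunc_norm_sq_def
  by (rule sum_ennreal[symmetric]) (simp add: less_imp_le[OF basis_coeff_pos[OF assms]])

lemma trunc_norm_sq_le:
  assumes "\<alpha> > -1" "h holomorphic_on unit_disk"
  shows "ennreal (trunc_norm_sq \<alpha> m h) \<le> disk_norm_sq \<alpha> 1 h"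
  unfolding ennreal_trunc_norm_sq[OF assms(1)] disk_norm_sq_1_taylor[OF assms]
  by (intro sum_le_suminf) auto

lemma trunc_norm_sq_cong:
  "(\<And>j. j < m \<Longrightarrow> taylor_coeff f j = taylor_coeff g j) \<Longrightarrow> trunc_norm_sq \<alpha> m f = trunc_norm_sq \<alpha> m g"
  unfolding trunc_norm_sq_def by (intro sum.cong) auto

text \<open>The first \<open>m\<close> Taylor coefficients of a product only depend on the first \<open>m\<close> Taylor
  coefficients of the factors, so that one may truncate \<open>h\<close> before multiplying.\<close>

lemma trunc_norm_sq_mult_le:
  assumes \<alpha>: "\<alpha> > -1" and \<psi>: "\<psi> holomorphic_on unit_disk" and h: "h holomorphic_on unit_disk"
    and B: "\<And>z. z \<in> unit_disk \<Longrightarrow> cmod (\<psi> z) \<le> B"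
  shows "trunc_norm_sq \<alpha> m (\<lambda>z. \<psi> z * h z) \<le> B\<^sup>2 * trunc_norm_sq \<alpha> m h"
proof -
  define p where "p z = (\<Sum>i<m. taylor_coeff h i * z ^ i)" for z
  have p: "p holomorphic_on unit_disk" unfolding p_def by (intro holomorphic_intros)
  have tp: "taylor_coeff p i = (if i < m then taylor_coeff h i else 0)" for i
    unfolding p_def[abs_def] by (rule taylor_coeff_polynomial)
  have "taylor_coeff (\<lambda>z. \<psi> z * h z) j = taylor_coeff (\<lambda>z. \<psi> z * p z) j" if "j < m" for j
    unfolding taylor_coeff_mult[OF \<psi> h] taylor_coeff_mult[OF \<psi> p] tp
    using that by (intro sum.cong) auto
  then have "ennreal (trunc_norm_sq \<alpha> m (\<lambda>z. \<psi> z * h z)) = ennreal (trunc_norm_sq \<alpha> m (\<lambda>z. \<psi> z * p z))"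
    by (subst trunc_norm_sq_cong) auto
  also have "\<dots> \<le> disk_norm_sq \<alpha> 1 (\<lambda>z. \<psi> z * p z)"
    by (intro trunc_norm_sq_le \<alpha> holomorphic_on_mult \<psi> p)
  also have "\<dots> \<le> (\<integral>\<^sup>+z. ennreal (B\<^sup>2) * (ennreal (disk_indicator 1 z) * ennreal ((cmod (p z))\<^sup>2)) \<partial>dA \<alpha>)"
    unfolding disk_norm_sq_def
  proof (intro nn_integral_mono)
    fix z assume "z \<in> space (dA \<alpha>)"
    then have "(cmod (\<psi> z))\<^sup>2 \<le> B\<^sup>2" using B[of z] by (intro power_mono) auto
    then have "ennreal ((cmod (\<psi> z * p z))\<^sup>2) \<le> ennreal (B\<^sup>2) * ennreal ((cmod (p z))\<^sup>2)"
      by (simp add: norm_mult power_mult_distrib mult_right_mono flip: ennreal_mult')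
    then have "ennreal (disk_indicator 1 z) * ennreal ((cmod (\<psi> z * p z))\<^sup>2) \<le>
        ennreal (disk_indicator 1 z) * (ennreal (B\<^sup>2) * ennreal ((cmod (p z))\<^sup>2))"
      by (rule mult_left_mono) simp
    then show "ennreal (disk_indicator 1 z) * ennreal ((cmod (\<psi> z * p z))\<^sup>2) \<le>
        ennreal (B\<^sup>2) * (ennreal (disk_indicator 1 z) * ennreal ((cmod (p z))\<^sup>2))"
      by (simp only: mult.left_commute)
  qed
  also have "\<dots> = ennreal (B\<^sup>2) * disk_norm_sq \<alpha> 1 p"
    unfolding disk_norm_sq_def by (rule nn_integral_cmult[OF disk_norm_sq_measurable[OF p]])
  \<comment> \<open>A polynomial of degree below \<open>m\<close> loses nothing under truncation, so
    its full norm is again the truncated norm of \<open>h\<close>.\<close>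
  also have "disk_norm_sq \<alpha> 1 p = ennreal (trunc_norm_sq \<alpha> m h)"
    unfolding p_def disk_norm_sq_polynomial[OF \<alpha>] ennreal_trunc_norm_sq[OF \<alpha>]
    by (intro sum.cong refl) (simp add: moment_1[OF \<alpha>] flip: ennreal_mult')
  finally show ?thesis
    using trunc_norm_sq_nonneg[OF \<alpha>, of m h] by (simp add: ennreal_mult'[symmetric])
qed

text \<open>The square root of \<open>trunc_norm_sq\<close>, written with \<open>L2_set\<close> for
  the sake of the triangle inequality: the lower bound for products is obtained as a difference of
  norms.\<close>

definition trunc_norm :: "real \<Rightarrow> nat \<Rightarrow> (complex \<Rightarrow> complex) \<Rightarrow> real" where
  "trunc_norm \<alpha> m h = L2_set (\<lambda>j. cmod (taylor_coeff h j) / sqrt (basis_coeff \<alpha> j)) {..<m}"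

lemma trunc_norm_power2:
  assumes "\<alpha> > -1"
  shows "(trunc_norm \<alpha> m h)\<^sup>2 = trunc_norm_sq \<alpha> m h"
proof -
  have "(cmod (taylor_coeff h j) / sqrt (basis_coeff \<alpha> j))\<^sup>2 = (cmod (taylor_coeff h j))\<^sup>2 / basis_coeff \<alpha> j" for j
    using basis_coeff_pos[OF assms, of j] by (simp add: power_divide)
  then show ?thesis
    using trunc_norm_sq_nonneg[OF assms, of m h] by (simp add: trunc_norm_def L2_set_def trunc_norm_sq_def)
qed

lemma trunc_norm_nonneg: "0 \<le> trunc_norm \<alpha> m h"
  by (simp add: trunc_norm_def L2_set_nonneg)

lemma trunc_norm_cong:
  "(\<And>j. j < m \<Longrightarrow> taylor_coeff f j = taylor_coeff g j) \<Longrightarrow> trunc_norm \<alpha> m f = trunc_norm \<alpha> m g"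
  unfolding trunc_norm_def by (intro L2_set_cong) auto

lemma trunc_norm_diff_ge:
  assumes \<alpha>: "\<alpha> > -1" and f: "f holomorphic_on unit_disk" and g: "g holomorphic_on unit_disk"
  shows "trunc_norm \<alpha> m f - trunc_norm \<alpha> m g \<le> trunc_norm \<alpha> m (\<lambda>z. f z - g z)"
proof -
  have s: "0 < sqrt (basis_coeff \<alpha> j)" for j using basis_coeff_pos[OF \<alpha>, of j] by simp
  have "trunc_norm \<alpha> m f \<le> L2_set (\<lambda>j. cmod (taylor_coeff f j - taylor_coeff g j) / sqrt (basis_coeff \<alpha> j) +
      cmod (taylor_coeff g j) / sqrt (basis_coeff \<alpha> j)) {..<m}"
    unfolding trunc_norm_def
  proof (rule L2_set_mono)
    fix j
    have "cmod (taylor_coeff f j) \<le> cmod (taylor_coeff f j - taylor_coeff g j) + cmod (taylor_coeff g j)"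
      by (metis diff_add_cancel norm_triangle_ineq)
    then show "cmod (taylor_coeff f j) / sqrt (basis_coeff \<alpha> j) \<le>
      cmod (taylor_coeff f j - taylor_coeff g j) / sqrt (basis_coeff \<alpha> j) + cmod (taylor_coeff g j) / sqrt (basis_coeff \<alpha> j)"
      using s[of j] by (simp add: divide_right_mono flip: add_divide_distrib)
  qed (intro divide_nonneg_pos norm_ge_zero s)
  also have "\<dots> \<le> trunc_norm \<alpha> m (\<lambda>z. f z - g z) + trunc_norm \<alpha> m g"
    unfolding trunc_norm_def taylor_coeff_diff[OF f g] by (rule L2_set_triangle_ineq)
  finally show ?thesis by simp
qed

lemma trunc_norm_cmult:
  assumes "h holomorphic_on unit_disk"
  shows "trunc_norm \<alpha> m (\<lambda>z. c * h z) = cmod c * trunc_norm \<alpha> m h"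
  unfolding trunc_norm_def taylor_coeff_cmult[OF assms]
  by (subst L2_set_right_distrib) (auto simp: norm_mult)

lemma trunc_norm_mult_le:
  assumes "\<alpha> > -1" "\<psi> holomorphic_on unit_disk" "h holomorphic_on unit_disk"
    and "\<And>z. z \<in> unit_disk \<Longrightarrow> cmod (\<psi> z) \<le> B" "0 \<le> B"
  shows "trunc_norm \<alpha> m (\<lambda>z. \<psi> z * h z) \<le> B * trunc_norm \<alpha> m h"
proof (rule power2_le_imp_le)
  show "(trunc_norm \<alpha> m (\<lambda>z. \<psi> z * h z))\<^sup>2 \<le> (B * trunc_norm \<alpha> m h)\<^sup>2"
    unfolding power_mult_distrib trunc_norm_power2[OF assms(1)] by (rule trunc_norm_sq_mult_le[OF assms(1-4)])
  show "0 \<le> B * trunc_norm \<alpha> m h" using assms(5) trunc_norm_nonneg by simp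
qed

text \<open>\<open>\<phi>\<^sub>w(z) = w - (1 - |w|\<^sup>2) z / (1 - cnj w z)\<close>, and modulo \<open>z\<^sup>m\<close> the geometric series may be
  cut off after \<open>m\<close> terms, which leaves a multiplier bounded by \<open>m\<close>.\<close>

lemma trunc_norm_disk_aut_ge:
  assumes \<alpha>: "\<alpha> > -1" and w: "w \<in> unit_disk" and h: "h holomorphic_on unit_disk"
  shows "(cmod w - real m * (1 - (cmod w)\<^sup>2)) * trunc_norm \<alpha> m h \<le> trunc_norm \<alpha> m (\<lambda>z. disk_aut w z * h z)"
proof -
  define c where "c = complex_of_real (1 - (cmod w)\<^sup>2)"
  define P where "P z = (\<Sum>k<m. cnj w ^ k * z ^ Suc k)" for z
  \<comment> \<open>\<open>z ^ m * R z\<close> is the omitted tail of the geometric series times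
    \<open>h\<close>; its factor z^m hides it from the first \<open>m\<close> coefficients.
    \<open>G\<close> below is the remaining part of the product.\<close>
  define R where "R z = c * (cnj w ^ m * z / (1 - cnj w * z)) * h z" for z
  have nc: "cmod c = 1 - (cmod w)\<^sup>2"
    using one_minus_norm_sq_pos[OF w] unfolding c_def norm_of_real by simp
  have P: "P holomorphic_on unit_disk" unfolding P_def by (intro holomorphic_intros)
  have R: "R holomorphic_on unit_disk"
    unfolding R_def using one_minus_cnj_mult_nonzero(1)[OF w] by (intro holomorphic_intros h) auto
  have Ph: "(\<lambda>z. P z * h z) holomorphic_on unit_disk" by (intro holomorphic_on_mult P h)
  define G where "G z = w * h z - c * (P z * h z)" for z
  have G: "G holomorphic_on unit_disk" unfolding G_def by (intro holomorphic_intros h P)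
  have eq: "disk_aut w z * h z = G z - z ^ m * R z" if z: "z \<in> unit_disk" for z
  proof -
    let ?d = "1 - cnj w * z"
    have d: "?d \<noteq> 0" by (rule one_minus_cnj_mult_nonzero(1)[OF w z])
    have P1: "P z = z * (1 - (cnj w * z) ^ m) / ?d"
    proof -
      have "P z = z * (\<Sum>k<m. (cnj w * z) ^ k)"
        unfolding P_def by (simp add: sum_distrib_left power_mult_distrib mult_ac)
      also have "(\<Sum>k<m. (cnj w * z) ^ k) = (1 - (cnj w * z) ^ m) / ?d"
        using d by (intro sum_gp_strict[THEN trans]) auto
      finally show ?thesis by simp
    qed
    have "c = 1 - w * cnj w" unfolding c_def of_real_diff complex_norm_square by simp
    then have "w - c * z / ?d = disk_aut w z"
      using d unfolding disk_aut_def by (simp only:) (simp add: field_simps)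
    moreover define Y where "Y = cnj w ^ m * z / ?d"
    moreover have "P z + z ^ m * Y = z / ?d"
      unfolding P1 Y_def by (simp add: power_mult_distrib field_simps add_divide_distrib[symmetric])
    ultimately have D: "disk_aut w z = w - c * (P z + z ^ m * Y)" by simp
    have Rz: "R z = c * Y * h z" unfolding R_def Y_def ..
    show ?thesis unfolding G_def D Rz by (simp add: algebra_simps)
  qed
  have "trunc_norm \<alpha> m (\<lambda>z. disk_aut w z * h z) = trunc_norm \<alpha> m G"
  proof (rule trunc_norm_cong)
    fix j assume "j < m"
    have "taylor_coeff (\<lambda>z. disk_aut w z * h z) j = taylor_coeff (\<lambda>z. G z - z ^ m * R z) j"
      by (rule taylor_coeff_cong) (rule eq)
    also have "\<dots> = taylor_coeff G j"
      using \<open>j < m\<close> taylor_coeff_power_mult[OF R, of m j]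
      by (subst taylor_coeff_diff[OF G]) (auto intro!: holomorphic_intros R)
    finally show "taylor_coeff (\<lambda>z. disk_aut w z * h z) j = taylor_coeff G j" .
  qed
  \<comment> \<open>Multiplication by the constant \<open>w\<close> is the main term, the rest is an
    error carrying the small factor 1 - |w|^2.\<close>
  moreover have "trunc_norm \<alpha> m (\<lambda>z. w * h z) - trunc_norm \<alpha> m (\<lambda>z. c * (P z * h z)) \<le> trunc_norm \<alpha> m G"
    unfolding G_def by (rule trunc_norm_diff_ge[OF \<alpha>]; intro holomorphic_intros h P)
  moreover have "trunc_norm \<alpha> m (\<lambda>z. w * h z) = cmod w * trunc_norm \<alpha> m h"
    by (rule trunc_norm_cmult[OF h])
  moreover have "trunc_norm \<alpha> m (\<lambda>z. c * (P z * h z)) \<le> (1 - (cmod w)\<^sup>2) * (real m * trunc_norm \<alpha> m h)"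
  proof -
    have "cmod (P z) \<le> real m" if "z \<in> unit_disk" for z
    proof -
      have "cmod (P z) \<le> (\<Sum>k<m. 1)"
        unfolding P_def
      proof (rule sum_norm_le)
        fix k
        have "cmod w ^ k * cmod z ^ Suc k \<le> 1 * 1"
          using w that by (intro mult_mono power_le_one) auto
        then show "cmod (cnj w ^ k * z ^ Suc k) \<le> 1" by (simp add: norm_mult norm_power)
      qed
      then show ?thesis by simp
    qed
    then have "trunc_norm \<alpha> m (\<lambda>z. P z * h z) \<le> real m * trunc_norm \<alpha> m h"
      by (intro trunc_norm_mult_le \<alpha> P h) auto
    then show ?thesis
      unfolding trunc_norm_cmult[OF Ph] nc
      using one_minus_norm_sq_pos[OF w] by (intro mult_left_mono) auto
  qed
  ultimately show ?thesis by (simp add: algebra_simps)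
qed

text \<open>Each factor \<open>disk_aut w\<close> costs at most a factor \<open>t\<close>, which may
  be taken close to 1 when |w| is close to 1 and m (1 - |w|^2) is small. For a fixed number
  \<open>n\<close> of factors the total loss is then small as well.\<close>

lemma trunc_norm_disk_aut_power_ge:
  assumes \<alpha>: "\<alpha> > -1" and w: "w \<in> unit_disk" and h: "h holomorphic_on unit_disk"
    and t: "0 \<le> t" "t \<le> cmod w - real m * (1 - (cmod w)\<^sup>2)"
  shows "t ^ n * trunc_norm \<alpha> m h \<le> trunc_norm \<alpha> m (\<lambda>z. disk_aut w z ^ n * h z)"
proof (induction n)
  case (Suc n)
  have "t ^ Suc n * trunc_norm \<alpha> m h \<le> t * trunc_norm \<alpha> m (\<lambda>z. disk_aut w z ^ n * h z)"
    using mult_left_mono[OF Suc t(1)] by (simp add: mult_ac)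
  also have "\<dots> \<le> (cmod w - real m * (1 - (cmod w)\<^sup>2)) * trunc_norm \<alpha> m (\<lambda>z. disk_aut w z ^ n * h z)"
    by (rule mult_right_mono[OF t(2) trunc_norm_nonneg])
  also have "\<dots> \<le> trunc_norm \<alpha> m (\<lambda>z. disk_aut w z * (disk_aut w z ^ n * h z))"
    by (intro trunc_norm_disk_aut_ge \<alpha> w holomorphic_intros h)
  finally show ?case by (simp add: mult_ac)
qed simp

text \<open>The composition is an automorphism whose zero is \<open>disk_aut a z\<close>, hence a
  rotation of the involution with that zero. The two points \<open>z\<close> and \<open>a\<close>
  thereby enter through one parameter, whose modulus is their pseudohyperbolic distance.\<close>

lemma disk_aut_compose:
  assumes z: "z \<in> unit_disk" and a: "a \<in> unit_disk"
  obtains v where "cmod v = 1" "\<And>\<zeta>. \<zeta> \<in> unit_disk \<Longrightarrow> disk_aut z (disk_aut a \<zeta>) = v * disk_aut (disk_aut a z) \<zeta>"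
proof -
  define e where "e = 1 - cnj a * z"
  have e: "e \<noteq> 0" "cnj e \<noteq> 0" using one_minus_cnj_mult_nonzero(1)[OF a z] by (auto simp: e_def simp del: complex_cnj_diff)
  have ce: "cnj e = 1 - a * cnj z" by (simp add: e_def)
  show thesis
  proof (rule that[of "- (e / cnj e)"])
    show "cmod (- (e / cnj e)) = 1" using e by (simp add: norm_divide)
    fix \<zeta> assume \<zeta>: "\<zeta> \<in> unit_disk"
    let ?d = "1 - cnj a * \<zeta>"
    have d: "?d \<noteq> 0" by (rule one_minus_cnj_mult_nonzero(1)[OF a \<zeta>])
    have "z - (a - \<zeta>) / ?d = (z * ?d - (a - \<zeta>)) / ?d" using d by (simp add: field_simps)
    moreover have "1 - cnj z * ((a - \<zeta>) / ?d) = (?d - cnj z * (a - \<zeta>)) / ?d" using d by (simp add: field_simps)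
    ultimately have 1: "disk_aut z (disk_aut a \<zeta>) = (z * ?d - (a - \<zeta>)) / (?d - cnj z * (a - \<zeta>))"
      using d by (simp add: disk_aut_def)
    have "(a - z) / e - \<zeta> = ((a - z) - \<zeta> * e) / e" using e by (simp add: field_simps)
    moreover have "1 - cnj ((a - z) / e) * \<zeta> = (cnj e - (cnj a - cnj z) * \<zeta>) / cnj e"
      unfolding complex_cnj_divide complex_cnj_diff using e(2) by (simp add: diff_divide_distrib left_diff_distrib)
    moreover have "disk_aut a z = (a - z) / e" by (simp add: disk_aut_def e_def)
    ultimately have 2: "disk_aut (disk_aut a z) \<zeta> = (((a - z) - \<zeta> * e) / e) / ((cnj e - (cnj a - cnj z) * \<zeta>) / cnj e)"
      by (simp only: disk_aut_def[of "(a - z) / e"])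
    have 3: "z * ?d - (a - \<zeta>) = - ((a - z) - \<zeta> * e)" by (simp add: e_def algebra_simps)
    have 4: "?d - cnj z * (a - \<zeta>) = cnj e - (cnj a - cnj z) * \<zeta>" by (simp add: ce algebra_simps)
    show "disk_aut z (disk_aut a \<zeta>) = - (e / cnj e) * disk_aut (disk_aut a z) \<zeta>"
      unfolding 1 2 3 4 using e by (simp del: minus_diff_eq)
  qed
qed

section \<open>The basis coefficients\<close>

text \<open>The quotient of n^(\<alpha> + 1) by the coefficient is exactly
  \<open>Gamma_series'\<close> at 2 + \<alpha>. This sequence converges to a Gamma value and is
  therefore bounded.\<close>

lemma basis_coeff_lower:
  assumes \<alpha>: "\<alpha> > -1"
  obtains K where "K > 0" "\<And>n. n \<ge> 1 \<Longrightarrow> real n powr (\<alpha> + 1) \<le> K * basis_coeff \<alpha> n"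
proof -
  define s where "s = 2 + \<alpha>"
  have s: "s > 0" using \<alpha> by (simp add: s_def)
  have Gs: "Gamma s > 0" using s by (rule Gamma_real_pos)
  have nn: "s \<notin> \<int>\<^sub>\<le>\<^sub>0" using s by (auto dest: nonpos_Ints_nonpos)
  have eq: "Gamma_series' s n = real n powr (\<alpha> + 1) / basis_coeff \<alpha> n" if n: "n \<ge> 1" for n
  proof -
    have "pochhammer s n = Gamma (s + real n) / Gamma s" by (rule pochhammer_Gamma[OF nn])
    then have "basis_coeff \<alpha> n = pochhammer s n / fact n"
      by (simp add: basis_coeff_def s_def add_ac)
    moreover have "fact n = real n * fact (n - 1)" using n by (simp add: fact_reduce)
    moreover have "exp (s * ln (real n)) = real n * real n powr (\<alpha> + 1)"
    proof -
      have "exp (s * ln (real n)) = real n powr (1 + (\<alpha> + 1))"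
        using n by (simp add: powr_def s_def)
      then show ?thesis using n by (simp add: powr_add power2_eq_square)
    qed
    ultimately show ?thesis using n by (simp add: Gamma_series'_def)
  qed
  have "Gamma_series' s \<longlonglongrightarrow> Gamma s" by (rule Gamma_series'_LIMSEQ)
  then have "Bseq (Gamma_series' s)" by (intro convergent_imp_Bseq) (auto simp: convergent_def)
  then obtain K where K: "K > 0" "\<And>n. norm (Gamma_series' s n) \<le> K" by (auto simp: Bseq_def)
  show thesis
  proof (rule that[OF K(1)])
    fix n :: nat assume n: "n \<ge> 1"
    have "real n powr (\<alpha> + 1) / basis_coeff \<alpha> n \<le> K"
      using abs_ge_self[of "Gamma_series' s n"] K(2)[of n] unfolding eq[OF n] real_norm_def by linarith
    then show "real n powr (\<alpha> + 1) \<le> K * basis_coeff \<alpha> n"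
      using basis_coeff_pos[OF \<alpha>, of n] by (simp add: pos_divide_le_eq)
  qed
qed

lemma basis_coeff_unbounded:
  assumes \<alpha>: "\<alpha> > -1"
  obtains n where "basis_coeff \<alpha> n > M"
proof -
  obtain K where K: "K > 0" "\<And>n. n \<ge> 1 \<Longrightarrow> real n powr (\<alpha> + 1) \<le> K * basis_coeff \<alpha> n"
    using basis_coeff_lower[OF \<alpha>] by blast
  have "filterlim (\<lambda>n. real n powr (\<alpha> + 1)) at_top sequentially"
    using \<alpha> by (intro filterlim_compose[OF real_powr_at_top filterlim_real_sequentially]) simp
  then have "eventually (\<lambda>n. real n powr (\<alpha> + 1) > K * M) sequentially"
    by (simp add: filterlim_at_top_dense)
  then have "eventually (\<lambda>n. real n powr (\<alpha> + 1) > K * M \<and> n \<ge> 1) sequentially"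
    using eventually_ge_at_top[of 1] by eventually_elim auto
  then obtain n where n: "real n powr (\<alpha> + 1) > K * M" "n \<ge> 1"
    using eventually_happens'[OF sequentially_bot] by blast
  then have "K * M < K * basis_coeff \<alpha> n" using K(2)[of n] by linarith
  then show thesis using K(1) that by simp
qed

text \<open>The function G(x) = (1 - x)^(-(2 + \<alpha>)) solves (1 - x) G' = (2 + \<alpha>) G. For
  its Taylor polynomials the recursion of the coefficients makes everything cancel except the top
  term. The sign of the right side will give monotonicity, and x = 1 a closed form for the sum of
  the coefficients.\<close>

lemma basis_coeff_partial_sum_ode:
  assumes \<alpha>: "\<alpha> > -1"
  shows "(1 - x) * (\<Sum>j<m. basis_coeff \<alpha> j * (real j * x ^ (j - 1))) - (2 + \<alpha>) * (\<Sum>j<m. basis_coeff \<alpha> j * x ^ j)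
    = - (real m * basis_coeff \<alpha> m * x ^ (m - 1))"
proof (induction m)
  case (Suc m)
  have c': "real (Suc m) * basis_coeff \<alpha> (Suc m) = (real m + 2 + \<alpha>) * basis_coeff \<alpha> m"
  proof -
    have "real m + 1 \<noteq> 0" by linarith
    then show ?thesis by (simp add: basis_coeff_Suc[OF \<alpha>] add.commute[of 1])
  qed
  have mX: "real m * x ^ m = x * (real m * x ^ (m - 1))" by (cases m) auto
  have st: "(1 - x) * (A + c * M) - (2 + \<alpha>) * (B + c * X) = - (c' * X)"
    if "(1 - x) * A - (2 + \<alpha>) * B = - (c * M)" "c' = (real m + 2 + \<alpha>) * c" "real m * X = x * M" for A B c c' X M
  proof -
    have "(1 - x) * (A + c * M) - (2 + \<alpha>) * (B + c * X) = - (c * M) + (c * M - c * (x * M) - (2 + \<alpha>) * (c * X))"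
      unfolding that(1)[symmetric] by (simp add: algebra_simps)
    also have "\<dots> = - (c' * X)" unfolding that(2) that(3)[symmetric] by (simp add: algebra_simps)
    finally show ?thesis .
  qed
  have "(1 - x) * (\<Sum>j<m. basis_coeff \<alpha> j * (real j * x ^ (j - 1))) - (2 + \<alpha>) * (\<Sum>j<m. basis_coeff \<alpha> j * x ^ j)
      = - (basis_coeff \<alpha> m * (real m * x ^ (m - 1)))" using Suc by (simp only: mult_ac)
  from st[OF this c' mX] show ?case by simp
qed simp

text \<open>The part of the unit vector \<open>T\<^sub>z e\<^sub>0\<close> seen by the first
  \<open>m\<close> sampling functionals at a point \<open>a\<close>, where \<open>x\<close> is the
  squared pseudohyperbolic distance of \<open>a\<close> and \<open>z\<close>. It is the probability
  that a negative binomial variable is below \<open>m\<close>.\<close>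

definition kernel_trunc :: "real \<Rightarrow> nat \<Rightarrow> real \<Rightarrow> real" where
  "kernel_trunc \<alpha> m x = (\<Sum>j<m. basis_coeff \<alpha> j * x ^ j) * (1 - x) powr (2 + \<alpha>)"

text \<open>The derivative is the left side of \<open>basis_coeff_partial_sum_ode\<close> times a
  power of 1 - t, hence not positive.\<close>

lemma kernel_trunc_antimono:
  assumes \<alpha>: "\<alpha> > -1" and x: "0 \<le> x" "x \<le> y" "y < 1"
  shows "kernel_trunc \<alpha> m y \<le> kernel_trunc \<alpha> m x"
proof (rule DERIV_nonpos_imp_nonincreasing[OF x(2)])
  fix t assume t: "x \<le> t" "t \<le> y"
  then have t': "0 \<le> t" "t < 1" using x by auto
  let ?G = "\<Sum>j<m. basis_coeff \<alpha> j * t ^ j"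
  let ?G' = "\<Sum>j<m. basis_coeff \<alpha> j * (real j * t ^ (j - 1))"
  have d1: "((\<lambda>t. \<Sum>j<m. basis_coeff \<alpha> j * t ^ j) has_real_derivative ?G') (at t)"
    by (auto intro!: derivative_eq_intros sum.cong)
  have d2: "((\<lambda>t. (1 - t) powr (2 + \<alpha>)) has_real_derivative - ((2 + \<alpha>) * (1 - t) powr (1 + \<alpha>))) (at t)"
    using t' by (auto intro!: derivative_eq_intros)
  have d: "(kernel_trunc \<alpha> m has_real_derivative ?G' * (1 - t) powr (2 + \<alpha>) + - ((2 + \<alpha>) * (1 - t) powr (1 + \<alpha>)) * ?G) (at t)"
    unfolding kernel_trunc_def[abs_def] by (rule DERIV_mult'[OF d1 d2, THEN DERIV_cong]) simp
  have "(1 - t) powr (2 + \<alpha>) = (1 - t) powr (1 + (1 + \<alpha>))" by simp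
  also have "\<dots> = (1 - t) * (1 - t) powr (1 + \<alpha>)"
    using t' powr_add[of "1 - t" 1 "1 + \<alpha>"] by simp
  finally have P: "(1 - t) powr (2 + \<alpha>) = (1 - t) * (1 - t) powr (1 + \<alpha>)" .
  have "?G' * (1 - t) powr (2 + \<alpha>) + - ((2 + \<alpha>) * (1 - t) powr (1 + \<alpha>)) * ?G =
      ((1 - t) * ?G' - (2 + \<alpha>) * ?G) * (1 - t) powr (1 + \<alpha>)"
  proof -
    have "A * ((1 - t) * P) + - ((2 + \<alpha>) * P) * B = ((1 - t) * A - (2 + \<alpha>) * B) * P" for A B P
      by (simp add: algebra_simps)
    then show ?thesis unfolding P by blast
  qed
  also have "\<dots> \<le> 0"
    unfolding basis_coeff_partial_sum_ode[OF \<alpha>] using t' basis_coeff_pos[OF \<alpha>, of m]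
    by (intro mult_nonpos_nonneg) auto
  finally show "\<exists>y. (kernel_trunc \<alpha> m has_real_derivative y) (at t) \<and> y \<le> 0" using d by blast
qed

text \<open>By monotonicity it is enough to look at 0, where the value is 1, or 0 when
  \<open>m = 0\<close>.\<close>

lemma kernel_trunc_le_1:
  assumes \<alpha>: "\<alpha> > -1" and x: "0 \<le> x" "x < 1"
  shows "kernel_trunc \<alpha> m x \<le> 1"
proof -
  have "kernel_trunc \<alpha> m x \<le> kernel_trunc \<alpha> m 0" by (rule kernel_trunc_antimono[OF \<alpha>]) (use x in auto)
  also have "\<dots> \<le> 1"
    using \<alpha> by (cases m) (auto simp: kernel_trunc_def lessThan_Suc_eq_insert_0 sum.insert_remove image_iff sum.reindex)
  finally show ?thesis .
qed

text \<open>\<open>kernel_trunc_le_1\<close> bounds the partial sums of the series by (1 - q)^(-(2 +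
  \<alpha>)), so its terms tend to 0. The resulting \<open>k\<close> is the exponent that later
  makes the uncovered compact set negligible.\<close>

lemma basis_coeff_geometric_small:
  assumes \<alpha>: "\<alpha> > -1" and q: "0 \<le> q" "q < 1" and "\<delta> > 0"
  obtains k where "basis_coeff \<alpha> k * q ^ k < \<delta>"
proof -
  have "summable (\<lambda>j. basis_coeff \<alpha> j * q ^ j)"
  proof (rule bounded_imp_summable)
    show "0 \<le> basis_coeff \<alpha> j * q ^ j" for j using basis_coeff_pos[OF \<alpha>, of j] q by simp
    show "(\<Sum>j\<le>m. basis_coeff \<alpha> j * q ^ j) \<le> 1 / (1 - q) powr (2 + \<alpha>)" for m
      using kernel_trunc_le_1[OF \<alpha> q, of "Suc m"] q
      by (simp add: kernel_trunc_def lessThan_Suc_atMost pos_le_divide_eq)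
  qed
  then have "(\<lambda>j. basis_coeff \<alpha> j * q ^ j) \<longlonglongrightarrow> 0" by (rule summable_LIMSEQ_zero)
  then have "eventually (\<lambda>j. basis_coeff \<alpha> j * q ^ j < \<delta>) sequentially"
    using \<open>\<delta> > 0\<close> by (rule order_tendstoD)
  then show thesis using that eventually_happens'[OF sequentially_bot] by blast
qed

lemma ratio_power_ge_exp:
  assumes "0 \<le> (a::real)" "m \<ge> 1"
  shows "exp (- a) \<le> (real m / (real m + a)) ^ m"
proof -
  have "(1 + a / real m) ^ m \<le> exp (a / real m) ^ m"
    using assms by (intro power_mono exp_ge_add_one_self add_nonneg_nonneg divide_nonneg_nonneg) auto
  also have "\<dots> = exp a" using assms by (simp flip: exp_of_nat_mult)
  finally have "inverse (exp a) \<le> inverse ((1 + a / real m) ^ m)"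
    using assms by (intro le_imp_inverse_le zero_less_power add_pos_nonneg) auto
  moreover have "inverse (1 + a / real m) = real m / (real m + a)" using assms by (simp add: field_simps)
  ultimately show ?thesis by (simp add: exp_minus power_inverse[symmetric])
qed

text \<open>By monotonicity only the endpoint y = m / (m + \<alpha> + 1) matters. There the powers
  y^j with j < m stay above exp (-(\<alpha> + 1)), the first \<open>m\<close> coefficients add up to
  at least a multiple of m^(\<alpha> + 2), and (1 - y)^(\<alpha> + 2) compensates exactly this
  growth.\<close>

lemma kernel_trunc_lower:
  assumes \<alpha>: "\<alpha> > -1"
  obtains \<kappa> where "\<kappa> > 0"
    "\<And>m x. m \<ge> 1 \<Longrightarrow> 0 \<le> x \<Longrightarrow> x < real m / (real m + \<alpha> + 1) \<Longrightarrow> \<kappa> \<le> kernel_trunc \<alpha> m x"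
proof -
  obtain K where K: "K > 0" "\<And>n. n \<ge> 1 \<Longrightarrow> real n powr (\<alpha> + 1) \<le> K * basis_coeff \<alpha> n"
    using basis_coeff_lower[OF \<alpha>] by blast
  define a where "a = \<alpha> + 1"
  have a: "a > 0" using \<alpha> by (simp add: a_def)
  \<comment> \<open>The three factors come from the bound on y^j, from the lower bound for the sum
    of the coefficients, and from m a / (m + a) \<ge> a / (1 + a) for m \<ge> 1.\<close>
  define \<kappa> where "\<kappa> = exp (- a) / (K * (1 + a)) * (a / (1 + a)) powr (1 + a)"
  have "\<kappa> > 0" using a K(1) by (simp add: \<kappa>_def)
  show thesis
  proof (rule that[OF \<open>\<kappa> > 0\<close>])
    fix m :: nat and x :: real
    assume m: "m \<ge> 1" and x: "0 \<le> x" "x < real m / (real m + \<alpha> + 1)"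
    define y where "y = real m / (real m + a)"
    have y: "0 \<le> y" "y < 1" "x \<le> y" using a x m by (auto simp: y_def a_def add_ac)
    have s1: "2 + \<alpha> = 1 + a" by (simp add: a_def)
    have y1: "1 - y = a / (real m + a)" using a m by (simp add: y_def field_simps)
    have "exp (- a) * (\<Sum>j<m. basis_coeff \<alpha> j) \<le> (\<Sum>j<m. basis_coeff \<alpha> j * y ^ j)"
      unfolding sum_distrib_left
    proof (rule sum_mono)
      fix j assume "j \<in> {..<m}"
      then have "y ^ m \<le> y ^ j" using y by (intro power_decreasing) auto
      moreover have "exp (- a) \<le> y ^ m" unfolding y_def using a m by (intro ratio_power_ge_exp) auto
      ultimately have "exp (- a) \<le> y ^ j" by linarith
      then show "exp (- a) * basis_coeff \<alpha> j \<le> basis_coeff \<alpha> j * y ^ j"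
        using basis_coeff_pos[OF \<alpha>, of j] by (simp add: mult.commute)
    qed
    moreover have "(\<Sum>j<m. basis_coeff \<alpha> j) = real m * basis_coeff \<alpha> m / (1 + a)"
      using basis_coeff_partial_sum_ode[OF \<alpha>, of 1 m] a by (simp add: a_def field_simps)
    moreover have "real m powr (1 + a) / (K * (1 + a)) \<le> real m * basis_coeff \<alpha> m / (1 + a)"
    proof -
      have "real m powr (1 + a) = real m * real m powr a" using m by (simp add: powr_add)
      also have "\<dots> \<le> real m * (K * basis_coeff \<alpha> m)" using K(2)[OF m] by (simp add: a_def mult_left_mono)
      finally have "real m powr (1 + a) / (K * (1 + a)) \<le> real m * (K * basis_coeff \<alpha> m) / (K * (1 + a))"
        using K(1) a by (intro divide_right_mono) auto
      then show ?thesis using K(1) by simp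
    qed
    ultimately have "exp (- a) * (real m powr (1 + a) / (K * (1 + a))) \<le> (\<Sum>j<m. basis_coeff \<alpha> j * y ^ j)"
      by (smt (verit) exp_gt_zero mult_left_mono)
    then have "exp (- a) * (real m powr (1 + a) / (K * (1 + a))) * (a / (real m + a)) powr (1 + a) \<le> kernel_trunc \<alpha> m y"
      unfolding kernel_trunc_def y1 s1 by (rule mult_right_mono) simp
    moreover have "\<kappa> \<le> exp (- a) * (real m powr (1 + a) / (K * (1 + a))) * (a / (real m + a)) powr (1 + a)"
    proof -
      have "(a / (1 + a)) powr (1 + a) \<le> (real m * (a / (real m + a))) powr (1 + a)"
      proof (rule powr_mono2)
        have "a * a * 1 \<le> a * a * real m" using m a by (intro mult_left_mono) auto
        then show "a / (1 + a) \<le> real m * (a / (real m + a))" using a m by (simp add: field_simps)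
      qed (use a in auto)
      also have "\<dots> = real m powr (1 + a) * (a / (real m + a)) powr (1 + a)"
        using a by (subst powr_mult) auto
      finally have "exp (- a) / (K * (1 + a)) * (a / (1 + a)) powr (1 + a) \<le>
          exp (- a) / (K * (1 + a)) * (real m powr (1 + a) * (a / (real m + a)) powr (1 + a))"
        using K(1) a by (intro mult_left_mono) auto
      then show ?thesis by (simp add: \<kappa>_def mult_ac)
    qed
    moreover have "kernel_trunc \<alpha> m y \<le> kernel_trunc \<alpha> m x"
      by (rule kernel_trunc_antimono[OF \<alpha> x(1) y(3,2)])
    ultimately show "\<kappa> \<le> kernel_trunc \<alpha> m x" by linarith
  qed
qed

section \<open>Necessity\<close>

lemma bergman_basis_in_bergman: "\<alpha> > -1 \<Longrightarrow> bergman_basis \<alpha> n \<in> bergman \<alpha>"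
  and disk_norm_sq_bergman_basis: "\<alpha> > -1 \<Longrightarrow> disk_norm_sq \<alpha> 1 (bergman_basis \<alpha> n) = 1"
proof -
  assume \<alpha>: "\<alpha> > -1"
  let ?c = "basis_coeff \<alpha> n"
  have c: "?c > 0" by (rule basis_coeff_pos[OF \<alpha>])
  have "disk_norm_sq \<alpha> 1 (bergman_basis \<alpha> n) =
      (\<integral>\<^sup>+z. ennreal ?c * (ennreal (disk_indicator 1 z) * ennreal ((cmod (z ^ n))\<^sup>2)) \<partial>dA \<alpha>)"
    unfolding disk_norm_sq_def bergman_basis_def basis_coeff_def[symmetric]
    using c by (intro nn_integral_cong) (simp add: norm_mult power_mult_distrib ennreal_mult' mult.left_commute)
  also have "\<dots> = ennreal ?c * moment \<alpha> n 1"
    unfolding moment_eq_disk_norm_sq disk_norm_sq_def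
    by (intro nn_integral_cmult disk_norm_sq_measurable holomorphic_intros)
  also have "\<dots> = 1" using c by (simp add: moment_1[OF \<alpha>] flip: ennreal_mult')
  finally show "disk_norm_sq \<alpha> 1 (bergman_basis \<alpha> n) = 1" .
  then show "bergman_basis \<alpha> n \<in> bergman \<alpha>" by (simp add: bergman_iff holomorphic_bergman_basis)
qed

lemma bergman_inner_cnj: "bergman_inner \<alpha> f g = cnj (bergman_inner \<alpha> g f)"
  unfolding bergman_inner_def Bochner_Integration.integral_cnj[symmetric]
  by (intro Bochner_Integration.integral_cong refl) (simp add: mult.commute)

text \<open>Since \<open>T\<^sub>z e\<^sub>0\<close> is the normalised reproducing kernel at \<open>z\<close>, its coefficients are read off from
  point evaluations.\<close>

lemma norm_sq_inner_kernel:
  assumes \<alpha>: "\<alpha> > -1" and z: "z \<in> unit_disk" and a: "a \<in> unit_disk"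
  shows "(cmod (bergman_inner \<alpha> (bergman_shift \<alpha> z (bergman_basis \<alpha> 0)) (bergman_shift \<alpha> a (bergman_basis \<alpha> j))))\<^sup>2
    = basis_coeff \<alpha> j * ((pseudohyp_dist a z)\<^sup>2) ^ j * (1 - (pseudohyp_dist a z)\<^sup>2) powr (2 + \<alpha>)"
proof -
  let ?g = "bergman_shift \<alpha> a (bergman_basis \<alpha> j)"
  let ?x = "(pseudohyp_dist a z)\<^sup>2"
  have g: "?g \<in> bergman \<alpha>" by (rule bergman_shift_in_bergman[OF a bergman_basis_in_bergman[OF \<alpha>]])
  then have gh: "?g holomorphic_on unit_disk" by (simp add: bergman_def)
  have z0: "0 \<in> unit_disk" by simp
  have dz: "disk_aut z 0 = z" by (simp add: disk_aut_def)
  have "cmod (bergman_inner \<alpha> (bergman_shift \<alpha> z (bergman_basis \<alpha> 0)) ?g) =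
      cmod (bergman_inner \<alpha> ?g (bergman_shift \<alpha> z (bergman_basis \<alpha> 0)))"
    by (subst bergman_inner_cnj) simp
  also have "\<dots> = cmod (bergman_inner \<alpha> (bergman_shift \<alpha> z ?g) (bergman_basis \<alpha> 0))"
    by (rule norm_bergman_inner_shift[OF z gh holomorphic_bergman_basis])
  also have "\<dots> = cmod (bergman_shift \<alpha> z ?g 0)"
    unfolding bergman_inner_basis[OF \<alpha> bergman_shift_in_bergman[OF z g]] taylor_coeff_def using \<alpha> by simp
  also have "\<dots> = cmod (shift_weight \<alpha> z 0) * (cmod (shift_weight \<alpha> a z) * cmod (bergman_basis \<alpha> j (disk_aut a z)))"
    by (simp add: bergman_shift_eq dz norm_mult)
  finally have "(cmod (bergman_inner \<alpha> (bergman_shift \<alpha> z (bergman_basis \<alpha> 0)) ?g))\<^sup>2 =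
      cmod (deriv (disk_aut z) 0) powr (2 + \<alpha>) * (cmod (deriv (disk_aut a) z) powr (2 + \<alpha>) *
      (cmod (bergman_basis \<alpha> j (disk_aut a z)))\<^sup>2)"
    by (simp only: power_mult_distrib norm_shift_weight[OF z z0] norm_shift_weight[OF a z])
  also have "cmod (deriv (disk_aut z) 0) powr (2 + \<alpha>) * (cmod (deriv (disk_aut a) z) powr (2 + \<alpha>) * Y) =
      (1 - ?x) powr (2 + \<alpha>) * Y" for Y
  proof -
    \<comment> \<open>The first modulus is 1 - |z|^2, the second is the remaining factor in the
      formula for 1 - |w|^2 with \<open>w = disk_aut a z\<close>.\<close>
    have "cmod (deriv (disk_aut z) 0) * cmod (deriv (disk_aut a) z) = 1 - ?x"
      using one_minus_norm_sq_disk_aut[OF a z]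
      by (simp add: norm_deriv_disk_aut[OF z z0] norm_deriv_disk_aut[OF a z] pseudohyp_dist_def)
    then show ?thesis by (simp add: powr_mult mult.assoc[symmetric] flip: powr_mult)
  qed
  also have "(cmod (bergman_basis \<alpha> j (disk_aut a z)))\<^sup>2 = basis_coeff \<alpha> j * ?x ^ j"
    using basis_coeff_pos[OF \<alpha>, of j]
    unfolding bergman_basis_def basis_coeff_def[symmetric] pseudohyp_dist_def
    by (simp add: norm_mult norm_power power_mult_distrib power_mult[symmetric] mult.commute)
  finally show ?thesis by (simp only: mult_ac)
qed

lemma sample_kernel:
  assumes \<alpha>: "\<alpha> > -1" and z: "z \<in> unit_disk" and L: "\<Lambda> \<subseteq> unit_disk"
  shows "sample_sum \<alpha> \<Lambda> m (bergman_shift \<alpha> z (bergman_basis \<alpha> 0)) =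
    (\<Sum>\<^sub>\<infinity>a\<in>\<Lambda>. ennreal (kernel_trunc \<alpha> (m a) ((pseudohyp_dist a z)\<^sup>2)))"
  unfolding sample_sum_def
proof (rule infsum_cong)
  fix a assume "a \<in> \<Lambda>"
  then have a: "a \<in> unit_disk" using L by blast
  show "(\<Sum>j<m a. ennreal ((cmod (bergman_inner \<alpha> (bergman_shift \<alpha> z (bergman_basis \<alpha> 0))
      (bergman_shift \<alpha> a (bergman_basis \<alpha> j))))\<^sup>2)) = ennreal (kernel_trunc \<alpha> (m a) ((pseudohyp_dist a z)\<^sup>2))"
    unfolding norm_sq_inner_kernel[OF \<alpha> z a] kernel_trunc_def sum_distrib_right
    by (rule sum_ennreal) (simp add: less_imp_le[OF basis_coeff_pos[OF \<alpha>]])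
qed

lemma shift_kernel_norm:
  assumes \<alpha>: "\<alpha> > -1" and z: "z \<in> unit_disk"
  shows "bergman_shift \<alpha> z (bergman_basis \<alpha> n) \<in> bergman \<alpha>"
    and "ennreal ((bergman_norm \<alpha> (bergman_shift \<alpha> z (bergman_basis \<alpha> n)))\<^sup>2) = 1"
proof -
  show 1: "bergman_shift \<alpha> z (bergman_basis \<alpha> n) \<in> bergman \<alpha>"
    by (rule bergman_shift_in_bergman[OF z bergman_basis_in_bergman[OF \<alpha>]])
  show "ennreal ((bergman_norm \<alpha> (bergman_shift \<alpha> z (bergman_basis \<alpha> n)))\<^sup>2) = 1"
    unfolding bergman_norm_sq[OF 1] disk_norm_sq_1_bergman_shift[OF z holomorphic_bergman_basis]
    by (rule disk_norm_sq_bergman_basis[OF \<alpha>])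
qed

lemma sample_le_of_upper_bound:
  assumes C: "C' > (0::real)" and le: "ennreal (1 / C') * S \<le> 1"
  shows "S \<le> ennreal C'"
proof -
  have "ennreal C' * (ennreal (1 / C') * S) \<le> ennreal C' * 1" by (intro mult_left_mono le) simp
  then show ?thesis using C by (simp add: mult.assoc[symmetric] flip: ennreal_mult')
qed

text \<open>Every disk containing \<open>z\<close> contributes at least \<kappa> to the sampling sum
  of a unit vector, and the whole sum is at most C'. Hence at most C' / \<kappa> disks contain
  \<open>z\<close>.\<close>

lemma sampling_imp_finite_overlap:
  assumes \<alpha>: "\<alpha> > -1" and div: "divisor \<Lambda> m" and samp: "sampling \<alpha> \<Lambda> m"
  shows "finite_overlap \<alpha> \<Lambda> m"
proof -
  have L: "\<Lambda> \<subseteq> unit_disk" using div by (simp add: divisor_def)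
  obtain C' where C': "C' > 0"
    "\<And>f. f \<in> bergman \<alpha> \<Longrightarrow> ennreal (1 / C') * sample_sum \<alpha> \<Lambda> m f \<le> ennreal ((bergman_norm \<alpha> f)\<^sup>2)"
    using samp unfolding sampling_def by blast
  obtain \<kappa> where \<kappa>: "\<kappa> > 0"
    "\<And>m x. m \<ge> 1 \<Longrightarrow> 0 \<le> x \<Longrightarrow> x < real m / (real m + \<alpha> + 1) \<Longrightarrow> \<kappa> \<le> kernel_trunc \<alpha> m x"
    using kernel_trunc_lower[OF \<alpha>] by blast
  let ?r = "\<lambda>a. sqrt (real (m a) / (real (m a) + \<alpha> + 1))"
  have "(\<Sum>\<^sub>\<infinity>a\<in>\<Lambda>. indicator (pseudohyp_disk a (?r a)) z) \<le> ennreal (1 / \<kappa>) * ennreal C'" if z: "z \<in> unit_disk" for z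
  proof -
    have "(\<Sum>\<^sub>\<infinity>a\<in>\<Lambda>. indicator (pseudohyp_disk a (?r a)) z) \<le>
        ennreal (1 / \<kappa>) * (\<Sum>\<^sub>\<infinity>a\<in>\<Lambda>. ennreal (kernel_trunc \<alpha> (m a) ((pseudohyp_dist a z)\<^sup>2)))"
    proof (rule ennreal_infsum_le_cmult)
      fix a assume a: "a \<in> \<Lambda>"
      show "indicator (pseudohyp_disk a (?r a)) z \<le> ennreal (1 / \<kappa>) * ennreal (kernel_trunc \<alpha> (m a) ((pseudohyp_dist a z)\<^sup>2))"
      proof (cases "z \<in> pseudohyp_disk a (?r a)")
        case True
        then have "pseudohyp_dist a z < ?r a" by (simp add: pseudohyp_disk_def)
        moreover have "0 \<le> pseudohyp_dist a z" by (simp add: pseudohyp_dist_def)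
        ultimately have "(pseudohyp_dist a z)\<^sup>2 < (?r a)\<^sup>2" by (intro power_strict_mono) auto
        also have "(?r a)\<^sup>2 = real (m a) / (real (m a) + \<alpha> + 1)" using \<alpha> by simp
        finally have "\<kappa> \<le> kernel_trunc \<alpha> (m a) ((pseudohyp_dist a z)\<^sup>2)"
          using div a by (intro \<kappa>(2)) (auto simp: divisor_def)
        then have "ennreal (1 / \<kappa>) * ennreal \<kappa> \<le> ennreal (1 / \<kappa>) * ennreal (kernel_trunc \<alpha> (m a) ((pseudohyp_dist a z)\<^sup>2))"
          by (intro mult_left_mono ennreal_leI) auto
        moreover have "ennreal (1 / \<kappa>) * ennreal \<kappa> = 1" using \<kappa>(1) by (simp flip: ennreal_mult')
        ultimately show ?thesis using True by simp
      qed simp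
    qed
    also have "(\<Sum>\<^sub>\<infinity>a\<in>\<Lambda>. ennreal (kernel_trunc \<alpha> (m a) ((pseudohyp_dist a z)\<^sup>2))) \<le> ennreal C'"
      unfolding sample_kernel[OF \<alpha> z L, symmetric]
      using C'(2)[OF shift_kernel_norm(1)[OF \<alpha> z, of 0]] unfolding shift_kernel_norm(2)[OF \<alpha> z]
      by (rule sample_le_of_upper_bound[OF C'(1)])
    finally show ?thesis by (simp add: mult_left_mono)
  qed
  then have "overlap_const \<alpha> \<Lambda> m \<le> ennreal (1 / \<kappa>) * ennreal C'"
    unfolding overlap_const_def by (intro SUP_least) auto
  also have "\<dots> < \<infinity>" by (simp add: ennreal_mult_less_top)
  finally show ?thesis unfolding finite_overlap_def .
qed

text \<open>As e_0 = 1 and e_n is a multiple of z^n, the two doubly shifted functions differ by the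
  factor sqrt c_n times the n-th power of \<open>disk_aut z\<close> composed with
  \<open>disk_aut a\<close>. Up to a rotation this composition is \<open>disk_aut w\<close>, to
  which the multiplier bound applies.\<close>

lemma trunc_norm_sq_shift_basis_ge:
  assumes \<alpha>: "\<alpha> > -1" and z: "z \<in> unit_disk" and a: "a \<in> unit_disk" and t: "0 \<le> t"
    and t': "t \<le> pseudohyp_dist a z - real m * (1 - (pseudohyp_dist a z)\<^sup>2)"
  shows "basis_coeff \<alpha> n * t ^ (2 * n) * trunc_norm_sq \<alpha> m (bergman_shift \<alpha> a (bergman_shift \<alpha> z (bergman_basis \<alpha> 0)))
    \<le> trunc_norm_sq \<alpha> m (bergman_shift \<alpha> a (bergman_shift \<alpha> z (bergman_basis \<alpha> n)))"
proof -
  let ?h = "bergman_shift \<alpha> a (bergman_shift \<alpha> z (bergman_basis \<alpha> 0))"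
  let ?c = "sqrt (basis_coeff \<alpha> n)"
  define w where "w = disk_aut a z"
  have w: "w \<in> unit_disk" unfolding w_def by (rule disk_aut_in_disk[OF a z])
  obtain v where v: "cmod v = 1" "\<And>\<zeta>. \<zeta> \<in> unit_disk \<Longrightarrow> disk_aut z (disk_aut a \<zeta>) = v * disk_aut w \<zeta>"
    using disk_aut_compose[OF z a] unfolding w_def by blast
  have h: "?h holomorphic_on unit_disk"
    by (intro holomorphic_bergman_shift a z holomorphic_bergman_basis)
  have wh: "(\<lambda>\<zeta>. disk_aut w \<zeta> ^ n * ?h \<zeta>) holomorphic_on unit_disk"
    by (intro holomorphic_intros w h)
  have b0: "bergman_basis \<alpha> 0 \<zeta> = 1" for \<zeta>
    unfolding bergman_basis_def basis_coeff_def[symmetric] using \<alpha> by simp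
  have "trunc_norm \<alpha> m (bergman_shift \<alpha> a (bergman_shift \<alpha> z (bergman_basis \<alpha> n))) =
      trunc_norm \<alpha> m (\<lambda>\<zeta>. (of_real ?c * v ^ n) * (disk_aut w \<zeta> ^ n * ?h \<zeta>))"
  proof (intro trunc_norm_cong taylor_coeff_cong)
    fix \<zeta> assume \<zeta>: "\<zeta> \<in> unit_disk"
    have "bergman_basis \<alpha> n (disk_aut z (disk_aut a \<zeta>)) = of_real ?c * (v * disk_aut w \<zeta>) ^ n"
      unfolding v(2)[OF \<zeta>] bergman_basis_def basis_coeff_def[symmetric] ..
    then show "bergman_shift \<alpha> a (bergman_shift \<alpha> z (bergman_basis \<alpha> n)) \<zeta> =
        of_real ?c * v ^ n * (disk_aut w \<zeta> ^ n * ?h \<zeta>)"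
      by (simp add: bergman_shift_eq b0 power_mult_distrib)
  qed
  also have "\<dots> = ?c * trunc_norm \<alpha> m (\<lambda>\<zeta>. disk_aut w \<zeta> ^ n * ?h \<zeta>)"
    using basis_coeff_pos[OF \<alpha>, of n] v(1) unfolding trunc_norm_cmult[OF wh] by (simp add: norm_mult norm_power)
  finally have 1: "trunc_norm \<alpha> m (bergman_shift \<alpha> a (bergman_shift \<alpha> z (bergman_basis \<alpha> n))) = \<dots>" .
  have "t ^ n * trunc_norm \<alpha> m ?h \<le> trunc_norm \<alpha> m (\<lambda>\<zeta>. disk_aut w \<zeta> ^ n * ?h \<zeta>)"
    using t' unfolding pseudohyp_dist_def w_def[symmetric] by (intro trunc_norm_disk_aut_power_ge \<alpha> w h t)
  then have "?c * (t ^ n * trunc_norm \<alpha> m ?h) \<le> trunc_norm \<alpha> m (bergman_shift \<alpha> a (bergman_shift \<alpha> z (bergman_basis \<alpha> n)))"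
    unfolding 1 using basis_coeff_pos[OF \<alpha>, of n] by (intro mult_left_mono) auto
  then have "(?c * (t ^ n * trunc_norm \<alpha> m ?h))\<^sup>2 \<le> (trunc_norm \<alpha> m (bergman_shift \<alpha> a (bergman_shift \<alpha> z (bergman_basis \<alpha> n))))\<^sup>2"
    using basis_coeff_pos[OF \<alpha>, of n] t by (intro power_mono) (auto simp: trunc_norm_nonneg)
  moreover have "(t ^ n)\<^sup>2 = t ^ (2 * n)" by (simp add: power_mult mult.commute flip: power_mult)
  moreover have "?c\<^sup>2 = basis_coeff \<alpha> n" using basis_coeff_pos[OF \<alpha>, of n] by simp
  ultimately show ?thesis
    unfolding power_mult_distrib trunc_norm_power2[OF \<alpha>] by (simp only: mult.assoc)
qed

lemma sampling_imp_covering: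
  assumes \<alpha>: "\<alpha> > -1" and div: "divisor \<Lambda> m" and samp: "sampling \<alpha> \<Lambda> m"
  shows "\<exists>C::real. 0 < C \<and> C < \<alpha> + 1 \<and>
    (\<Union>a\<in>\<Lambda>. pseudohyp_disk a (sqrt ((real (m a) + C) / (real (m a) + \<alpha> + 1)))) = unit_disk"
proof -
  have L: "\<Lambda> \<subseteq> unit_disk" and m1: "\<And>a. a \<in> \<Lambda> \<Longrightarrow> 1 \<le> m a" using div by (auto simp: divisor_def)
  obtain C' where C': "C' > 0"
    "\<And>f. f \<in> bergman \<alpha> \<Longrightarrow> ennreal (1 / C') * sample_sum \<alpha> \<Lambda> m f \<le> ennreal ((bergman_norm \<alpha> f)\<^sup>2)"
    "\<And>f. f \<in> bergman \<alpha> \<Longrightarrow> ennreal ((bergman_norm \<alpha> f)\<^sup>2) \<le> ennreal C' * sample_sum \<alpha> \<Lambda> m f"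
    using samp unfolding sampling_def by blast
  \<comment> \<open>The two sampling inequalities cost a factor C' each, and t^(2n) \<ge> 1/2 costs
    the factor 2.\<close>
  obtain n where n: "basis_coeff \<alpha> n > 2 * C' * C'" using basis_coeff_unbounded[OF \<alpha>] by blast
  \<comment> \<open>The first entry keeps C = \<alpha> + 1 - \<epsilon> positive. The second makes 4
    n \<epsilon> \<le> 1/2, so that Bernoulli's inequality gives t^(2n) \<ge> 1/2.\<close>
  define \<epsilon> where "\<epsilon> = min ((\<alpha> + 1) / 2) (1 / (8 * real n + 8))"
  have e: "0 < \<epsilon>" "\<epsilon> < \<alpha> + 1" "\<epsilon> \<le> 1 / (8 * real n + 8)" using \<alpha> by (auto simp: \<epsilon>_def min_def)
  \<comment> \<open>At an uncovered point one \<epsilon> bounds 1 - \<rho> and the other bounds m (1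
    - \<rho>^2), the two losses in the multiplier bound.\<close>
  define t where "t = 1 - 2 * \<epsilon>"
  have en: "real n * \<epsilon> \<le> 1 / 8" "\<epsilon> \<le> 1 / 8"
  proof -
    have "\<epsilon> * (8 * real n + 8) \<le> 1" using e(3) by (simp add: field_simps)
    then have "8 * (real n * \<epsilon>) + 8 * \<epsilon> \<le> 1" by (simp add: algebra_simps)
    moreover have "0 \<le> real n * \<epsilon>" using e(1) by simp
    ultimately show "real n * \<epsilon> \<le> 1 / 8" "\<epsilon> \<le> 1 / 8" using e(1) by linarith+
  qed
  have t: "0 \<le> t" "1 / 2 \<le> t ^ (2 * n)"
  proof -
    show "0 \<le> t" using en by (simp add: t_def)
    have "1 + real (2 * n) * (- (2 * \<epsilon>)) \<le> (1 + (- (2 * \<epsilon>))) ^ (2 * n)"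
      using en by (intro Bernoulli_inequality) simp
    then show "1 / 2 \<le> t ^ (2 * n)" using en by (simp add: t_def)
  qed
  have "z \<in> (\<Union>a\<in>\<Lambda>. pseudohyp_disk a (sqrt ((real (m a) + (\<alpha> + 1 - \<epsilon>)) / (real (m a) + \<alpha> + 1))))" if z: "z \<in> unit_disk" for z
  proof (rule ccontr)
    assume neg: "\<not> ?thesis"
    let ?f = "\<lambda>n. bergman_shift \<alpha> z (bergman_basis \<alpha> n)"
    have key: "basis_coeff \<alpha> n / 2 * trunc_norm_sq \<alpha> (m a) (bergman_shift \<alpha> a (?f 0))
        \<le> trunc_norm_sq \<alpha> (m a) (bergman_shift \<alpha> a (?f n))" if a: "a \<in> \<Lambda>" for a
    proof -
      have aD: "a \<in> unit_disk" using L a by blast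
      let ?p = "pseudohyp_dist a z"
      define M where "M = real (m a)"
      have M: "M \<ge> 1" using m1[OF a] by (simp add: M_def)
      have p: "0 \<le> ?p" "?p < 1" using disk_aut_in_disk[OF aD z] by (auto simp: pseudohyp_dist_def)
      have "sqrt ((M + (\<alpha> + 1 - \<epsilon>)) / (M + \<alpha> + 1)) \<le> ?p"
        using neg a z unfolding M_def by (auto simp: pseudohyp_disk_def not_less)
      then have "(M + (\<alpha> + 1 - \<epsilon>)) / (M + \<alpha> + 1) \<le> ?p\<^sup>2"
        by (rule sqrt_le_D)
      then have "1 - ?p\<^sup>2 \<le> \<epsilon> / (M + \<alpha> + 1)" using M \<alpha> by (simp add: field_simps)
      also have "\<dots> \<le> \<epsilon> / M" using M \<alpha> e(1) by (intro frac_le) auto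
      finally have Me: "M * (1 - ?p\<^sup>2) \<le> \<epsilon>" using M by (simp add: field_simps)
      have "1 - ?p\<^sup>2 \<le> M * (1 - ?p\<^sup>2)"
        using mult_right_mono[OF M, of "1 - ?p\<^sup>2"] p by (simp add: power_le_one)
      moreover have "?p\<^sup>2 \<le> ?p" using p by (simp add: power2_eq_square mult_left_le)
      ultimately have "t \<le> ?p - M * (1 - ?p\<^sup>2)" using Me unfolding t_def by linarith
      from trunc_norm_sq_shift_basis_ge[OF \<alpha> z aD t(1) this[unfolded M_def], of n]
      have "basis_coeff \<alpha> n * t ^ (2 * n) * trunc_norm_sq \<alpha> (m a) (bergman_shift \<alpha> a (?f 0))
        \<le> trunc_norm_sq \<alpha> (m a) (bergman_shift \<alpha> a (?f n))" .
      moreover have "basis_coeff \<alpha> n * (1 / 2) \<le> basis_coeff \<alpha> n * t ^ (2 * n)"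
        using t(2) basis_coeff_pos[OF \<alpha>, of n] by (intro mult_left_mono) auto
      then have "basis_coeff \<alpha> n * (1 / 2) * trunc_norm_sq \<alpha> (m a) (bergman_shift \<alpha> a (?f 0)) \<le>
          basis_coeff \<alpha> n * t ^ (2 * n) * trunc_norm_sq \<alpha> (m a) (bergman_shift \<alpha> a (?f 0))"
        by (rule mult_right_mono) (rule trunc_norm_sq_nonneg[OF \<alpha>])
      ultimately show ?thesis by simp
    qed
    define q where "q = 2 / basis_coeff \<alpha> n"
    have q: "q > 0" using basis_coeff_pos[OF \<alpha>, of n] by (simp add: q_def)
    have "sample_sum \<alpha> \<Lambda> m (?f 0) \<le> ennreal q * sample_sum \<alpha> \<Lambda> m (?f n)"
      unfolding sample_sum_eq[OF \<alpha> L shift_kernel_norm(1)[OF \<alpha> z]]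
    proof (rule ennreal_infsum_le_cmult)
      fix a assume "a \<in> \<Lambda>"
      from key[OF this] have "trunc_norm_sq \<alpha> (m a) (bergman_shift \<alpha> a (?f 0)) \<le>
          q * trunc_norm_sq \<alpha> (m a) (bergman_shift \<alpha> a (?f n))"
        using basis_coeff_pos[OF \<alpha>, of n] by (simp add: q_def field_simps)
      then show "ennreal (trunc_norm_sq \<alpha> (m a) (bergman_shift \<alpha> a (?f 0))) \<le>
          ennreal q * ennreal (trunc_norm_sq \<alpha> (m a) (bergman_shift \<alpha> a (?f n)))"
        using q by (simp add: ennreal_mult'[symmetric] ennreal_leI)
    qed
    also have "\<dots> \<le> ennreal q * ennreal C'"
      using C'(2)[OF shift_kernel_norm(1)[OF \<alpha> z, of n]] unfolding shift_kernel_norm(2)[OF \<alpha> z]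
      by (intro mult_left_mono sample_le_of_upper_bound[OF C'(1)]) auto
    finally have S0: "sample_sum \<alpha> \<Lambda> m (?f 0) \<le> ennreal q * ennreal C'" .
    have "1 \<le> ennreal C' * sample_sum \<alpha> \<Lambda> m (?f 0)"
      using C'(3)[OF shift_kernel_norm(1)[OF \<alpha> z, of 0]] unfolding shift_kernel_norm(2)[OF \<alpha> z] .
    also have "\<dots> \<le> ennreal C' * (ennreal q * ennreal C')" by (intro mult_left_mono S0) simp
    also have "\<dots> = ennreal (C' * (q * C'))" using q C'(1) by (simp add: ennreal_mult')
    finally have "1 \<le> C' * (q * C')" using q C'(1) by (simp flip: ennreal_1)
    moreover have "C' * (q * C') < 1"
      using n basis_coeff_pos[OF \<alpha>, of n] by (simp add: q_def field_simps)
    ultimately show False by simp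
  qed
  then have "(\<Union>a\<in>\<Lambda>. pseudohyp_disk a (sqrt ((real (m a) + (\<alpha> + 1 - \<epsilon>)) / (real (m a) + \<alpha> + 1)))) = unit_disk"
    by (auto simp: pseudohyp_disk_def)
  then show ?thesis using e by (intro exI[of _ "\<alpha> + 1 - \<epsilon>"]) auto
qed

section \<open>Comparison of incomplete beta integrals\<close>

lemma incomplete_beta_measurable [measurable]:
  "(\<lambda>t. indicator {0<..<x} t * ennreal (t ^ n * (1 - t) powr \<alpha>)) \<in> borel_measurable borel"
  by measurable

text \<open>The exponential bounds q^(n + 1) for n \<ge> M, where q = (M - C) / M. The power bounds
  the quotient of (1 - q u)^\<alpha> and (1 - u)^\<alpha> for 0 < u < M / (M + \<alpha> + 1); for
  negative \<alpha> this quotient is at most 1, whence the maximum.\<close>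

definition dilation_const :: "real \<Rightarrow> real \<Rightarrow> real" where
  "dilation_const \<alpha> C = exp (- C) * (1 + C / (\<alpha> + 1)) powr max \<alpha> 0"

text \<open>Substitute \<open>t = q u\<close> with \<open>q = (M - C) / M\<close>, which maps the shorter interval of
  integration onto the longer one; the factor \<open>q\<^sup>n\<close> accounts for \<open>exp (- C)\<close>.\<close>

lemma incomplete_beta_dilation:
  assumes \<alpha>: "\<alpha> > -1" and C: "0 < C" "C < M" and n: "M \<le> real n"
  shows "incomplete_beta \<alpha> n ((M - C) / (M + \<alpha> + 1))
    \<le> ennreal (dilation_const \<alpha> C) * incomplete_beta \<alpha> n (M / (M + \<alpha> + 1))"
proof -
  define a where "a = \<alpha> + 1"
  have a: "a > 0" using \<alpha> by (simp add: a_def)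
  have M: "M > 0" using C by simp
  define q where "q = (M - C) / M"
  have q: "0 < q" "q < 1" "1 - q = C / M" using C M by (auto simp: q_def field_simps)
  define y where "y = M / (M + a)"
  have y: "0 < y" "y < 1" using M a by (auto simp: y_def)
  have xy: "(M - C) / (M + \<alpha> + 1) = q * y" using M a by (simp add: q_def y_def a_def add_ac)
  have yy: "M / (M + \<alpha> + 1) = y" by (simp add: y_def a_def add_ac)
  let ?D = "dilation_const \<alpha> C"
  let ?g = "\<lambda>x t. indicator {0<..<x} t * ennreal (t ^ n * (1 - t) powr \<alpha>)"
  \<comment> \<open>One factor \<open>q\<close> is the Jacobian of the substitution, the other
    \<open>n\<close> come from the monomial.\<close>
  have qn: "q ^ Suc n \<le> exp (- C)"
  proof -
    have "q \<le> exp (- (C / M))" using exp_ge_add_one_self[of "- (C / M)"] q(3) by simp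
    then have "q ^ Suc n \<le> exp (- (C / M)) ^ Suc n" using q by (intro power_mono) auto
    also have "\<dots> = exp (- (real (Suc n) * (C / M)))" by (simp only: exp_of_nat_mult[symmetric]) simp
    also have "\<dots> \<le> exp (- C)"
    proof -
      have "M * C \<le> real (Suc n) * C" using n C by (intro mult_right_mono) auto
      then show ?thesis using M by (simp add: pos_le_divide_eq mult.commute)
    qed
    finally show ?thesis .
  qed
  have pt: "ennreal q * ?g (q * y) (0 + q * u) \<le> ennreal ?D * ?g y u" for u
  proof (cases "u \<in> {0<..<y}")
    case True
    then have u: "0 < u" "u < y" "u < 1" using y by auto
    have qu: "q * u \<in> {0<..<q * y}" using u q by auto
    have qu1: "1 - u \<le> 1 - q * u" using q u by (simp add: mult_left_le_one_le)
    \<comment> \<open>Being left of \<open>y\<close> means a u < M (1 - u). Hence 1 - q u = (1 - u)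
      + (C / M) u is at most (1 + C / a) (1 - u).\<close>
    have pw: "(1 - q * u) powr \<alpha> \<le> (1 + C / a) powr max \<alpha> 0 * (1 - u) powr \<alpha>"
    proof (cases "\<alpha> \<ge> 0")
      case True
      have "u * (M + a) < M" using u(2) M a by (simp add: y_def pos_less_divide_eq)
      then have "a * u \<le> M * (1 - u)" by (simp add: algebra_simps)
      then have "C * (a * u) / (M * a) \<le> C * (M * (1 - u)) / (M * a)" using C M a by (intro divide_right_mono mult_left_mono) auto
      then have "(C / M) * u \<le> (C / a) * (1 - u)" using M a by simp
      then have "1 - q * u \<le> (1 + C / a) * (1 - u)" unfolding q(3)[symmetric] by (simp add: algebra_simps)
      moreover have "0 \<le> 1 - q * u" using qu1 u by linarith
      ultimately have "(1 - q * u) powr \<alpha> \<le> ((1 + C / a) * (1 - u)) powr \<alpha>"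
        using True by (intro powr_mono2) auto
      also have "\<dots> = (1 + C / a) powr \<alpha> * (1 - u) powr \<alpha>" using C a u by (subst powr_mult) auto
      finally show ?thesis using True by (simp add: max_def)
    next
      case False
      then have "(1 - q * u) powr \<alpha> \<le> (1 - u) powr \<alpha>" using u qu1 by (intro powr_mono2') auto
      moreover have "max \<alpha> 0 = 0" "1 + C / a \<noteq> 0" using False C a by (auto simp: add_pos_pos less_imp_neq[symmetric])
      ultimately show ?thesis by simp
    qed
    have "q * ((q * u) ^ n * (1 - q * u) powr \<alpha>) = q ^ Suc n * (u ^ n * (1 - q * u) powr \<alpha>)"
      by (simp add: power_mult_distrib)
    also have "\<dots> \<le> exp (- C) * (u ^ n * ((1 + C / a) powr max \<alpha> 0 * (1 - u) powr \<alpha>))"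
      using qn pw u by (intro mult_mono) auto
    also have "\<dots> = ?D * (u ^ n * (1 - u) powr \<alpha>)" by (simp add: dilation_const_def a_def)
    finally have "q * ((q * u) ^ n * (1 - q * u) powr \<alpha>) \<le> ?D * (u ^ n * (1 - u) powr \<alpha>)" .
    then have "ennreal (q * ((q * u) ^ n * (1 - q * u) powr \<alpha>)) \<le> ennreal (?D * (u ^ n * (1 - u) powr \<alpha>))"
      by (rule ennreal_leI)
    moreover have "0 \<le> ?D" by (simp add: dilation_const_def)
    ultimately show ?thesis using True qu q(1) by (simp add: ennreal_mult')
  next
    case False
    then have "0 + q * u \<notin> {0<..<q * y}" using q(1) by (auto simp: zero_less_mult_iff)
    then have "indicator {0<..<q * y} (0 + q * u) = (0::ennreal)" by (rule indicator_simps(2))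
    then show ?thesis by (simp only: mult_zero_left mult_zero_right zero_le)
  qed
  have "incomplete_beta \<alpha> n (q * y) = ennreal \<bar>q\<bar> * (\<integral>\<^sup>+u. ?g (q * y) (0 + q * u) \<partial>lborel)"
    unfolding incomplete_beta_def using q by (intro nn_integral_real_affine incomplete_beta_measurable) simp
  also have "\<dots> = (\<integral>\<^sup>+u. ennreal q * ?g (q * y) (0 + q * u) \<partial>lborel)"
    using q(1) by (subst nn_integral_cmult) auto
  also have "\<dots> \<le> (\<integral>\<^sup>+u. ennreal ?D * ?g y u \<partial>lborel)"
    by (intro nn_integral_mono pt)
  also have "\<dots> = ennreal ?D * incomplete_beta \<alpha> n y"
    unfolding incomplete_beta_def by (intro nn_integral_cmult) simp
  finally show ?thesis unfolding xy yy .
qed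

text \<open>The exponential decay in \<open>C\<close> beats the power. The value found depends on
  \<alpha> and \<open>S\<close> alone; this is the dependence on the overlap constant claimed for
  the covering constant.\<close>

lemma dilation_const_small:
  assumes \<alpha>: "\<alpha> > -1" and "0 \<le> S"
  obtains C where "C > 1" "dilation_const \<alpha> C * S \<le> 1 / 2"
proof -
  define a where "a = \<alpha> + 1"
  have a: "a > 0" using \<alpha> by (simp add: a_def)
  define p where "p = max \<alpha> 0"
  have p: "p \<ge> 0" by (simp add: p_def)
  \<comment> \<open>For e = exp (C / (2 (p + 1))) one has C / a \<le> (2 (p + 1) / a) e, and
    therefore (1 + C / a)^p \<le> Q e^p \<le> Q exp (C / 2). Half of the exponential decay is spent
    on the power.\<close>
  define Q where "Q = (1 + 2 * (p + 1) / a) powr p"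
  \<comment> \<open>The value 2 ensures C > 1, and the logarithm gives exp (C / 2) \<ge> 2 Q S +
    1.\<close>
  define C where "C = max 2 (2 * ln (2 * Q * S + 1))"
  have Q: "Q \<ge> 0" by (simp add: Q_def)
  have C: "C \<ge> 2" "2 * ln (2 * Q * S + 1) \<le> C" by (auto simp: C_def)
  have "dilation_const \<alpha> C \<le> Q * exp (- (C / 2))"
  proof -
    let ?e = "exp (C / (2 * (p + 1)))"
    have e: "1 \<le> ?e" "C / (2 * (p + 1)) \<le> ?e"
      using exp_ge_add_one_self[of "C / (2 * (p + 1))"] C p by (auto intro: order_trans[OF _ exp_ge_add_one_self])
    have "C / a = 2 * (p + 1) / a * (C / (2 * (p + 1)))" using p by simp
    also have "\<dots> \<le> 2 * (p + 1) / a * ?e" using p a e by (intro mult_left_mono) auto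
    finally have "1 + C / a \<le> (1 + 2 * (p + 1) / a) * ?e"
      unfolding distrib_right mult_1 using e(1) by linarith
    then have "(1 + C / a) powr p \<le> ((1 + 2 * (p + 1) / a) * ?e) powr p"
      using p C a by (intro powr_mono2) auto
    also have "\<dots> = Q * ?e powr p" using p a unfolding Q_def by (subst powr_mult) auto
    also have "?e powr p = exp (C / 2 * (p / (p + 1)))" by (simp add: powr_def)
    also have "Q * exp (C / 2 * (p / (p + 1))) \<le> Q * exp (C / 2)"
    proof -
      have "p / (p + 1) \<le> 1" using p by simp
      then have "C / 2 * (p / (p + 1)) \<le> C / 2 * 1" using C by (intro mult_left_mono) auto
      then show ?thesis using Q by (intro mult_left_mono) simp_all
    qed
    finally have "exp (- C) * (1 + C / a) powr p \<le> exp (- C) * (Q * exp (C / 2))" by (intro mult_left_mono) auto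
    also have "\<dots> = Q * exp (- C + C / 2)" by (simp only: exp_add mult_ac)
    also have "- C + C / 2 = - (C / 2)" by simp
    finally show ?thesis by (simp add: dilation_const_def a_def p_def)
  qed
  from mult_right_mono[OF this \<open>0 \<le> S\<close>] have "dilation_const \<alpha> C * S \<le> Q * S * exp (- (C / 2))"
    by (simp only: mult_ac)
  also have "\<dots> \<le> 1 / 2"
  proof -
    have pos: "0 < 2 * Q * S + 1" using Q \<open>0 \<le> S\<close> by (simp add: add_nonneg_pos)
    have "2 * Q * S + 1 = exp (ln (2 * Q * S + 1))" using pos by simp
    also have "\<dots> \<le> exp (C / 2)" using C(2) by (subst exp_le_cancel_iff) linarith
    finally have "2 * (Q * S) \<le> exp (C / 2)" by simp
    then show ?thesis by (simp add: exp_minus field_simps)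
  qed
  finally show thesis using that[of C] C by simp
qed

text \<open>Write \<delta> = 1 - y for the distance of y = m / (m + \<alpha> + 1) from 1. The piece
  between y^2 and \<open>y\<close> already contributes at least c \<delta>^(\<alpha> + 1), while the
  tail beyond \<open>y\<close> is at most B \<delta>^(\<alpha> + 1). So the tail is a bounded
  multiple of the incomplete integral, uniformly in \<open>m\<close> and \<open>n\<close>.\<close>

lemma incomplete_beta_comparison:
  assumes \<alpha>: "\<alpha> > -1"
  obtains K where "K > 0"
    "\<And>m n. n < m \<Longrightarrow> incomplete_beta \<alpha> n 1 \<le> ennreal K * incomplete_beta \<alpha> n (real m / (real m + \<alpha> + 1))"
proof -
  define a where "a = \<alpha> + 1"
  have a: "a > 0" using \<alpha> by (simp add: a_def)
  define B where "B = Beta 1 (\<alpha> + 1)"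
  have B: "B \<ge> 0" using \<alpha> unfolding B_def Beta_def
    by (intro divide_nonneg_pos mult_nonneg_nonneg Gamma_real_pos less_imp_le[OF Gamma_real_pos]) auto
  \<comment> \<open>From n < m follows y^(2n + 1) \<ge> y^(2m) \<ge> exp (-2 a), where one factor
    \<open>y\<close> belongs to the length y - y^2. The power of 2 accounts for 1 - t \<le> 2
    \<delta> when \<alpha> is negative.\<close>
  define c where "c = exp (- 2 * a) * 2 powr min \<alpha> 0"
  have c: "c > 0" by (simp add: c_def)
  show thesis
  proof (rule that)
    show "0 < 1 + B / c" using B c by (simp add: add_pos_nonneg)
    fix m n :: nat assume nm: "n < m"
    define y where "y = real m / (real m + a)"
    have yy: "real m / (real m + \<alpha> + 1) = y" by (simp add: y_def a_def add_ac)
    have y: "0 < y" "y < 1" using nm a by (auto simp: y_def)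
    define \<delta> where "\<delta> = 1 - y"
    have d: "0 < \<delta>" using y by (simp add: \<delta>_def)
    let ?g = "\<lambda>x t. indicator {0<..<x} t * ennreal (t ^ n * (1 - t) powr \<alpha>)"
    have lower: "ennreal (c * \<delta> powr a) \<le> incomplete_beta \<alpha> n y"
    proof -
      have yp: "exp (- 2 * a) \<le> y ^ (2 * n) * y"
      proof -
        have "exp (- a) \<le> y ^ m" unfolding y_def using a nm by (intro ratio_power_ge_exp) auto
        then have "exp (- a) * exp (- a) \<le> y ^ m * y ^ m" using y by (intro mult_mono) auto
        also have "\<dots> = y ^ (m + m)" by (simp add: power_add)
        also have "\<dots> \<le> y ^ Suc (2 * n)" using y nm by (intro power_decreasing) auto
        finally show ?thesis by (simp add: mult.commute flip: exp_add)
      qed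
      have pt: "ennreal (y ^ (2 * n) * (2 powr min \<alpha> 0 * \<delta> powr \<alpha>)) * indicator {y\<^sup>2<..<y} t \<le> ?g y t" for t
      proof (cases "t \<in> {y\<^sup>2<..<y}")
        case True
        then have t: "y\<^sup>2 < t" "t < y" "0 < t" by (auto intro: le_less_trans[OF zero_le_power2])
        have "(y\<^sup>2) ^ n \<le> t ^ n" using t by (intro power_mono) auto
        then have 1: "y ^ (2 * n) \<le> t ^ n" by (simp add: power_mult)
        have 2: "2 powr min \<alpha> 0 * \<delta> powr \<alpha> \<le> (1 - t) powr \<alpha>"
        proof (cases "\<alpha> \<ge> 0")
          case True
          then show ?thesis using t d y by (auto simp: min_def \<delta>_def intro!: powr_mono2)
        next
          case False
          have "1 - y\<^sup>2 = \<delta> * (1 + y)" by (simp add: \<delta>_def algebra_simps power2_eq_square)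
          also have "\<dots> \<le> \<delta> * 2" using d y by (intro mult_left_mono) auto
          finally have "1 - t \<le> 2 * \<delta>" using t by simp
          then have "(2 * \<delta>) powr \<alpha> \<le> (1 - t) powr \<alpha>" using False t y by (intro powr_mono2') auto
          then show ?thesis using False d by (simp add: powr_mult min_def)
        qed
        have "y ^ (2 * n) * (2 powr min \<alpha> 0 * \<delta> powr \<alpha>) \<le> t ^ n * (1 - t) powr \<alpha>"
          using 1 2 y t by (intro mult_mono) auto
        then show ?thesis using True t by (simp add: ennreal_leI)
      qed simp
      have "c * \<delta> powr a = exp (- 2 * a) * (2 powr min \<alpha> 0 * \<delta> powr \<alpha>) * \<delta>"
        using d by (simp add: c_def a_def powr_add)
      also have "\<dots> \<le> (y ^ (2 * n) * y) * (2 powr min \<alpha> 0 * \<delta> powr \<alpha>) * \<delta>"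
        using yp d by (intro mult_right_mono) auto
      also have "\<dots> = y ^ (2 * n) * (2 powr min \<alpha> 0 * \<delta> powr \<alpha>) * (y - y\<^sup>2)"
        by (simp add: \<delta>_def power2_eq_square algebra_simps)
      finally have "ennreal (c * \<delta> powr a) \<le> ennreal (y ^ (2 * n) * (2 powr min \<alpha> 0 * \<delta> powr \<alpha>) * (y - y\<^sup>2))"
        by (rule ennreal_leI)
      also have "\<dots> = ennreal (y ^ (2 * n) * (2 powr min \<alpha> 0 * \<delta> powr \<alpha>)) * emeasure lborel {y\<^sup>2<..<y}"
      proof -
        have "y\<^sup>2 \<le> y" using y by (simp add: power2_eq_square mult_left_le)
        then show ?thesis using y by (simp add: ennreal_mult')
      qed
      also have "\<dots> = (\<integral>\<^sup>+t. ennreal (y ^ (2 * n) * (2 powr min \<alpha> 0 * \<delta> powr \<alpha>)) * indicator {y\<^sup>2<..<y} t \<partial>lborel)"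
        by (rule nn_integral_cmult_indicator[symmetric]) simp
      also have "\<dots> \<le> incomplete_beta \<alpha> n y" unfolding incomplete_beta_def by (intro nn_integral_mono pt)
      finally show ?thesis .
    qed
    let ?h = "\<lambda>t. indicator {y<..<1} t * ennreal ((1 - t) powr \<alpha>)"
    \<comment> \<open>The affine map from the unit interval onto the tail interval scales the
      integral by \<delta>^(\<alpha> + 1), which leaves a complete beta integral.\<close>
    have tail: "(\<integral>\<^sup>+t. ?h t \<partial>lborel) = ennreal (\<delta> powr a * B)"
    proof -
      have "(\<integral>\<^sup>+t. ?h t \<partial>lborel) = ennreal \<bar>\<delta>\<bar> * (\<integral>\<^sup>+u. ?h (y + \<delta> * u) \<partial>lborel)"
        using d by (intro nn_integral_real_affine) auto
      also have "\<dots> = (\<integral>\<^sup>+u. ennreal \<delta> * ?h (y + \<delta> * u) \<partial>lborel)"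
        using d by (subst nn_integral_cmult) auto
      also have "\<dots> = (\<integral>\<^sup>+u. ennreal (\<delta> powr a) * (indicator {0<..<1} u * ennreal (u ^ 0 * (1 - u) powr \<alpha>)) \<partial>lborel)"
      proof (intro nn_integral_cong)
        fix u :: real
        have i: "y + \<delta> * u \<in> {y<..<1} \<longleftrightarrow> u \<in> {0<..<1}"
        proof -
          have "y + \<delta> * u < 1 \<longleftrightarrow> \<delta> * u < \<delta> * 1" by (auto simp: \<delta>_def)
          then show ?thesis using d by (auto simp: zero_less_mult_iff)
        qed
        have "1 - (y + \<delta> * u) = \<delta> * (1 - u)" by (simp add: \<delta>_def algebra_simps)
        then have "\<delta> * (1 - (y + \<delta> * u)) powr \<alpha> = \<delta> powr a * (1 - u) powr \<alpha>" if "u \<in> {0<..<1}"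
          using that d by (simp add: powr_mult powr_add a_def)
        then have "u \<in> {0<..<1} \<Longrightarrow> ennreal \<delta> * ennreal ((1 - (y + \<delta> * u)) powr \<alpha>) = ennreal (\<delta> powr a) * ennreal ((1 - u) powr \<alpha>)"
          using d by (simp flip: ennreal_mult')
        then show "ennreal \<delta> * ?h (y + \<delta> * u) = ennreal (\<delta> powr a) * (indicator {0<..<1} u * ennreal (u ^ 0 * (1 - u) powr \<alpha>))"
        proof (cases "u \<in> {0<..<1}")
          case False
          then have "indicator {y<..<1} (y + \<delta> * u) = (0::ennreal)" "indicator {0<..<1} u = (0::ennreal)"
            using i by (simp_all only: indicator_simps(2) not_False_eq_True)
          then show ?thesis by (simp only: mult_zero_left mult_zero_right)
        qed (use i in \<open>simp only: indicator_simps(1) mult_1 power_0\<close>)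
      qed
      also have "\<dots> = ennreal (\<delta> powr a) * incomplete_beta \<alpha> 0 1"
        unfolding incomplete_beta_def by (rule nn_integral_cmult) simp
      also have "\<dots> = ennreal (\<delta> powr a * B)"
        using incomplete_beta_1[OF \<alpha>, of 0] by (simp add: B_def ennreal_mult')
      finally show ?thesis .
    qed
    have "incomplete_beta \<alpha> n 1 \<le> (\<integral>\<^sup>+t. ?g y t + ?h t \<partial>lborel)"
      unfolding incomplete_beta_def
    proof (rule nn_integral_mono_AE)
      \<comment> \<open>The point \<open>y\<close> lies in neither of the two open intervals, hence
        the almost everywhere bound.\<close>
      show "AE t in lborel. ?g 1 t \<le> ?g y t + ?h t"
        using AE_lborel_singleton[of y]
      proof eventually_elim
        case (elim t)
        show ?case
        proof (cases "t \<in> {0<..<1} \<and> \<not> t < y")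
          case True
          then have "t ^ n * (1 - t) powr \<alpha> \<le> 1 * (1 - t) powr \<alpha>"
            by (intro mult_right_mono power_le_one) auto
          then show ?thesis using True elim by (auto simp: indicator_def intro!: ennreal_leI)
        qed (use y in \<open>auto simp: indicator_def\<close>)
      qed
    qed
    also have "\<dots> = incomplete_beta \<alpha> n y + ennreal (\<delta> powr a * B)"
      unfolding tail[symmetric] incomplete_beta_def by (rule nn_integral_add) auto
    also have "ennreal (\<delta> powr a * B) = ennreal (B / c) * ennreal (c * \<delta> powr a)"
      using B c d by (simp flip: ennreal_mult')
    also have "\<dots> \<le> ennreal (B / c) * incomplete_beta \<alpha> n y" by (intro mult_left_mono lower) simp
    also have "incomplete_beta \<alpha> n y + ennreal (B / c) * incomplete_beta \<alpha> n y = ennreal (1 + B / c) * incomplete_beta \<alpha> n y"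
      using B c by (simp add: distrib_right)
    finally show "incomplete_beta \<alpha> n 1 \<le> ennreal (1 + B / c) * incomplete_beta \<alpha> n (real m / (real m + \<alpha> + 1))"
      unfolding yy by (simp add: add_left_mono)
  qed
qed

section \<open>Sufficiency\<close>

lemma moment_comparison:
  assumes \<alpha>: "\<alpha> > -1"
  obtains K where "K > 0"
    "\<And>m n. n < m \<Longrightarrow> moment \<alpha> n 1 \<le> ennreal K * moment \<alpha> n (real m / (real m + \<alpha> + 1))"
proof -
  obtain K where K: "K > 0"
    "\<And>m n. n < m \<Longrightarrow> incomplete_beta \<alpha> n 1 \<le> ennreal K * incomplete_beta \<alpha> n (real m / (real m + \<alpha> + 1))"
    using incomplete_beta_comparison[OF \<alpha>] by blast
  show thesis
  proof (rule that[OF K(1)])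
    fix m n :: nat assume nm: "n < m"
    have "real m / (real m + \<alpha> + 1) \<le> 1" using \<alpha> nm by simp
    then show "moment \<alpha> n 1 \<le> ennreal K * moment \<alpha> n (real m / (real m + \<alpha> + 1))"
      using mult_left_mono[OF K(2)[OF nm], of "ennreal (1 + \<alpha>)"]
      by (simp add: moment_eq_incomplete_beta[OF \<alpha>] mult.left_commute)
  qed
qed

lemma moment_dilation:
  assumes \<alpha>: "\<alpha> > -1" and C: "0 < C" "C < M" and n: "M \<le> real n"
  shows "moment \<alpha> n ((M - C) / (M + \<alpha> + 1)) \<le> ennreal (dilation_const \<alpha> C) * moment \<alpha> n (M / (M + \<alpha> + 1))"
proof -
  have "(M - C) / (M + \<alpha> + 1) \<le> 1" "M / (M + \<alpha> + 1) \<le> 1" using \<alpha> C by auto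
  then show ?thesis
    using mult_left_mono[OF incomplete_beta_dilation[OF \<alpha> C n], of "ennreal (1 + \<alpha>)"]
    by (simp add: moment_eq_incomplete_beta[OF \<alpha>] mult.left_commute)
qed

text \<open>For degrees below \<open>m\<close> the full moment is comparable with the moment of the
  smaller disk, and adding the terms of higher degree only increases the right side. As
  \<open>K\<close> does not depend on \<open>a\<close> and \<open>m\<close>, finite overlap will
  turn this into the upper sampling inequality.\<close>

lemma trunc_norm_sq_shift_le_local:
  assumes \<alpha>: "\<alpha> > -1"
  obtains K where "K > 0"
    "\<And>a f m. a \<in> unit_disk \<Longrightarrow> f holomorphic_on unit_disk \<Longrightarrow>
      ennreal (trunc_norm_sq \<alpha> m (bergman_shift \<alpha> a f)) \<le>
      ennreal K * set_norm_sq \<alpha> (pseudohyp_disk a (sqrt (real m / (real m + \<alpha> + 1)))) f"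
proof -
  obtain K where K: "K > 0"
    "\<And>m n. n < m \<Longrightarrow> moment \<alpha> n 1 \<le> ennreal K * moment \<alpha> n (real m / (real m + \<alpha> + 1))"
    using moment_comparison[OF \<alpha>] by blast
  show thesis
  proof (rule that[OF K(1)])
    fix a f m assume a: "a \<in> unit_disk" and f: "f holomorphic_on unit_disk"
    let ?h = "bergman_shift \<alpha> a f"
    let ?y = "real m / (real m + \<alpha> + 1)"
    have y: "0 \<le> ?y" "?y \<le> 1" using \<alpha> by (auto simp: divide_le_eq_1)
    have h: "?h holomorphic_on unit_disk" by (rule holomorphic_bergman_shift[OF a f])
    have "ennreal (trunc_norm_sq \<alpha> m ?h) = (\<Sum>j<m. ennreal ((cmod (taylor_coeff ?h j))\<^sup>2) * moment \<alpha> j 1)"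
      unfolding ennreal_trunc_norm_sq[OF \<alpha>]
      by (intro sum.cong refl) (simp add: moment_1[OF \<alpha>] flip: ennreal_mult')
    also have "\<dots> \<le> (\<Sum>j<m. ennreal K * (ennreal ((cmod (taylor_coeff ?h j))\<^sup>2) * moment \<alpha> j ?y))"
    proof (rule sum_mono)
      fix j assume "j \<in> {..<m}"
      then have "moment \<alpha> j 1 \<le> ennreal K * moment \<alpha> j ?y" by (intro K(2)) simp
      then show "ennreal ((cmod (taylor_coeff ?h j))\<^sup>2) * moment \<alpha> j 1 \<le>
          ennreal K * (ennreal ((cmod (taylor_coeff ?h j))\<^sup>2) * moment \<alpha> j ?y)"
        unfolding mult.left_commute[of "ennreal K"] by (rule mult_left_mono) simp
    qed
    also have "\<dots> = ennreal K * (\<Sum>j<m. ennreal ((cmod (taylor_coeff ?h j))\<^sup>2) * moment \<alpha> j ?y)"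
      by (simp only: sum_distrib_left)
    also have "\<dots> \<le> ennreal K * disk_norm_sq \<alpha> ?y ?h"
      unfolding disk_norm_sq_taylor[OF \<alpha> h y(2)]
      by (intro mult_left_mono sum_le_suminf) auto
    finally show "ennreal (trunc_norm_sq \<alpha> m ?h) \<le> ennreal K * set_norm_sq \<alpha> (pseudohyp_disk a (sqrt ?y)) f"
      unfolding disk_norm_sq_bergman_shift[OF a f y(1)] .
  qed
qed

text \<open>The Parseval series is split at degree \<open>m\<close>. The terms below are bounded by
  their full moments, which is the sampling term at \<open>a\<close>; for the others the shrinking
  of the disk gains the factor \<open>dilation_const \<alpha> C\<close>.\<close>

lemma set_norm_sq_shrunk_disk_le:
  assumes \<alpha>: "\<alpha> > -1" and a: "a \<in> unit_disk" and f: "f holomorphic_on unit_disk"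
    and C: "0 < C" "C < real m"
  shows "set_norm_sq \<alpha> (pseudohyp_disk a (sqrt ((real m - C) / (real m + \<alpha> + 1)))) f
    \<le> ennreal (trunc_norm_sq \<alpha> m (bergman_shift \<alpha> a f)) +
      ennreal (dilation_const \<alpha> C) * set_norm_sq \<alpha> (pseudohyp_disk a (sqrt (real m / (real m + \<alpha> + 1)))) f"
proof -
  let ?h = "bergman_shift \<alpha> a f"
  let ?x = "(real m - C) / (real m + \<alpha> + 1)"
  let ?y = "real m / (real m + \<alpha> + 1)"
  let ?t = "\<lambda>n. ennreal ((cmod (taylor_coeff ?h n))\<^sup>2)"
  have x: "0 \<le> ?x" "?x \<le> 1" and y: "0 \<le> ?y" "?y \<le> 1"
    using \<alpha> C by (auto simp: divide_le_eq_1)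
  have h: "?h holomorphic_on unit_disk" by (rule holomorphic_bergman_shift[OF a f])
  have "disk_norm_sq \<alpha> ?x ?h = (\<Sum>n. ?t n * moment \<alpha> n ?x)" by (rule disk_norm_sq_taylor[OF \<alpha> h x(2)])
  also have "\<dots> \<le> (\<Sum>n. (if n \<in> {..<m} then ?t n * moment \<alpha> n 1 else 0) + ennreal (dilation_const \<alpha> C) * (?t n * moment \<alpha> n ?y))"
  proof (rule suminf_le)
    fix n
    show "?t n * moment \<alpha> n ?x \<le> (if n \<in> {..<m} then ?t n * moment \<alpha> n 1 else 0) + ennreal (dilation_const \<alpha> C) * (?t n * moment \<alpha> n ?y)"
    proof (cases "n < m")
      case True
      have "moment \<alpha> n ?x \<le> moment \<alpha> n 1"
        unfolding moment_eq_disk_norm_sq by (rule disk_norm_sq_mono[OF x(2)])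
      then have "?t n * moment \<alpha> n ?x \<le> ?t n * moment \<alpha> n 1 + 0" by (simp add: mult_left_mono)
      also have "\<dots> \<le> ?t n * moment \<alpha> n 1 + ennreal (dilation_const \<alpha> C) * (?t n * moment \<alpha> n ?y)"
        by (intro add_left_mono) simp
      finally show ?thesis using True by simp
    next
      case False
      then have "moment \<alpha> n ?x \<le> ennreal (dilation_const \<alpha> C) * moment \<alpha> n ?y"
        by (intro moment_dilation \<alpha> C) simp
      then have "?t n * moment \<alpha> n ?x \<le> ?t n * (ennreal (dilation_const \<alpha> C) * moment \<alpha> n ?y)"
        by (rule mult_left_mono) simp
      then show ?thesis using False by (simp add: mult.left_commute)
    qed
  qed auto
  also have "\<dots> = (\<Sum>n. if n \<in> {..<m} then ?t n * moment \<alpha> n 1 else 0) + (\<Sum>n. ennreal (dilation_const \<alpha> C) * (?t n * moment \<alpha> n ?y))"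
    by (rule suminf_add[symmetric]) auto
  also have "(\<Sum>n. if n \<in> {..<m} then ?t n * moment \<alpha> n 1 else 0) = (\<Sum>n<m. ?t n * moment \<alpha> n 1)"
    by (subst suminf_finite[of "{..<m}"]) auto
  also have "\<dots> = ennreal (trunc_norm_sq \<alpha> m ?h)"
    unfolding ennreal_trunc_norm_sq[OF \<alpha>]
    by (intro sum.cong refl) (simp add: moment_1[OF \<alpha>] flip: ennreal_mult')
  also have "(\<Sum>n. ennreal (dilation_const \<alpha> C) * (?t n * moment \<alpha> n ?y)) = ennreal (dilation_const \<alpha> C) * disk_norm_sq \<alpha> ?y ?h"
    unfolding disk_norm_sq_taylor[OF \<alpha> h y(2)] by (rule ennreal_suminf_cmult)
  finally show ?thesis
    unfolding disk_norm_sq_bergman_shift[OF a f x(1)] disk_norm_sq_bergman_shift[OF a f y(1)] .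
qed

section \<open>From single disks to the whole divisor\<close>

lemma set_norm_sq_measurable:
  assumes "A \<in> sets borel" "f holomorphic_on unit_disk"
  shows "(\<lambda>z. indicator A z * ennreal ((cmod (f z))\<^sup>2)) \<in> borel_measurable (dA \<alpha>)"
proof -
  have [measurable]: "f \<in> borel_measurable (dA \<alpha>)"
    by (intro borel_measurable_dA_continuous holomorphic_on_imp_continuous_on assms)
  have [measurable]: "indicator A \<in> borel_measurable (dA \<alpha>)"
    using assms(1) by (intro borel_measurable_dA borel_measurable_indicator)
  show ?thesis by measurable
qed

lemma sum_set_norm_sq:
  assumes F: "finite F" and A: "\<And>a. a \<in> F \<Longrightarrow> A a \<in> sets borel" and f: "f holomorphic_on unit_disk"
  shows "(\<Sum>a\<in>F. set_norm_sq \<alpha> (A a) f) = (\<integral>\<^sup>+z. (\<Sum>a\<in>F. indicator (A a) z) * ennreal ((cmod (f z))\<^sup>2) \<partial>dA \<alpha>)"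
proof -
  have "(\<Sum>a\<in>F. set_norm_sq \<alpha> (A a) f) = (\<integral>\<^sup>+z. (\<Sum>a\<in>F. indicator (A a) z * ennreal ((cmod (f z))\<^sup>2)) \<partial>dA \<alpha>)"
    unfolding set_norm_sq_def by (rule nn_integral_sum[symmetric]) (rule set_norm_sq_measurable[OF A f])
  then show ?thesis by (simp only: sum_distrib_right)
qed

text \<open>Sum and integral are interchanged for finite subsets, where the pointwise overlap bound
  applies, and the supremum is taken afterwards.\<close>

lemma infsum_set_norm_sq_le_overlap:
  assumes L: "\<Lambda> \<subseteq> unit_disk" and f: "f holomorphic_on unit_disk"
  shows "(\<Sum>\<^sub>\<infinity>a\<in>\<Lambda>. set_norm_sq \<alpha> (pseudohyp_disk a (sqrt (real (m a) / (real (m a) + \<alpha> + 1)))) f)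
    \<le> overlap_const \<alpha> \<Lambda> m * disk_norm_sq \<alpha> 1 f"
  unfolding infsum_ennreal_SUP
proof (intro SUP_least)
  let ?D = "\<lambda>a. pseudohyp_disk a (sqrt (real (m a) / (real (m a) + \<alpha> + 1)))"
  fix F assume "F \<in> {F. finite F \<and> F \<subseteq> \<Lambda>}"
  then have F: "finite F" "F \<subseteq> \<Lambda>" by auto
  have D: "?D a \<in> sets borel" if "a \<in> F" for a
    using F L that by (intro borel_open pseudohyp_disk_open) auto
  have "(\<Sum>a\<in>F. set_norm_sq \<alpha> (?D a) f) = (\<integral>\<^sup>+z. (\<Sum>a\<in>F. indicator (?D a) z) * ennreal ((cmod (f z))\<^sup>2) \<partial>dA \<alpha>)"
    by (rule sum_set_norm_sq[OF F(1) D f])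
  also have "\<dots> \<le> (\<integral>\<^sup>+z. overlap_const \<alpha> \<Lambda> m * (ennreal (disk_indicator 1 z) * ennreal ((cmod (f z))\<^sup>2)) \<partial>dA \<alpha>)"
  proof (intro nn_integral_mono)
    fix z assume "z \<in> space (dA \<alpha>)"
    then have z: "z \<in> unit_disk" by simp
    have "(\<Sum>a\<in>F. indicator (?D a) z) \<le> (\<Sum>\<^sub>\<infinity>a\<in>\<Lambda>. indicator (?D a) z :: ennreal)"
      unfolding infsum_ennreal_SUP using F by (intro SUP_upper) auto
    also have "\<dots> \<le> overlap_const \<alpha> \<Lambda> m"
      unfolding overlap_const_def by (rule SUP_upper[OF z])
    finally have "(\<Sum>a\<in>F. indicator (?D a) z) * ennreal ((cmod (f z))\<^sup>2) \<le> overlap_const \<alpha> \<Lambda> m * ennreal ((cmod (f z))\<^sup>2)"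
      by (rule mult_right_mono) simp
    moreover have "disk_indicator 1 z = 1" using z by (simp add: power_less_one_iff abs_square_less_1)
    ultimately show "(\<Sum>a\<in>F. indicator (?D a) z) * ennreal ((cmod (f z))\<^sup>2) \<le>
        overlap_const \<alpha> \<Lambda> m * (ennreal (disk_indicator 1 z) * ennreal ((cmod (f z))\<^sup>2))" by simp
  qed
  also have "\<dots> = overlap_const \<alpha> \<Lambda> m * disk_norm_sq \<alpha> 1 f"
    unfolding disk_norm_sq_def by (rule nn_integral_cmult[OF disk_norm_sq_measurable[OF f]])
  finally show "(\<Sum>a\<in>F. set_norm_sq \<alpha> (?D a) f) \<le> overlap_const \<alpha> \<Lambda> m * disk_norm_sq \<alpha> 1 f" .
qed

text \<open>The shrunk disks cover everything outside |z|^2 < R, and their local estimates are added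
  up. The last term on the right is a multiple of the left side, to be absorbed once
  \<open>dilation_const\<close> times the overlap is at most 1/2.\<close>

lemma norm_sq_le_inner_disk_plus_sample:
  assumes \<alpha>: "\<alpha> > -1" and L: "\<Lambda> \<subseteq> unit_disk" and f: "f \<in> bergman \<alpha>" and C: "0 < C"
    and cov: "unit_disk - {z. (cmod z)\<^sup>2 < R} \<subseteq>
      (\<Union>a\<in>{a\<in>\<Lambda>. real (m a) > C}. pseudohyp_disk a (sqrt ((real (m a) - C) / (real (m a) + \<alpha> + 1))))"
  shows "disk_norm_sq \<alpha> 1 f \<le> disk_norm_sq \<alpha> R f + (sample_sum \<alpha> \<Lambda> m f +
    ennreal (dilation_const \<alpha> C) * (overlap_const \<alpha> \<Lambda> m * disk_norm_sq \<alpha> 1 f))"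
proof -
  let ?D = "\<lambda>a. pseudohyp_disk a (sqrt (real (m a) / (real (m a) + \<alpha> + 1)))"
  let ?E = "\<lambda>a. pseudohyp_disk a (sqrt ((real (m a) - C) / (real (m a) + \<alpha> + 1)))"
  have hol: "f holomorphic_on unit_disk" using f by (simp add: bergman_def)
  have main: "disk_norm_sq \<alpha> x f \<le> disk_norm_sq \<alpha> R f + (sample_sum \<alpha> \<Lambda> m f +
    ennreal (dilation_const \<alpha> C) * (overlap_const \<alpha> \<Lambda> m * disk_norm_sq \<alpha> 1 f))" if x: "x < 1" for x
  proof -
    \<comment> \<open>A compact annulus, so that finitely many of the open disks suffice and only
      finite sums enter the integral. The bound does not depend on \<open>x\<close>, which then
      tends to 1.\<close>
    define Q where "Q = {z. R \<le> (cmod z)\<^sup>2 \<and> (cmod z)\<^sup>2 \<le> x}"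
    have "closed Q" unfolding Q_def
      by (intro closed_Collect_conj closed_Collect_le continuous_intros)
    moreover have Q1: "cmod z < 1" if "z \<in> Q" for z
    proof -
      have "(cmod z)\<^sup>2 < 1" using that x by (simp add: Q_def)
      then show ?thesis by (simp add: power_less_one_iff abs_square_less_1)
    qed
    moreover have "bounded Q" using Q1 by (intro boundedI[of _ 1]) (simp add: less_imp_le)
    ultimately have "compact Q" by (simp add: compact_eq_bounded_closed)
    have QD: "Q \<subseteq> (\<Union>a\<in>{a\<in>\<Lambda>. real (m a) > C}. ?E a)"
    proof -
      have "Q \<subseteq> unit_disk - {z. (cmod z)\<^sup>2 < R}"
        using Q1 by (auto simp: Q_def)
      then show ?thesis using cov by blast
    qed
    have openE: "open (?E a)" if "a \<in> {a\<in>\<Lambda>. real (m a) > C}" for a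
      using L that by (intro pseudohyp_disk_open) auto
    obtain F where F: "F \<subseteq> {a\<in>\<Lambda>. real (m a) > C}" "finite F" "Q \<subseteq> (\<Union>a\<in>F. ?E a)"
      using compactE_image[OF \<open>compact Q\<close> openE QD] by blast
    have FL: "F \<subseteq> \<Lambda>" using F(1) by auto
    have "disk_norm_sq \<alpha> x f \<le> (\<integral>\<^sup>+z. ennreal (disk_indicator R z) * ennreal ((cmod (f z))\<^sup>2) +
        (\<Sum>a\<in>F. indicator (?E a) z) * ennreal ((cmod (f z))\<^sup>2) \<partial>dA \<alpha>)"
      unfolding disk_norm_sq_def
    proof (intro nn_integral_mono)
      fix z
      have "ennreal (disk_indicator x z) \<le> ennreal (disk_indicator R z) + (\<Sum>a\<in>F. indicator (?E a) z)"
      proof (cases "z \<in> Q")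
        case True
        then obtain b where b: "b \<in> F" "z \<in> ?E b" using F(3) by blast
        have "(1::ennreal) = indicator (?E b) z" using b(2) by simp
        also have "\<dots> \<le> (\<Sum>a\<in>F. indicator (?E a) z)" using b(1) F(2) by (intro member_le_sum) auto
        finally show ?thesis using add_increasing[of "ennreal (disk_indicator R z)" "ennreal (disk_indicator x z)"]
          by (auto simp: indicator_def)
      next
        case False
        then show ?thesis by (auto simp: Q_def indicator_def)
      qed
      from mult_right_mono[OF this, of "ennreal ((cmod (f z))\<^sup>2)"]
      show "ennreal (disk_indicator x z) * ennreal ((cmod (f z))\<^sup>2) \<le> ennreal (disk_indicator R z) * ennreal ((cmod (f z))\<^sup>2) +
        (\<Sum>a\<in>F. indicator (?E a) z) * ennreal ((cmod (f z))\<^sup>2)"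
        by (simp only: distrib_right zero_le simp_thms)
    qed
    also have "\<dots> = disk_norm_sq \<alpha> R f + (\<integral>\<^sup>+z. (\<Sum>a\<in>F. indicator (?E a) z) * ennreal ((cmod (f z))\<^sup>2) \<partial>dA \<alpha>)"
      unfolding disk_norm_sq_def
    proof (rule nn_integral_add[OF disk_norm_sq_measurable[OF hol]])
      have "(\<lambda>z. \<Sum>a\<in>F. indicator (?E a) z * ennreal ((cmod (f z))\<^sup>2)) \<in> borel_measurable (dA \<alpha>)"
        using F(1) openE by (intro borel_measurable_sum set_norm_sq_measurable hol borel_open) auto
      then show "(\<lambda>z. (\<Sum>a\<in>F. indicator (?E a) z) * ennreal ((cmod (f z))\<^sup>2)) \<in> borel_measurable (dA \<alpha>)"
        by (simp only: sum_distrib_right)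
    qed
    also have "(\<integral>\<^sup>+z. (\<Sum>a\<in>F. indicator (?E a) z) * ennreal ((cmod (f z))\<^sup>2) \<partial>dA \<alpha>) = (\<Sum>a\<in>F. set_norm_sq \<alpha> (?E a) f)"
      using F(1) openE by (intro sum_set_norm_sq[symmetric] F(2) hol borel_open) auto
    also have "\<dots> \<le> (\<Sum>a\<in>F. ennreal (trunc_norm_sq \<alpha> (m a) (bergman_shift \<alpha> a f)) +
        ennreal (dilation_const \<alpha> C) * set_norm_sq \<alpha> (?D a) f)"
      using F(1) L C by (intro sum_mono set_norm_sq_shrunk_disk_le \<alpha> hol) auto
    also have "\<dots> = (\<Sum>a\<in>F. ennreal (trunc_norm_sq \<alpha> (m a) (bergman_shift \<alpha> a f))) +
        ennreal (dilation_const \<alpha> C) * (\<Sum>a\<in>F. set_norm_sq \<alpha> (?D a) f)"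
      by (simp only: sum.distrib sum_distrib_left)
    also have "\<dots> \<le> sample_sum \<alpha> \<Lambda> m f + ennreal (dilation_const \<alpha> C) * (overlap_const \<alpha> \<Lambda> m * disk_norm_sq \<alpha> 1 f)"
    proof (intro add_mono mult_left_mono)
      show "(\<Sum>a\<in>F. ennreal (trunc_norm_sq \<alpha> (m a) (bergman_shift \<alpha> a f))) \<le> sample_sum \<alpha> \<Lambda> m f"
        unfolding sample_sum_eq[OF \<alpha> L f] by (rule finite_sum_le_infsum_ennreal[OF F(2) FL])
      show "(\<Sum>a\<in>F. set_norm_sq \<alpha> (?D a) f) \<le> overlap_const \<alpha> \<Lambda> m * disk_norm_sq \<alpha> 1 f"
        by (rule order_trans[OF finite_sum_le_infsum_ennreal[OF F(2) FL] infsum_set_norm_sq_le_overlap[OF L hol]])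
    qed simp
    finally show ?thesis by (simp add: add_left_mono)
  qed
  show ?thesis
    by (subst (1) disk_norm_sq_SUP[OF hol]) (intro SUP_least main; simp)
qed

section \<open>Multiplication by powers of z\<close>

lemma disk_norm_sq_power_mult_le:
  assumes R: "0 \<le> R" "R \<le> 1" and f: "f holomorphic_on unit_disk"
  shows "disk_norm_sq \<alpha> R (\<lambda>z. z ^ k * f z) \<le> ennreal (R ^ k) * disk_norm_sq \<alpha> 1 f"
proof -
  have "disk_norm_sq \<alpha> R (\<lambda>z. z ^ k * f z) \<le>
      (\<integral>\<^sup>+z. ennreal (R ^ k) * (ennreal (disk_indicator 1 z) * ennreal ((cmod (f z))\<^sup>2)) \<partial>dA \<alpha>)"
    unfolding disk_norm_sq_def
  proof (intro nn_integral_mono)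
    fix z
    show "ennreal (disk_indicator R z) * ennreal ((cmod (z ^ k * f z))\<^sup>2) \<le>
        ennreal (R ^ k) * (ennreal (disk_indicator 1 z) * ennreal ((cmod (f z))\<^sup>2))"
    proof (cases "(cmod z)\<^sup>2 < R")
      case True
      have "(cmod (z ^ k))\<^sup>2 = ((cmod z)\<^sup>2) ^ k" by (simp add: norm_power power_mult[symmetric] mult.commute)
      also have "\<dots> \<le> R ^ k" using True by (intro power_mono) auto
      finally have "(cmod (z ^ k * f z))\<^sup>2 \<le> R ^ k * (cmod (f z))\<^sup>2"
        by (simp add: norm_mult power_mult_distrib mult_right_mono)
      then have "ennreal ((cmod (z ^ k * f z))\<^sup>2) \<le> ennreal (R ^ k) * ennreal ((cmod (f z))\<^sup>2)"
        using R by (simp add: ennreal_leI flip: ennreal_mult')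
      then show ?thesis using True R by simp
    qed simp
  qed
  also have "\<dots> = ennreal (R ^ k) * disk_norm_sq \<alpha> 1 f"
    unfolding disk_norm_sq_def by (rule nn_integral_cmult[OF disk_norm_sq_measurable[OF f]])
  finally show ?thesis .
qed

lemma power_mult_in_bergman:
  assumes "f \<in> bergman \<alpha>"
  shows "(\<lambda>z. z ^ k * f z) \<in> bergman \<alpha>"
proof -
  have f: "f holomorphic_on unit_disk" using assms by (simp add: bergman_iff)
  have "disk_norm_sq \<alpha> 1 (\<lambda>z. z ^ k * f z) \<le> disk_norm_sq \<alpha> 1 f"
    using disk_norm_sq_power_mult_le[OF _ _ f, of 1 \<alpha> k] by simp
  then show ?thesis using assms f by (auto simp: bergman_iff intro!: holomorphic_intros elim: le_less_trans)
qed

text \<open>Multiplication by z^k moves the coefficient of degree \<open>n\<close> to degree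
  \<open>n + k\<close>, and submultiplicativity of \<open>basis_coeff\<close> bounds the resulting
  change of weight by \<open>basis_coeff \<alpha> k\<close>.\<close>

lemma disk_norm_sq_power_mult_ge:
  assumes \<alpha>: "\<alpha> > -1" and f: "f holomorphic_on unit_disk"
  shows "disk_norm_sq \<alpha> 1 f \<le> ennreal (basis_coeff \<alpha> k) * disk_norm_sq \<alpha> 1 (\<lambda>z. z ^ k * f z)"
proof -
  let ?c = "basis_coeff \<alpha>"
  let ?g = "\<lambda>z. z ^ k * f z"
  let ?t = "\<lambda>n. ennreal ((cmod (taylor_coeff ?g n))\<^sup>2 / ?c n)"
  have g: "?g holomorphic_on unit_disk" by (intro holomorphic_intros f)
  have "disk_norm_sq \<alpha> 1 f = (\<Sum>n. ennreal ((cmod (taylor_coeff f n))\<^sup>2 / ?c n))"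
    by (rule disk_norm_sq_1_taylor[OF \<alpha> f])
  also have "\<dots> \<le> (\<Sum>n. ennreal (?c k) * ?t (n + k))"
  proof (rule suminf_le)
    fix n
    have pos: "0 < ?c n" "0 < ?c k" "0 < ?c (n + k)" using basis_coeff_pos[OF \<alpha>] by auto
    have "1 / ?c n = ?c k / (?c n * ?c k)" using pos by simp
    also have "\<dots> \<le> ?c k / ?c (n + k)" using pos basis_coeff_add_le[OF \<alpha>, of n k] by (intro divide_left_mono) auto
    finally have "(cmod (taylor_coeff f n))\<^sup>2 * (1 / ?c n) \<le> (cmod (taylor_coeff f n))\<^sup>2 * (?c k / ?c (n + k))"
      by (rule mult_left_mono) simp
    moreover have "taylor_coeff ?g (n + k) = taylor_coeff f n" by (simp add: taylor_coeff_power_mult[OF f])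
    ultimately have "(cmod (taylor_coeff f n))\<^sup>2 / ?c n \<le> ?c k * ((cmod (taylor_coeff ?g (n + k)))\<^sup>2 / ?c (n + k))"
      by (simp add: mult.commute)
    then show "ennreal ((cmod (taylor_coeff f n))\<^sup>2 / ?c n) \<le> ennreal (?c k) * ?t (n + k)"
      using pos by (simp add: ennreal_leI flip: ennreal_mult')
  qed auto
  also have "\<dots> = ennreal (?c k) * (\<Sum>n. ?t (n + k))" by (rule ennreal_suminf_cmult)
  also have "(\<Sum>n. ?t (n + k)) \<le> (\<Sum>n. ?t n)"
  proof (rule suminf_le_const)
    fix N
    have "(\<Sum>n<N. ?t (n + k)) = (\<Sum>n\<in>{k..<N + k}. ?t n)"
      using sum.shift_bounds_nat_ivl[of ?t 0 k N] by (simp add: atLeast0LessThan)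
    also have "\<dots> \<le> (\<Sum>n. ?t n)" by (intro sum_le_suminf) auto
    finally show "(\<Sum>n<N. ?t (n + k)) \<le> (\<Sum>n. ?t n)" .
  qed auto
  also have "(\<Sum>n. ?t n) = disk_norm_sq \<alpha> 1 ?g" by (rule disk_norm_sq_1_taylor[OF \<alpha> g, symmetric])
  finally show ?thesis by (simp add: mult_left_mono)
qed

text \<open>The shift turns the factor z^k into the k-th power of \<open>disk_aut a\<close>, a
  multiplier bounded by 1, which cannot increase any of the truncated norms.\<close>

lemma sample_sum_power_mult_le:
  assumes \<alpha>: "\<alpha> > -1" and L: "\<Lambda> \<subseteq> unit_disk" and f: "f \<in> bergman \<alpha>"
  shows "sample_sum \<alpha> \<Lambda> m (\<lambda>z. z ^ k * f z) \<le> sample_sum \<alpha> \<Lambda> m f"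
proof -
  have hol: "f holomorphic_on unit_disk" using f by (simp add: bergman_def)
  have "sample_sum \<alpha> \<Lambda> m (\<lambda>z. z ^ k * f z) \<le> 1 * sample_sum \<alpha> \<Lambda> m f"
    unfolding sample_sum_eq[OF \<alpha> L f] sample_sum_eq[OF \<alpha> L power_mult_in_bergman[OF f]]
  proof (rule ennreal_infsum_le_cmult)
    fix a assume "a \<in> \<Lambda>"
    then have a: "a \<in> unit_disk" using L by blast
    have "bergman_shift \<alpha> a (\<lambda>z. z ^ k * f z) = (\<lambda>z. disk_aut a z ^ k * bergman_shift \<alpha> a f z)"
      by (simp add: bergman_shift_eq fun_eq_iff)
    moreover have "trunc_norm_sq \<alpha> (m a) (\<lambda>z. disk_aut a z ^ k * bergman_shift \<alpha> a f z) \<le>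
        1\<^sup>2 * trunc_norm_sq \<alpha> (m a) (bergman_shift \<alpha> a f)"
    proof (rule trunc_norm_sq_mult_le[OF \<alpha>])
      show "(\<lambda>z. disk_aut a z ^ k) holomorphic_on unit_disk" by (intro holomorphic_intros a)
      show "bergman_shift \<alpha> a f holomorphic_on unit_disk" by (rule holomorphic_bergman_shift[OF a hol])
      fix z assume "z \<in> unit_disk"
      from disk_aut_in_disk[OF a this] show "cmod (disk_aut a z ^ k) \<le> 1"
        by (simp add: norm_power power_le_one)
    qed
    ultimately show "ennreal (trunc_norm_sq \<alpha> (m a) (bergman_shift \<alpha> a (\<lambda>z. z ^ k * f z))) \<le>
        1 * ennreal (trunc_norm_sq \<alpha> (m a) (bergman_shift \<alpha> a f))"
      by (simp add: ennreal_leI)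
  qed
  then show ?thesis by simp
qed

lemma sample_sum_le:
  assumes \<alpha>: "\<alpha> > -1"
  obtains K where "K > 0" "\<And>\<Lambda> m f. \<Lambda> \<subseteq> unit_disk \<Longrightarrow> f \<in> bergman \<alpha> \<Longrightarrow>
    sample_sum \<alpha> \<Lambda> m f \<le> ennreal K * (overlap_const \<alpha> \<Lambda> m * disk_norm_sq \<alpha> 1 f)"
proof -
  obtain K where K: "K > 0"
    "\<And>a f m. a \<in> unit_disk \<Longrightarrow> f holomorphic_on unit_disk \<Longrightarrow>
      ennreal (trunc_norm_sq \<alpha> m (bergman_shift \<alpha> a f)) \<le>
      ennreal K * set_norm_sq \<alpha> (pseudohyp_disk a (sqrt (real m / (real m + \<alpha> + 1)))) f"
    using trunc_norm_sq_shift_le_local[OF \<alpha>] by blast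
  show thesis
  proof (rule that[OF K(1)])
    fix \<Lambda> m f assume L: "\<Lambda> \<subseteq> unit_disk" and f: "f \<in> bergman \<alpha>"
    have hol: "f holomorphic_on unit_disk" using f by (simp add: bergman_def)
    have "sample_sum \<alpha> \<Lambda> m f \<le> ennreal K * (\<Sum>\<^sub>\<infinity>a\<in>\<Lambda>. set_norm_sq \<alpha> (pseudohyp_disk a (sqrt (real (m a) / (real (m a) + \<alpha> + 1)))) f)"
      unfolding sample_sum_eq[OF \<alpha> L f] using L by (intro ennreal_infsum_le_cmult K(2) hol) auto
    also have "\<dots> \<le> ennreal K * (overlap_const \<alpha> \<Lambda> m * disk_norm_sq \<alpha> 1 f)"
      by (intro mult_left_mono infsum_set_norm_sq_le_overlap L hol) simp
    finally show "sample_sum \<alpha> \<Lambda> m f \<le> \<dots>" .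
  qed
qed

lemma compact_subset_disk:
  assumes "compact K" "K \<subseteq> unit_disk"
  obtains R where "0 \<le> R" "R < 1" "K \<subseteq> {z. (cmod z)\<^sup>2 < R}"
proof (cases "K = {}")
  case False
  have "continuous_on K (\<lambda>z. (cmod z)\<^sup>2)" by (intro continuous_intros)
  from continuous_attains_sup[OF assms(1) False this] obtain w where
    w: "w \<in> K" "\<And>z. z \<in> K \<Longrightarrow> (cmod z)\<^sup>2 \<le> (cmod w)\<^sup>2" by blast
  have "(cmod w)\<^sup>2 < 1" using one_minus_norm_sq_pos[of w] w(1) assms(2) by auto
  show thesis
  proof (rule that[of "((cmod w)\<^sup>2 + 1) / 2"])
    show "K \<subseteq> {z. (cmod z)\<^sup>2 < ((cmod w)\<^sup>2 + 1) / 2}"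
    proof (intro subsetI CollectI)
      fix z assume "z \<in> K"
      from w(2)[OF this] \<open>(cmod w)\<^sup>2 < 1\<close> show "(cmod z)\<^sup>2 < ((cmod w)\<^sup>2 + 1) / 2" by argo
    qed
  qed (use \<open>(cmod w)\<^sup>2 < 1\<close> in auto)
qed (use that[of 0] in auto)

text \<open>Multiplication by \<open>z\<^sup>k\<close> does not increase the sampling sum, makes the mass on a smaller disk
  exponentially small in \<open>k\<close>, but decreases the norm only polynomially. For large \<open>k\<close> this
  absorbs the uncovered compact set.\<close>

lemma sampling_of_covering:
  assumes \<alpha>: "\<alpha> > -1" and div: "divisor \<Lambda> m" and S: "overlap_const \<alpha> \<Lambda> m = ennreal S" "0 \<le> S"
    and C: "0 < C" "dilation_const \<alpha> C * S \<le> 1 / 2"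
    and K: "compact K" "K \<subseteq> unit_disk"
    and cov: "(\<Union>a\<in>{a\<in>\<Lambda>. real (m a) > C}.
      pseudohyp_disk a (sqrt ((real (m a) - C) / (real (m a) + \<alpha> + 1)))) = unit_disk - K"
  shows "sampling \<alpha> \<Lambda> m"
proof -
  have L: "\<Lambda> \<subseteq> unit_disk" using div by (simp add: divisor_def)
  obtain B where B: "B > 0" "\<And>\<Lambda> m f. \<Lambda> \<subseteq> unit_disk \<Longrightarrow> f \<in> bergman \<alpha> \<Longrightarrow>
    sample_sum \<alpha> \<Lambda> m f \<le> ennreal B * (overlap_const \<alpha> \<Lambda> m * disk_norm_sq \<alpha> 1 f)"
    using sample_sum_le[OF \<alpha>] by blast
  obtain R where R: "0 \<le> R" "R < 1" "K \<subseteq> {z. (cmod z)\<^sup>2 < R}"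
    using compact_subset_disk[OF K] by blast
  \<comment> \<open>The exponent depends on \<open>K\<close> through \<open>R\<close>, whereas
    \<open>C\<close> does not. The product is compared with 1/4 because the absorption of
    \<open>G\<close> below doubles it and half of \<open>N\<close> is to remain.\<close>
  obtain k where k: "basis_coeff \<alpha> k * R ^ k < 1 / 4"
    using basis_coeff_geometric_small[OF \<alpha> R(1,2), of "1 / 4"] by auto
  define c where "c = basis_coeff \<alpha> k"
  have c: "c > 0" unfolding c_def by (rule basis_coeff_pos[OF \<alpha>])
  \<comment> \<open>The first summand serves the upper sampling inequality, the second the lower
    one.\<close>
  define C' where "C' = B * S + 4 * c"
  have C': "C' > 0" "B * S \<le> C'" "4 * c \<le> C'" using B(1) S(2) c by (auto simp: C'_def add_nonneg_pos)
  have covR: "unit_disk - {z. (cmod z)\<^sup>2 < R} \<subseteq>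
      (\<Union>a\<in>{a\<in>\<Lambda>. real (m a) > C}. pseudohyp_disk a (sqrt ((real (m a) - C) / (real (m a) + \<alpha> + 1))))"
    unfolding cov using R(3) by blast
  show ?thesis
    unfolding sampling_def
  proof (intro exI[of _ C'] conjI ballI C'(1))
    fix f assume f: "f \<in> bergman \<alpha>"
    then have hol: "f holomorphic_on unit_disk" by (simp add: bergman_def)
    define N where "N = enn2real (disk_norm_sq \<alpha> 1 f)"
    have N: "disk_norm_sq \<alpha> 1 f = ennreal N" "0 \<le> N" using f by (auto simp: N_def bergman_iff)
    \<comment> \<open>This also shows that the sampling sum is finite, which allows the remaining
      estimates to be made with real numbers.\<close>
    have upper: "sample_sum \<alpha> \<Lambda> m f \<le> ennreal (B * (S * N))"
      using B(2)[OF L f, of m] B(1) S N by (simp add: ennreal_mult')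
    define A where "A = enn2real (sample_sum \<alpha> \<Lambda> m f)"
    have "sample_sum \<alpha> \<Lambda> m f < top" using upper by (rule le_less_trans) simp
    then have A: "sample_sum \<alpha> \<Lambda> m f = ennreal A" "0 \<le> A" by (auto simp: A_def)
    have AB: "A \<le> B * (S * N)" using upper A N(2) S(2) B(1) by simp
    let ?g = "\<lambda>z. z ^ k * f z"
    have g: "?g \<in> bergman \<alpha>" by (rule power_mult_in_bergman[OF f])
    define G where "G = enn2real (disk_norm_sq \<alpha> 1 ?g)"
    have G: "disk_norm_sq \<alpha> 1 ?g = ennreal G" "0 \<le> G" using g by (auto simp: G_def bergman_iff)
    have NG: "N \<le> c * G"
      using disk_norm_sq_power_mult_ge[OF \<alpha> hol, of k] G N c unfolding c_def[symmetric]
      by (simp flip: ennreal_mult')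
    let ?d = "dilation_const \<alpha> C"
    have d: "0 \<le> ?d" by (simp add: dilation_const_def)
    have "ennreal G \<le> disk_norm_sq \<alpha> R ?g + (sample_sum \<alpha> \<Lambda> m ?g + ennreal ?d * (ennreal S * ennreal G))"
      using norm_sq_le_inner_disk_plus_sample[OF \<alpha> L g C(1) covR] unfolding G(1) S(1) .
    also have "\<dots> \<le> ennreal (R ^ k) * ennreal N + (ennreal A + ennreal ?d * (ennreal S * ennreal G))"
      using disk_norm_sq_power_mult_le[OF R(1) less_imp_le[OF R(2)] hol, of \<alpha> k]
        sample_sum_power_mult_le[OF \<alpha> L f, of m k]
      unfolding A(1) N(1) by (intro add_mono) auto
    also have "\<dots> = ennreal (R ^ k * N + (A + ?d * (S * G)))"
      using R(1) N(2) A(2) d S(2) G(2) by (simp add: ennreal_mult' ennreal_plus)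
    finally have "G \<le> R ^ k * N + (A + ?d * (S * G))"
      using R(1) N(2) A(2) d S(2) G(2) by (subst (asm) ennreal_le_iff) auto
    \<comment> \<open>This is where the choice of \<open>C\<close> enters: as \<open>G\<close> is
      finite, half of it can be moved to the left side.\<close>
    moreover have "?d * (S * G) \<le> G / 2" using mult_right_mono[OF C(2) G(2)] by (simp add: mult.assoc)
    ultimately have "G \<le> 2 * (R ^ k * N) + 2 * A" by simp
    then have "c * G \<le> c * (2 * (R ^ k * N) + 2 * A)" using c by (intro mult_left_mono) auto
    also have "\<dots> = 2 * ((c * R ^ k) * N) + 2 * c * A" by (simp add: algebra_simps)
    \<comment> \<open>Together with N \<le> c G this reads N \<le> N / 2 + 2 c A, so the mass on the
      smaller disk has been absorbed.\<close>
    also have "(c * R ^ k) * N \<le> 1 / 4 * N" using k N(2) unfolding c_def[symmetric] by (intro mult_right_mono) auto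
    finally have "N \<le> 4 * c * A" using NG by simp
    also have "\<dots> \<le> C' * A" using C'(3) A(2) by (intro mult_right_mono) auto
    finally have low: "N \<le> C' * A" .
    have "B * (S * N) \<le> C' * N" using C'(2) N(2) by (simp add: mult_right_mono flip: mult.assoc)
    then have "1 / C' * A \<le> N" using AB C'(1) by (simp add: pos_divide_le_eq mult.commute)
    then show "ennreal (1 / C') * sample_sum \<alpha> \<Lambda> m f \<le> ennreal ((bergman_norm \<alpha> f)\<^sup>2)"
      unfolding bergman_norm_sq[OF f] A(1) N(1) using C'(1) by (simp add: ennreal_leI flip: ennreal_mult')
    show "ennreal ((bergman_norm \<alpha> f)\<^sup>2) \<le> ennreal C' * sample_sum \<alpha> \<Lambda> m f"
      unfolding bergman_norm_sq[OF f] A(1) N(1) using C'(1) low by (simp add: ennreal_leI flip: ennreal_mult')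
  qed
qed

theorem theorem1p4:
  fixes \<alpha> :: real
  assumes "\<alpha> > -1"
  shows "(\<forall>\<Lambda> m. divisor \<Lambda> m \<and> sampling \<alpha> \<Lambda> m \<longrightarrow>
            finite_overlap \<alpha> \<Lambda> m \<and>
            (\<exists>C::real. 0 < C \<and> C < \<alpha> + 1 \<and>
              (\<Union>a\<in>\<Lambda>. pseudohyp_disk a (sqrt ((real (m a) + C) / (real (m a) + \<alpha> + 1))))
                = unit_disk))
       \<and> (\<forall>S::ennreal. \<exists>C::real. C > 1 \<and>
            (\<forall>\<Lambda> m. divisor \<Lambda> m \<and> finite_overlap \<alpha> \<Lambda> m \<and> overlap_const \<alpha> \<Lambda> m = S \<and>
              (\<exists>K. compact K \<and> K \<subseteq> unit_disk \<and>
                (\<Union>a\<in>{a\<in>\<Lambda>. real (m a) > C}.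
                   pseudohyp_disk a (sqrt ((real (m a) - C) / (real (m a) + \<alpha> + 1))))
                = unit_disk - K)
              \<longrightarrow> sampling \<alpha> \<Lambda> m))"
proof (intro conjI allI impI)
  fix \<Lambda> m assume "divisor \<Lambda> m \<and> sampling \<alpha> \<Lambda> m"
  then show "finite_overlap \<alpha> \<Lambda> m"
    and "\<exists>C::real. 0 < C \<and> C < \<alpha> + 1 \<and>
      (\<Union>a\<in>\<Lambda>. pseudohyp_disk a (sqrt ((real (m a) + C) / (real (m a) + \<alpha> + 1)))) = unit_disk"
    using sampling_imp_finite_overlap[OF assms] sampling_imp_covering[OF assms] by blast+
next
  fix S :: ennreal
  \<comment> \<open>For infinite \<open>S\<close> the function \<open>enn2real\<close> returns 0,
    and any such \<open>C\<close> will do, because \<open>finite_overlap\<close> rules this case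
    out.\<close>
  obtain C where C: "C > 1" "dilation_const \<alpha> C * enn2real S \<le> 1 / 2"
    using dilation_const_small[OF assms enn2real_nonneg] by blast
  show "\<exists>C::real. C > 1 \<and>
            (\<forall>\<Lambda> m. divisor \<Lambda> m \<and> finite_overlap \<alpha> \<Lambda> m \<and> overlap_const \<alpha> \<Lambda> m = S \<and>
              (\<exists>K. compact K \<and> K \<subseteq> unit_disk \<and>
                (\<Union>a\<in>{a\<in>\<Lambda>. real (m a) > C}.
                   pseudohyp_disk a (sqrt ((real (m a) - C) / (real (m a) + \<alpha> + 1))))
                = unit_disk - K)
              \<longrightarrow> sampling \<alpha> \<Lambda> m)"
  proof (intro exI[of _ C] conjI C(1) allI impI)
    fix \<Lambda> m
    assume H: "divisor \<Lambda> m \<and> finite_overlap \<alpha> \<Lambda> m \<and> overlap_const \<alpha> \<Lambda> m = S \<and>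
              (\<exists>K. compact K \<and> K \<subseteq> unit_disk \<and>
                (\<Union>a\<in>{a\<in>\<Lambda>. real (m a) > C}.
                   pseudohyp_disk a (sqrt ((real (m a) - C) / (real (m a) + \<alpha> + 1))))
                = unit_disk - K)"
    then have "S < \<infinity>" by (auto simp: finite_overlap_def)
    then have "overlap_const \<alpha> \<Lambda> m = ennreal (enn2real S)" using H by simp
    then show "sampling \<alpha> \<Lambda> m"
      using H C sampling_of_covering[OF assms, of \<Lambda> m "enn2real S" C] by auto
  qed
qed

end
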